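(* Let $\frac12<p<1$ and let $E\subset[0,1]^2$ be the random fractal percolation set with parameter $p$. Write \[ \mathcal D=\{x=(x_1,x_2)\in\mathbb R^2: x_1\notin[0,1]\text{ and }x_2\notin[0,1]\}. \] Then: (1) For every fixed $x\in\mathcal D$, the visible part $V_x(E)$ has finite $\mathcal H^1$-measure almost surely. (2) For every fixed $x\in\mathbb R^2$, almost surely on the event $x\notin E$, the visible part $V_x(E)$ has $\sigma$-finite $\mathcal H^1$-measure. (3) Conditioned on non-extinction (that is, on $E\neq\emptyset$), almost surely $0<\mathcal H^1(V_x(E))<\infty$ for $\mathcal L^2$-almost all $x\in\mathcal D$, and $V_x(E)$ has positive and $\sigma$-finite $\mathcal H^1$-measure for $\mathcal L^2$-almost all $x\in\mathbb R^2\setminus E$.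
   Context: Fractal percolation: let $0<p<1$ and $Q_0=[0,1]\times[0,1]$. Divide $Q_0$ into four closed subsquares of equal size; each is chosen with probability $p$ and dropped with probability $1-p$, independently of each other. Let $\mathcal C_1$ be the collection of chosen subsquares. Each $Q\in\mathcal C_1$ is again divided into four subsquares of equal size, each chosen with probability $p$ independently; the collection of all chosen squares at the second level is $\mathcal C_2$. Continue inductively to define $\mathcal C_n$ (consisting of squares of side length $2^{-n}$), and set $E=\bigcap_{n=1}^\infty\bigcup\{Q: Q\in\mathcal C_n\}$. The probability measure induced on the space of constructions is $\mathbf P$. Visible part: for compact $E\subset\mathbb R^2$ and $x\in\mathbb R^2\setminus E$, $V_x(E)=\{a\in E: [a,x]\cap E=\{a\}\}$, where $[a,x]$ is the closed line segment from $a$ to $x$. $\mathcal H^1$ is the 1-dimensional Hausdorff measure and $\mathcal L^2$ is Lebesgue measure on $\mathbb R^2$. *)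

theory Defs
  imports "HOL-Probability.Probability"
begin

text \<open>The Hausdorff (outer) measure of dimension one, defined on all subsets. Covering sets are
  required to be bounded because \<^const>\<open>diameter\<close> is real-valued and carries no information
  on unbounded sets.\<close>

definition hausdorff1_delta :: "real \<Rightarrow> 'a::metric_space set \<Rightarrow> ennreal" where
  "hausdorff1_delta \<delta> A =
     (INF U \<in> {U :: nat \<Rightarrow> 'a set. A \<subseteq> (\<Union>i. U i) \<and> (\<forall>i. bounded (U i) \<and> diameter (U i) \<le> \<delta>)}.
        (\<Sum>i. ennreal (diameter (U i))))"

definition hausdorff1 :: "'a::metric_space set \<Rightarrow> ennreal" where
  "hausdorff1 A = (SUP \<delta> \<in> {0<..}. hausdorff1_delta \<delta> A)"

definition sigma_finite_hausdorff1 :: "'a::metric_space set \<Rightarrow> bool" where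
  "sigma_finite_hausdorff1 A \<longleftrightarrow>
     (\<exists>B :: nat \<Rightarrow> 'a set. A = (\<Union>i. B i) \<and> (\<forall>i. hausdorff1 (B i) < \<infinity>))"

text \<open>The triple \<open>(n, i, j)\<close> with \<open>i, j < 2 ^ n\<close> encodes the closed dyadic square of side
  length \<open>2 ^ -n\<close> with lower left corner \<open>(i / 2 ^ n, j / 2 ^ n)\<close>. On the type
  \<^typ>\<open>real \<times> real\<close> the metric is Euclidean and \<^const>\<open>cbox\<close> is a closed rectangle.\<close>

definition dyadic_square :: "nat \<Rightarrow> nat \<times> nat \<Rightarrow> (real \<times> real) set" where
  "dyadic_square n = (\<lambda>(i, j).
     cbox (real i / 2 ^ n, real j / 2 ^ n) (real (i + 1) / 2 ^ n, real (j + 1) / 2 ^ n))"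

definition subsquares :: "nat \<times> nat \<Rightarrow> (nat \<times> nat) set" where
  "subsquares = (\<lambda>(i, j). {2 * i, 2 * i + 1} \<times> {2 * j, 2 * j + 1})"

definition square_labels :: "(nat \<times> nat \<times> nat) set" where
  "square_labels = {(n, i, j). 1 \<le> n \<and> i < 2 ^ n \<and> j < 2 ^ n}"

text \<open>A construction assigns to every dyadic square of level at least one the outcome of its own
  coin toss (\<^const>\<open>True\<close>: chosen). Tosses are made for all squares, but the toss of a square
  takes effect only if its parent belongs to the preceding collection, so the induced law of the
  collections is that of the inductive construction.\<close>

definition percolation :: "real \<Rightarrow> (nat \<times> nat \<times> nat \<Rightarrow> bool) measure" where
  "percolation p = PiM square_labels (\<lambda>_. measure_pmf (bernoulli_pmf p))"

primrec chosen_squares :: "(nat \<times> nat \<times> nat \<Rightarrow> bool) \<Rightarrow> nat \<Rightarrow> (nat \<times> nat) set" where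
  "chosen_squares \<omega> 0 = {(0, 0)}"
| "chosen_squares \<omega> (Suc n) =
     {q \<in> (\<Union>r \<in> chosen_squares \<omega> n. subsquares r). \<omega> (Suc n, q)}"

definition percolation_set :: "(nat \<times> nat \<times> nat \<Rightarrow> bool) \<Rightarrow> (real \<times> real) set" where
  "percolation_set \<omega> = (\<Inter>n\<in>{1..}. \<Union>q \<in> chosen_squares \<omega> n. dyadic_square n q)"

definition visible_part :: "'a::euclidean_space \<Rightarrow> 'a set \<Rightarrow> 'a set" where
  "visible_part x E = {a \<in> E. closed_segment a x \<inter> E = {a}}"

definition diagonal_region :: "(real \<times> real) set" where
  "diagonal_region = {(x1, x2). x1 \<notin> {0..1} \<and> x2 \<notin> {0..1}}"

end

theory Submission
  imports Defs "HOL-Real_Asymp.Real_Asymp"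
begin

text \<open>Upper bound. Fix \<open>x\<close> and consider lines through \<open>x\<close> of positive slope bounded away from
  the axes. For \<open>p > 1 / 2\<close> the total chord of such a line in the chosen squares of level \<open>n\<close> grows
  by a factor close to \<open>2 p\<close> relative to the side length, with super-exponentially small failure
  probability by Hoeffding's inequality. A net argument therefore gives a positive probability that
  the percolation set meets all lines crossing the unit square non-marginally. Cut the lines through \<open>x\<close>
  into \<open>O(2 ^ n)\<close> thin tubes. Each chosen square that a tube crosses properly blocks the tube with
  probability bounded below, independently of the others, so the expected number of chosen squares
  seen before the first blocking one is \<open>O(1)\<close> per tube. Squares crossed only near a corner sit at a
  corner of a properly crossed ancestor and are counted there. Fatou's lemma then bounds the
  Hausdorff measure. The other directions follow by rotating the construction.

  Lower bound. By a zero-one law for branching trees, almost surely every surviving square contains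
  a smaller square that meets all lines crossing it properly. From any \<open>x\<close> outside the set, an
  interval of slopes is then hit, and the slope is a Lipschitz function of the visible point.\<close>

text \<open>A line that clips a square near a corner has a short chord, and its probability of being
  hit there has no positive lower bound. This obstacle shapes the definitions:
  \<open>crossing_line\<close> demands a margin \<open>g\<close> at the two critical corners and a
  slope parameter in [1/m, m], and lines without the margin are treated separately by
  \<open>bad_squares_corner\<close>. The margin occurs in three sizes: 3g for the line of sight to a
  visible point, 2g for the representative direction of its tube, and g after the way back from the
  representative to the line of sight. \<open>mesh\<close> is the tube width for which each passage
  costs one g. The counting rests on one independence: whether a square is reached without earlier
  blocking depends on no coin strictly below it, so the mean count in a tube is at most the
  reciprocal of the blocking probability, at every level. For almost all x two different arguments
  are used. Finiteness is proved for each fixed x and carried over by Fubini's theorem. Positivity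
  holds off a single null set of configurations, for all x that avoid the axis-parallel lines
  through some point of the set.\<close>

type_synonym config = "nat \<times> nat \<times> nat \<Rightarrow> bool"

section \<open>The tree of chosen squares\<close>

definition grid :: "nat \<Rightarrow> (nat \<times> nat) set" where
  "grid n = {..<2 ^ n} \<times> {..<2 ^ n}"

text \<open>\<open>n\<close> counts generations upwards: a square of level \<open>k + n\<close> has
  this ancestor at level \<open>k\<close>.\<close>

definition ancestor :: "nat \<Rightarrow> nat \<times> nat \<Rightarrow> nat \<times> nat" where
  "ancestor n q = (fst q div 2 ^ n, snd q div 2 ^ n)"

text \<open>Here \<open>n\<close> is the level of \<open>r\<close>, which addresses a piece of
  \<open>q\<close> as if \<open>q\<close> were the unit square.\<close>

definition graft :: "nat \<Rightarrow> nat \<times> nat \<Rightarrow> nat \<times> nat \<Rightarrow> nat \<times> nat" where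
  "graft n q r = (2 ^ n * fst q + fst r, 2 ^ n * snd q + snd r)"

text \<open>The restriction to \<open>square_labels\<close> makes the result a point of the product
  space again, so that it can have the law of the whole construction. The toss of \<open>q\<close>
  itself is left out.\<close>

definition subtree :: "nat \<Rightarrow> nat \<times> nat \<Rightarrow> config \<Rightarrow> config" where
  "subtree k q \<omega> = (\<lambda>l\<in>square_labels. \<omega> (k + fst l, graft (fst l) q (snd l)))"

lemma finite_grid [simp, intro]: "finite (grid n)"
  by (simp add: grid_def)

lemma mem_grid_iff: "q \<in> grid n \<longleftrightarrow> fst q < 2 ^ n \<and> snd q < 2 ^ n"
  by (cases q) (simp add: grid_def)

lemma mem_square_labels_iff: "(n, q) \<in> square_labels \<longleftrightarrow> 1 \<le> n \<and> q \<in> grid n"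
  by (cases q) (simp add: square_labels_def grid_def)

lemma mem_subsquares_iff: "q \<in> subsquares r \<longleftrightarrow> r = ancestor 1 q"
  by (cases q; cases r) (auto simp: subsquares_def ancestor_def)

lemma ancestor_0 [simp]: "ancestor 0 q = q"
  by (simp add: ancestor_def)

lemma ancestor_ancestor [simp]: "ancestor a (ancestor b q) = ancestor (a + b) q"
  by (simp add: ancestor_def power_add mult.commute flip: div_mult2_eq)

lemma ancestor_in_grid: "q \<in> grid (k + n) \<Longrightarrow> ancestor n q \<in> grid k"
  by (auto simp: mem_grid_iff ancestor_def power_add less_mult_imp_div_less)

lemma ancestor_graft [simp]: "r \<in> grid n \<Longrightarrow> ancestor n (graft n q r) = q"
  by (cases q) (auto simp: mem_grid_iff ancestor_def graft_def)

lemma ancestor_graft_le: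
  assumes "i \<le> n"
  shows "ancestor i (graft n q r) = graft (n - i) q (ancestor i r)"
proof -
  have "(2::nat) ^ n = 2 ^ i * 2 ^ (n - i)"
    using assms by (simp flip: power_add)
  then show ?thesis
    by (simp add: ancestor_def graft_def mult.assoc)
qed

lemma graft_in_grid: "q \<in> grid k \<Longrightarrow> r \<in> grid n \<Longrightarrow> graft n q r \<in> grid (k + n)"
proof -
  have *: "2 ^ n * a + b < 2 ^ (k + n)" if "a < 2 ^ k" "b < 2 ^ n" for a b :: nat
  proof -
    have "2 ^ n * a + b < 2 ^ n * (a + 1)"
      using that by simp
    also have "\<dots> \<le> 2 ^ n * 2 ^ k"
      using that by (intro mult_left_mono) auto
    finally show ?thesis
      by (simp add: power_add mult.commute)
  qed
  then show "q \<in> grid k \<Longrightarrow> r \<in> grid n \<Longrightarrow> ?thesis"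
    by (simp add: mem_grid_iff graft_def)
qed

lemma graft_cases:
  assumes "c \<in> grid (k + n)"
  obtains q r where "q \<in> grid k" "r \<in> grid n" "c = graft n q r"
proof
  show "ancestor n c \<in> grid k"
    using assms by (rule ancestor_in_grid)
  show "(fst c mod 2 ^ n, snd c mod 2 ^ n) \<in> grid n"
    by (simp add: mem_grid_iff)
  show "c = graft n (ancestor n c) (fst c mod 2 ^ n, snd c mod 2 ^ n)"
    by (cases c) (simp add: graft_def ancestor_def)
qed

lemma graft_inj: "r \<in> grid n \<Longrightarrow> r' \<in> grid n \<Longrightarrow> graft n q r = graft n q' r' \<Longrightarrow> q = q' \<and> r = r'"
proof -
  assume r: "r \<in> grid n" "r' \<in> grid n" and eq: "graft n q r = graft n q' r'"
  have "q = q'"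
    using r eq by (metis ancestor_graft)
  with eq show ?thesis
    by (cases r; cases r') (simp add: graft_def)
qed

lemma graft_graft: "graft n (graft k q r) s = graft (k + n) q (graft n r s)"
  by (simp add: graft_def power_add algebra_simps)

lemma chosen_squares_Suc_iff:
  "q \<in> chosen_squares \<omega> (Suc n) \<longleftrightarrow> ancestor 1 q \<in> chosen_squares \<omega> n \<and> \<omega> (Suc n, q)"
  by (auto simp: mem_subsquares_iff)

declare chosen_squares.simps(2) [simp del]

lemma chosen_squares_subset_grid: "chosen_squares \<omega> n \<subseteq> grid n"
proof (induction n)
  case (Suc n)
  have "q \<in> grid (Suc n)" if "ancestor 1 q \<in> grid n" for q
    using that by (auto simp: mem_grid_iff ancestor_def)
  with Suc show ?case
    by (auto simp: chosen_squares_Suc_iff)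
qed (simp add: grid_def)

lemma finite_chosen_squares [simp, intro]: "finite (chosen_squares \<omega> n)"
  using chosen_squares_subset_grid finite_grid by (rule finite_subset)

lemma ancestor_chosen: "q \<in> chosen_squares \<omega> (k + n) \<Longrightarrow> ancestor n q \<in> chosen_squares \<omega> k"
proof (induction n arbitrary: q)
  case (Suc n)
  then have "ancestor 1 q \<in> chosen_squares \<omega> (k + n)"
    by (simp add: chosen_squares_Suc_iff)
  from Suc.IH[OF this] show ?case
    by simp
qed simp

text \<open>Self-similarity: below \<open>q\<close> the selection rule reads the same tosses as a
  construction in the unit square with relabelled coins, generation by generation.\<close>

lemma chosen_squares_graft:
  assumes "q \<in> grid k" "r \<in> grid n"
  shows "graft n q r \<in> chosen_squares \<omega> (k + n) \<longleftrightarrow>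
    q \<in> chosen_squares \<omega> k \<and> r \<in> chosen_squares (subtree k q \<omega>) n"
  using assms(2)
proof (induction n arbitrary: r)
  case 0
  then show ?case
    by (auto simp: grid_def graft_def)
next
  case (Suc n)
  have 1: "ancestor 1 r \<in> grid n"
    using Suc.prems ancestor_in_grid[of r n 1] by simp
  have 2: "ancestor 1 (graft (Suc n) q r) = graft n q (ancestor 1 r)"
    by (simp add: ancestor_graft_le)
  have 3: "subtree k q \<omega> (Suc n, r) = \<omega> (k + Suc n, graft (Suc n) q r)"
    using Suc.prems by (simp add: subtree_def mem_square_labels_iff)
  show ?case
    using Suc.IH[OF 1] 2 3 by (simp add: chosen_squares_Suc_iff)
qed

lemma subtree_subtree:
  assumes "r \<in> grid n"
  shows "subtree n r (subtree k q \<omega>) = subtree (k + n) (graft n q r) \<omega>"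
proof
  fix l :: "nat \<times> nat \<times> nat"
  obtain m s where l: "l = (m, s)" by (cases l)
  show "subtree n r (subtree k q \<omega>) l = subtree (k + n) (graft n q r) \<omega> l"
  proof (cases "l \<in> square_labels")
    case True
    then have "(n + m, graft m r s) \<in> square_labels"
      using assms l graft_in_grid[of r n s m] by (simp add: mem_square_labels_iff)
    with True show ?thesis
      by (simp add: subtree_def l graft_graft add.assoc)
  qed (simp add: subtree_def)
qed

definition survives :: "config \<Rightarrow> bool" where
  "survives \<omega> \<longleftrightarrow> (\<forall>n. chosen_squares \<omega> n \<noteq> {})"

lemma chosen_squares_nonempty_antimono:
  assumes "chosen_squares \<omega> n \<noteq> {}" "k \<le> n"
  shows "chosen_squares \<omega> k \<noteq> {}"
  using assms ancestor_chosen[of _ \<omega> k "n - k"] by auto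

text \<open>Emptiness persists to deeper levels. The infinitely-often form distributes over finite
  disjunctions, which the pigeonhole argument of \<open>percolation_set_subtree\<close>
  uses.\<close>

lemma survives_iff_eventually: "survives \<omega> \<longleftrightarrow> (\<exists>\<^sub>\<infinity>n. chosen_squares \<omega> n \<noteq> {})"
  unfolding survives_def INFM_nat_le
  by (metis chosen_squares_nonempty_antimono nle_le)

section \<open>Geometry of the percolation set\<close>

lemma mem_dyadic_square_iff:
  "z \<in> dyadic_square n q \<longleftrightarrow>
     real (fst q) \<le> 2 ^ n * fst z \<and> 2 ^ n * fst z \<le> real (fst q) + 1 \<and>
     real (snd q) \<le> 2 ^ n * snd z \<and> 2 ^ n * snd z \<le> real (snd q) + 1"
  by (cases q; cases z)
     (auto simp: dyadic_square_def cbox_Pair_eq field_simps)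

lemma dyadic_square_ancestor: "dyadic_square (k + n) q \<subseteq> dyadic_square k (ancestor n q)"
proof -
  have *: "real (a div 2 ^ n) \<le> 2 ^ k * t \<and> 2 ^ k * t \<le> real (a div 2 ^ n) + 1"
    if "real a \<le> 2 ^ (k + n) * t" "2 ^ (k + n) * t \<le> real a + 1" for a :: nat and t :: real
  proof -
    have "2 ^ n * (a div 2 ^ n) \<le> a"
      by simp
    then have "real (2 ^ n * (a div 2 ^ n)) \<le> real a"
      by (simp only: of_nat_le_iff)
    then have "2 ^ n * real (a div 2 ^ n) \<le> real a"
      by simp
    also have "real a \<le> 2 ^ n * (2 ^ k * t)"
      using that by (simp add: power_add mult_ac)
    finally have 1: "2 ^ n * real (a div 2 ^ n) \<le> 2 ^ n * (2 ^ k * t)" .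
    have "a + 1 \<le> 2 ^ n * (a div 2 ^ n + 1)"
      using dividend_less_times_div[of "2 ^ n" a] by simp
    then have "real (a + 1) \<le> real (2 ^ n * (a div 2 ^ n + 1))"
      by (simp only: of_nat_le_iff)
    then have 2: "2 ^ n * (2 ^ k * t) \<le> 2 ^ n * (real (a div 2 ^ n) + 1)"
      using that by (simp add: power_add algebra_simps)
    show ?thesis
      using 1 2 by simp
  qed
  show ?thesis
    using *[of "fst q"] *[of "snd q"] by (auto simp: mem_dyadic_square_iff ancestor_def)
qed

lemma compact_dyadic_square [simp]: "compact (dyadic_square n q)"
  by (simp add: dyadic_square_def case_prod_beta)

definition level_set :: "config \<Rightarrow> nat \<Rightarrow> (real \<times> real) set" where
  "level_set \<omega> n = (\<Union>q \<in> chosen_squares \<omega> n. dyadic_square n q)"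

lemma compact_level_set [simp]: "compact (level_set \<omega> n)"
  unfolding level_set_def by (intro compact_UN) auto

lemma level_set_antimono: "m \<le> n \<Longrightarrow> level_set \<omega> n \<subseteq> level_set \<omega> m"
  using ancestor_chosen[of _ \<omega> m "n - m"] dyadic_square_ancestor[of m "n - m"]
  unfolding level_set_def by fastforce

lemma percolation_set_eq: "percolation_set \<omega> = (\<Inter>n. level_set \<omega> n)"
proof -
  have "z \<in> level_set \<omega> 0" if "z \<in> level_set \<omega> 1" for z
    using level_set_antimono[of 0 1 \<omega>] that by auto
  then have "(\<Inter>n\<in>{1..}. level_set \<omega> n) \<subseteq> (\<Inter>n. level_set \<omega> n)"
    by (auto, metis One_nat_def atLeast_iff not_less_eq_eq le0 le_antisym)
  then show ?thesis
    unfolding percolation_set_def level_set_def by blast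
qed

lemma compact_percolation_set [simp]: "compact (percolation_set \<omega>)"
  unfolding percolation_set_eq by (intro compact_Inter) auto

lemma percolation_set_subset_unit: "percolation_set \<omega> \<subseteq> {0..1} \<times> {0..1}"
proof -
  have "level_set \<omega> 0 \<subseteq> {0..1} \<times> {0..1}"
    by (auto simp: level_set_def mem_dyadic_square_iff)
  then show ?thesis
    unfolding percolation_set_eq by blast
qed

text \<open>Cantor's intersection theorem for the nested compact level sets. It lets statements
  about the limit set be checked at each finite level.\<close>

lemma percolation_set_meets_compact:
  assumes "compact K" "\<And>n. level_set \<omega> n \<inter> K \<noteq> {}"
  shows "percolation_set \<omega> \<inter> K \<noteq> {}"
proof -
  have "(\<Inter>n. level_set \<omega> n \<inter> K) \<noteq> {}"
    using assms level_set_antimono[of _ _ \<omega>]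
    by (intro compact_nest) (force simp: compact_Int)+
  then show ?thesis
    unfolding percolation_set_eq by blast
qed

lemma percolation_set_nonempty_iff: "percolation_set \<omega> \<noteq> {} \<longleftrightarrow> survives \<omega>"
proof
  assume "percolation_set \<omega> \<noteq> {}"
  then show "survives \<omega>"
    unfolding percolation_set_eq survives_def level_set_def by fastforce
next
  have ne: "(real (fst q) / 2 ^ n, real (snd q) / 2 ^ n) \<in> dyadic_square n q" for n q
    by (simp add: mem_dyadic_square_iff)
  assume "survives \<omega>"
  then have "level_set \<omega> n \<inter> level_set \<omega> 0 \<noteq> {}" for n
    using ne level_set_antimono[of 0 n \<omega>] unfolding survives_def level_set_def by fastforce
  then show "percolation_set \<omega> \<noteq> {}"
    using percolation_set_meets_compact[of "level_set \<omega> 0"] by auto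
qed

definition zoom_in :: "nat \<Rightarrow> nat \<times> nat \<Rightarrow> real \<times> real \<Rightarrow> real \<times> real" where
  "zoom_in k q z = ((real (fst q) + fst z) / 2 ^ k, (real (snd q) + snd z) / 2 ^ k)"

lemma zoom_in_mem_dyadic_square:
  "z \<in> dyadic_square n r \<Longrightarrow> zoom_in k q z \<in> dyadic_square (k + n) (graft n q r)"
proof -
  have "2 ^ (k + n) * ((real a + t) / 2 ^ k) = 2 ^ n * real a + 2 ^ n * t" for a :: nat and t :: real
    by (simp add: power_add field_simps)
  then show "z \<in> dyadic_square n r \<Longrightarrow> ?thesis"
    by (simp add: mem_dyadic_square_iff zoom_in_def graft_def)
qed

lemma zoom_in_percolation_set:
  assumes "q \<in> chosen_squares \<omega> k" "z \<in> percolation_set (subtree k q \<omega>)"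
  shows "zoom_in k q z \<in> percolation_set \<omega>"
proof -
  have "zoom_in k q z \<in> level_set \<omega> (k + n)" for n
  proof -
    obtain r where "r \<in> chosen_squares (subtree k q \<omega>) n" "z \<in> dyadic_square n r"
      using assms unfolding percolation_set_eq level_set_def by blast
    then have "graft n q r \<in> chosen_squares \<omega> (k + n)"
      using assms chosen_squares_graft[of q k r n \<omega>] chosen_squares_subset_grid by blast
    with \<open>z \<in> dyadic_square n r\<close> show ?thesis
      unfolding level_set_def using zoom_in_mem_dyadic_square by blast
  qed
  then show ?thesis
    unfolding percolation_set_eq
    using level_set_antimono[OF le_add2] by blast
qed

text \<open>A point on a common edge lies in several squares of level \<open>k\<close>, some perhaps
  with extinct subtrees. For every \<open>n\<close> one of them survives \<open>n\<close> further
  levels; as there are finitely many squares, one serves infinitely many \<open>n\<close> and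
  therefore survives.\<close>

lemma percolation_set_subtree:
  assumes "a \<in> percolation_set \<omega>"
  obtains q where "q \<in> chosen_squares \<omega> k" "a \<in> dyadic_square k q" "survives (subtree k q \<omega>)"
proof -
  have "\<exists>q\<in>chosen_squares \<omega> k. a \<in> dyadic_square k q \<and> chosen_squares (subtree k q \<omega>) n \<noteq> {}" for n
  proof -
    obtain c where c: "c \<in> chosen_squares \<omega> (k + n)" "a \<in> dyadic_square (k + n) c"
      using assms unfolding percolation_set_eq level_set_def by blast
    then have "c \<in> grid (k + n)"
      using chosen_squares_subset_grid by blast
    then obtain q r where qr: "q \<in> grid k" "r \<in> grid n" "c = graft n q r"
      by (rule graft_cases)
    with c have "q \<in> chosen_squares \<omega> k" "r \<in> chosen_squares (subtree k q \<omega>) n"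
      using chosen_squares_graft by blast+
    moreover have "a \<in> dyadic_square k q"
      using c dyadic_square_ancestor[of k n c] qr by auto
    ultimately show ?thesis by blast
  qed
  then have "\<exists>\<^sub>\<infinity>n. \<exists>q\<in>chosen_squares \<omega> k. a \<in> dyadic_square k q \<and> chosen_squares (subtree k q \<omega>) n \<noteq> {}"
    unfolding INFM_nat_le by blast
  then obtain q where "q \<in> chosen_squares \<omega> k"
    "\<exists>\<^sub>\<infinity>n. a \<in> dyadic_square k q \<and> chosen_squares (subtree k q \<omega>) n \<noteq> {}"
    by (auto simp: INFM_finite_Bex_distrib)
  then show ?thesis
    using that by (auto simp: survives_iff_eventually frequently_const_iff)
qed

lemma survives_if_subtree:
  assumes "q \<in> chosen_squares \<omega> k" "survives (subtree k q \<omega>)"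
  shows "survives \<omega>"
  using assms zoom_in_percolation_set[OF assms(1)] percolation_set_nonempty_iff by blast

lemma chosen_squares_1_iff: "q \<in> chosen_squares \<omega> 1 \<longleftrightarrow> q \<in> grid 1 \<and> \<omega> (1, q)"
proof -
  have "ancestor 1 q = (0, 0) \<longleftrightarrow> q \<in> grid 1"
    by (auto simp: ancestor_def mem_grid_iff)
  then show ?thesis
    using chosen_squares_Suc_iff[of q \<omega> 0] by simp
qed

lemma survives_iff_child: "survives \<omega> \<longleftrightarrow> (\<exists>q\<in>grid 1. \<omega> (1, q) \<and> survives (subtree 1 q \<omega>))"
proof
  assume "survives \<omega>"
  then obtain a where "a \<in> percolation_set \<omega>"
    using percolation_set_nonempty_iff by blast
  then obtain q where "q \<in> chosen_squares \<omega> 1" "survives (subtree 1 q \<omega>)"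
    by (rule percolation_set_subtree)
  then show "\<exists>q\<in>grid 1. \<omega> (1, q) \<and> survives (subtree 1 q \<omega>)"
    using chosen_squares_1_iff by blast
next
  assume "\<exists>q\<in>grid 1. \<omega> (1, q) \<and> survives (subtree 1 q \<omega>)"
  then show "survives \<omega>"
    using chosen_squares_1_iff survives_if_subtree by blast
qed

section \<open>The percolation measure\<close>

text \<open>A pointwise substitute for measurability with respect to the coins in \<open>I\<close>,
  checked by congruence alone; \<open>prob_conj_independent\<close> turns it into
  independence.\<close>

definition determined_by :: "(('l \<Rightarrow> bool) \<Rightarrow> bool) \<Rightarrow> 'l set \<Rightarrow> bool" where
  "determined_by P I \<longleftrightarrow> (\<forall>\<omega> \<omega>'. (\<forall>l\<in>I. \<omega> l = \<omega>' l) \<longrightarrow> P \<omega> = P \<omega>')"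

definition labels_upto :: "nat \<Rightarrow> (nat \<times> nat \<times> nat) set" where
  "labels_upto k = {l. fst l \<le> k}"

text \<open>The tosses that \<open>subtree k q\<close> reads. Because of \<open>1 \<le> n\<close>
  the toss of \<open>q\<close> is not among them.\<close>

definition labels_below :: "nat \<Rightarrow> nat \<times> nat \<Rightarrow> (nat \<times> nat \<times> nat) set" where
  "labels_below k q = {(k + n, graft n q r) | n r. 1 \<le> n \<and> r \<in> grid n}"

lemma determined_byI:
  "(\<And>\<omega> \<omega>'. (\<And>l. l \<in> I \<Longrightarrow> \<omega> l = \<omega>' l) \<Longrightarrow> P \<omega> = P \<omega>') \<Longrightarrow> determined_by P I"
  unfolding determined_by_def by blast

lemma determined_byD:
  "determined_by P I \<Longrightarrow> (\<And>l. l \<in> I \<Longrightarrow> \<omega> l = \<omega>' l) \<Longrightarrow> P \<omega> = P \<omega>'"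
  unfolding determined_by_def by blast

lemma chosen_squares_cong:
  "(\<And>l. l \<in> labels_upto n \<Longrightarrow> \<omega> l = \<omega>' l) \<Longrightarrow> chosen_squares \<omega> n = chosen_squares \<omega>' n"
proof (induction n)
  case (Suc n)
  from Suc have "chosen_squares \<omega> n = chosen_squares \<omega>' n"
    by (simp add: labels_upto_def)
  then show ?case
    using Suc.prems by (auto simp: chosen_squares_Suc_iff labels_upto_def)
qed simp

lemma subtree_cong:
  "(\<And>l. l \<in> labels_below k q \<Longrightarrow> \<omega> l = \<omega>' l) \<Longrightarrow> subtree k q \<omega> = subtree k q \<omega>'"
  unfolding subtree_def
proof (rule restrict_ext)
  fix l :: "nat \<times> nat \<times> nat" assume "l \<in> square_labels"
  then have "(k + fst l, graft (fst l) q (snd l)) \<in> labels_below k q"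
    by (cases l) (auto simp: labels_below_def mem_square_labels_iff)
  moreover assume "\<And>l. l \<in> labels_below k q \<Longrightarrow> \<omega> l = \<omega>' l"
  ultimately show "\<omega> (k + fst l, graft (fst l) q (snd l)) = \<omega>' (k + fst l, graft (fst l) q (snd l))"
    by blast
qed

lemma labels_below_disjoint_upto: "labels_below k q \<inter> labels_upto k = {}"
  by (auto simp: labels_below_def labels_upto_def)

lemma labels_below_disjoint: "q \<noteq> q' \<Longrightarrow> labels_below k q \<inter> labels_below k q' = {}"
proof (rule ccontr)
  assume "q \<noteq> q'" "labels_below k q \<inter> labels_below k q' \<noteq> {}"
  then obtain l where "l \<in> labels_below k q" "l \<in> labels_below k q'"
    by blast
  then obtain n r n' r' where "r \<in> grid n" "r' \<in> grid n'"
    and "l = (k + n, graft n q r)" "l = (k + n', graft n' q' r')"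
    unfolding labels_below_def by blast
  then have "r \<in> grid n" "r' \<in> grid n" "graft n q r = graft n q' r'"
    by auto
  with \<open>q \<noteq> q'\<close> show False
    using graft_inj by blast
qed

abbreviation coin :: "real \<Rightarrow> bool measure" where
  "coin p \<equiv> measure_pmf (bernoulli_pmf p)"

lemma prob_space_percolation: "prob_space (percolation p)"
  unfolding percolation_def by (intro prob_space_PiM measure_pmf.prob_space_axioms)

lemma measurable_coin [measurable]: "Measurable.pred (percolation p) (\<lambda>\<omega>. \<omega> l)"
proof (cases "l \<in> square_labels")
  case True
  then have "(\<lambda>\<omega>. \<omega> l) \<in> percolation p \<rightarrow>\<^sub>M coin p"
    unfolding percolation_def by (rule measurable_component_singleton)
  then show ?thesis
    by (simp add: measurable_def)
next
  case False
  \<comment> \<open>Points of the product space are \<open>undefined\<close> off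
    \<open>square_labels\<close>, so this toss is constant.\<close>
  then have "\<omega> l = undefined" if "\<omega> \<in> space (percolation p)" for \<omega>
    using that False by (auto simp: percolation_def space_PiM intro: PiE_arb)
  then have "Measurable.pred (percolation p) (\<lambda>\<omega>. \<omega> l) \<longleftrightarrow> Measurable.pred (percolation p) (\<lambda>_. undefined)"
    by (rule measurable_cong)
  then show ?thesis
    by simp
qed

lemma measurable_chosen_squares [measurable]:
  "Measurable.pred (percolation p) (\<lambda>\<omega>. q \<in> chosen_squares \<omega> n)"
proof (induction n arbitrary: q)
  case (Suc n)
  note Suc[measurable]
  show ?case
    unfolding chosen_squares_Suc_iff by measurable
qed simp

text \<open>The collection of level \<open>n\<close> takes finitely many values, so every predicate
  of it is an event, even one that quantifies over uncountably many lines as in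
  \<open>measurable_blocks\<close>.\<close>

lemma measurable_chosen_squares_pred [measurable]:
  "Measurable.pred (percolation p) (\<lambda>\<omega>. R (chosen_squares \<omega> n))"
proof -
  have "R (chosen_squares \<omega> n) \<longleftrightarrow>
      (\<exists>S\<in>Pow (grid n). R S \<and> (\<forall>q\<in>grid n. q \<in> chosen_squares \<omega> n \<longleftrightarrow> q \<in> S))" for \<omega>
  proof -
    have "chosen_squares \<omega> n = S"
      if "S \<in> Pow (grid n)" "\<forall>q\<in>grid n. q \<in> chosen_squares \<omega> n \<longleftrightarrow> q \<in> S" for S
      using that chosen_squares_subset_grid[of \<omega> n] by blast
    then show ?thesis
      using chosen_squares_subset_grid[of \<omega> n] by blast
  qed
  then show ?thesis
    by (simp only:) measurable
qed

lemma measurable_survives [measurable]: "Measurable.pred (percolation p) survives"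
  unfolding survives_def by measurable

lemma subtree_label_inj_on:
  "inj_on (\<lambda>l. (k + fst l, graft (fst l) q (snd l))) square_labels"
proof (rule inj_onI)
  fix l l' :: "nat \<times> nat \<times> nat"
  assume "l \<in> square_labels" "l' \<in> square_labels"
    "(k + fst l, graft (fst l) q (snd l)) = (k + fst l', graft (fst l') q (snd l'))"
  then show "l = l'"
    using graft_inj[of "snd l" "fst l" "snd l'" q q]
    by (cases l; cases l') (simp add: mem_square_labels_iff)
qed

text \<open>The relabelling is injective and the coins are independent with a common law.\<close>

lemma distr_subtree:
  assumes "q \<in> grid k"
  shows "distr (percolation p) (percolation p) (subtree k q) = percolation p"
proof -
  have "(\<lambda>l. (k + fst l, graft (fst l) q (snd l))) \<in> square_labels \<rightarrow> square_labels"
    using assms graft_in_grid[of q k] by (auto simp: mem_square_labels_iff)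
  from distr_PiM_reindex[OF _ subtree_label_inj_on this, of "\<lambda>_. coin p"]
  show ?thesis
    by (simp add: percolation_def subtree_def[abs_def] measure_pmf.prob_space_axioms)
qed

lemma measurable_subtree [measurable]:
  assumes "q \<in> grid k"
  shows "subtree k q \<in> percolation p \<rightarrow>\<^sub>M percolation p"
  unfolding percolation_def subtree_def[abs_def]
proof (rule measurable_restrict)
  fix l assume "l \<in> square_labels"
  then have "(k + fst l, graft (fst l) q (snd l)) \<in> square_labels"
    using assms graft_in_grid[of q k] by (cases l) (simp add: mem_square_labels_iff)
  then show "(\<lambda>\<omega>. \<omega> (k + fst l, graft (fst l) q (snd l)))
      \<in> (\<Pi>\<^sub>M l\<in>square_labels. coin p) \<rightarrow>\<^sub>M coin p"
    by (rule measurable_component_singleton)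
qed

lemma AE_subtree:
  assumes "q \<in> grid k" and "AE \<omega> in percolation p. P \<omega>"
  shows "AE \<omega> in percolation p. P (subtree k q \<omega>)"
  using AE_distrD[OF measurable_subtree[OF assms(1), of p], of P] assms(2)
  unfolding distr_subtree[OF assms(1)] by simp

definition somewhere :: "(config \<Rightarrow> bool) \<Rightarrow> config \<Rightarrow> bool" where
  "somewhere G \<omega> \<longleftrightarrow> (\<exists>k. \<exists>q\<in>grid k. q \<in> chosen_squares \<omega> k \<and> G (subtree k q \<omega>))"

locale fractal_percolation = prob_space "percolation p" for p :: real +
  assumes p_gt: "1 / 2 < p" and p_less: "p < 1"
begin

abbreviation M where "M \<equiv> percolation p"

lemma prob_subtree:
  assumes "q \<in> grid k" and [measurable]: "Measurable.pred M P"
  shows "\<P>(\<omega> in M. P (subtree k q \<omega>)) = \<P>(\<omega> in M. P \<omega>)"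
proof -
  note measurable_subtree[OF assms(1), measurable]
  have "\<P>(\<omega> in M. P \<omega>) = measure (distr M M (subtree k q)) {\<omega> \<in> space M. P \<omega>}"
    using assms by (simp add: distr_subtree)
  also have "\<dots> = \<P>(\<omega> in M. P (subtree k q \<omega>))"
    using measurable_space[OF measurable_subtree[OF assms(1)]]
    by (subst measure_distr) (auto intro!: arg_cong[where f = prob])
  finally show ?thesis ..
qed

lemma distr_coin:
  "l \<in> square_labels \<Longrightarrow> distr M (coin p) (\<lambda>\<omega>. \<omega> l) = coin p"
  unfolding percolation_def by (rule distr_PiM_component) (auto intro: measure_pmf.prob_space_axioms)

lemma prob_coin:
  assumes "l \<in> square_labels"
  shows "\<P>(\<omega> in M. \<omega> l) = p"
proof -
  have "(\<lambda>\<omega>. \<omega> l) \<in> M \<rightarrow>\<^sub>M coin p"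
    using assms unfolding percolation_def by (rule measurable_component_singleton)
  then have "measure (distr M (coin p) (\<lambda>\<omega>. \<omega> l)) {True} = \<P>(\<omega> in M. \<omega> l)"
    by (subst measure_distr) (auto intro!: arg_cong[where f = prob])
  then show ?thesis
    using assms p_gt p_less by (simp add: distr_coin measure_pmf_single)
qed

lemma indep_vars_coins:
  "indep_vars (\<lambda>_. coin p) (\<lambda>l \<omega>. \<omega> l) square_labels"
proof -
  have "distr M (PiM square_labels (\<lambda>_. coin p)) (\<lambda>\<omega>. \<lambda>l\<in>square_labels. \<omega> l)
      = distr M M (\<lambda>\<omega>. \<omega>)"
    by (rule distr_cong) (auto simp: percolation_def space_PiM PiE_restrict)
  also have "\<dots> = PiM square_labels (\<lambda>l. distr M (coin p) (\<lambda>\<omega>. \<omega> l))"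
    unfolding distr_id by (subst percolation_def) (auto intro!: PiM_cong simp: distr_coin)
  finally have "distr M (PiM square_labels (\<lambda>_. coin p)) (\<lambda>\<omega>. \<lambda>l\<in>square_labels. \<omega> l)
      = PiM square_labels (\<lambda>l. distr M (coin p) (\<lambda>\<omega>. \<omega> l))" .
  moreover have "(1, 0, 0) \<in> square_labels"
    by (simp add: square_labels_def)
  ultimately show ?thesis
    by (subst indep_vars_iff_distr_eq_PiM')
       (auto simp: percolation_def intro: measurable_component_singleton[of _ _ "\<lambda>_. coin p", simplified])
qed

text \<open>The restrictions of the coin family to disjoint label sets are independent random
  variables, and each of the two events is a preimage under its restriction.\<close>

lemma prob_conj_independent:
  assumes [measurable]: "Measurable.pred M P" "Measurable.pred M R"
    and P: "determined_by P I" and R: "determined_by R J" and "I \<inter> J = {}"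
  shows "\<P>(\<omega> in M. P \<omega> \<and> R \<omega>) = \<P>(\<omega> in M. P \<omega>) * \<P>(\<omega> in M. R \<omega>)"
proof -
  define B where "B = coin p"
  define I' where "I' = I \<inter> square_labels"
  define J' where "J' = J \<inter> square_labels"
  \<comment> \<open>\<open>ext\<close> completes a partial family of tosses by the arbitrary value
    \<open>True\<close>; by \<open>determined_by\<close> the events do not notice.\<close>
  define ext :: "_ \<Rightarrow> config \<Rightarrow> _" where
    "ext = (\<lambda>K \<tau>. \<lambda>l\<in>square_labels. if l \<in> K then \<tau> l else True)"
  have M: "M = PiM square_labels (\<lambda>_. B)"
    by (simp add: percolation_def B_def)
  have ext [measurable]: "ext K \<in> PiM K (\<lambda>_. B) \<rightarrow>\<^sub>M M" for K
    unfolding M ext_def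
  proof (rule measurable_restrict)
    fix l assume "l \<in> square_labels"
    show "(\<lambda>\<tau>. if l \<in> K then \<tau> l else True) \<in> PiM K (\<lambda>_. B) \<rightarrow>\<^sub>M B"
      using measurable_component_singleton[of l K "\<lambda>_. B"] by (cases "l \<in> K") (simp_all add: B_def)
  qed
  have determined: "Q (ext (K \<inter> square_labels) (restrict \<omega> (K \<inter> square_labels))) = Q \<omega>"
    if "determined_by Q K" "\<omega> \<in> space M" for Q K \<omega>
  proof (rule determined_byD[OF that(1)])
    fix l assume "l \<in> K"
    then show "ext (K \<inter> square_labels) (restrict \<omega> (K \<inter> square_labels)) l = \<omega> l"
      using that(2) by (auto simp: ext_def M space_PiM intro: PiE_arb[symmetric])
  qed
  have "indep_var (PiM I' (\<lambda>_. B)) (\<lambda>\<omega>. restrict \<omega> I') (PiM J' (\<lambda>_. B)) (\<lambda>\<omega>. restrict \<omega> J')"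
    using indep_var_restrict[OF indep_vars_coins, of I' J'] \<open>I \<inter> J = {}\<close>
    by (auto simp: B_def I'_def J'_def)
  moreover define A where "A = {\<tau> \<in> space (PiM I' (\<lambda>_. B)). P (ext I' \<tau>)}"
  moreover define C where "C = {\<tau> \<in> space (PiM J' (\<lambda>_. B)). R (ext J' \<tau>)}"
  ultimately have "prob ((\<lambda>\<omega>. (restrict \<omega> I', restrict \<omega> J')) -` (A \<times> C) \<inter> space M)
      = prob ((\<lambda>\<omega>. restrict \<omega> I') -` A \<inter> space M) * prob ((\<lambda>\<omega>. restrict \<omega> J') -` C \<inter> space M)"
    by (intro indep_varD) auto
  moreover have sp: "restrict \<omega> K \<in> space (PiM K (\<lambda>_. B))" for \<omega> K
    by (auto simp: space_PiM B_def)
  have "restrict \<omega> I' \<in> A \<longleftrightarrow> P \<omega>" "restrict \<omega> J' \<in> C \<longleftrightarrow> R \<omega>" if "\<omega> \<in> space M" for \<omega>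
    using sp determined[OF P that] determined[OF R that] unfolding A_def C_def I'_def J'_def by blast+
  then have "(\<lambda>\<omega>. (restrict \<omega> I', restrict \<omega> J')) -` (A \<times> C) \<inter> space M = {\<omega> \<in> space M. P \<omega> \<and> R \<omega>}"
    "(\<lambda>\<omega>. restrict \<omega> I') -` A \<inter> space M = {\<omega> \<in> space M. P \<omega>}"
    "(\<lambda>\<omega>. restrict \<omega> J') -` C \<inter> space M = {\<omega> \<in> space M. R \<omega>}"
    by auto
  ultimately show ?thesis
    by simp
qed

lemma prob_Ball_independent:
  assumes "finite F" "\<And>q. q \<in> F \<Longrightarrow> Measurable.pred M (P q)"
    and "\<And>q. q \<in> F \<Longrightarrow> determined_by (P q) (I q)" "disjoint_family_on I F"
  shows "\<P>(\<omega> in M. \<forall>q\<in>F. P q \<omega>) = (\<Prod>q\<in>F. \<P>(\<omega> in M. P q \<omega>))"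
  using assms
proof (induction F)
  case empty
  then show ?case by (simp add: prob_space)
next
  case (insert q F)
  have IH: "\<P>(\<omega> in M. \<forall>q\<in>F. P q \<omega>) = (\<Prod>q\<in>F. \<P>(\<omega> in M. P q \<omega>))"
    using insert by (intro insert.IH) (auto simp: disjoint_family_on_def)
  have "\<P>(\<omega> in M. P q \<omega> \<and> (\<forall>q\<in>F. P q \<omega>)) =
      \<P>(\<omega> in M. P q \<omega>) * \<P>(\<omega> in M. \<forall>q\<in>F. P q \<omega>)"
  proof (rule prob_conj_independent)
    show "Measurable.pred M (\<lambda>\<omega>. \<forall>q\<in>F. P q \<omega>)"
      using insert.hyps insert.prems(1) by (intro pred_intros_finite) auto
    show "determined_by (\<lambda>\<omega>. \<forall>q\<in>F. P q \<omega>) (\<Union>q\<in>F. I q)"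
    proof (rule determined_byI)
      fix \<omega> \<omega>' :: config
      assume "\<And>l. l \<in> (\<Union>q\<in>F. I q) \<Longrightarrow> \<omega> l = \<omega>' l"
      then have "P q \<omega> = P q \<omega>'" if "q \<in> F" for q
        using that insert.prems(2) by (intro determined_byD[of "P q" "I q"]) auto
      then show "(\<forall>q\<in>F. P q \<omega>) = (\<forall>q\<in>F. P q \<omega>')"
        by blast
    qed
    show "I q \<inter> (\<Union>q\<in>F. I q) = {}"
    proof -
      have "I q \<inter> I q' = {}" if "q' \<in> F" for q'
        using insert.hyps that by (intro disjoint_family_onD[OF insert.prems(3)]) auto
      then show ?thesis
        by auto
    qed
  qed (use insert.prems in auto)
  with IH insert.hyps show ?case
    by simp
qed

section \<open>The zero-one law\<close>

lemma measurable_somewhere [measurable]: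
  assumes [measurable]: "Measurable.pred M G"
  shows "Measurable.pred M (somewhere G)"
proof -
  have "Measurable.pred M (\<lambda>\<omega>. G (subtree k q \<omega>))" if "q \<in> grid k" for k q
    using measurable_subtree[OF that] assms by (rule measurable_compose)
  note this[measurable]
  show ?thesis
    unfolding somewhere_def by measurable
qed

lemma somewhere_child:
  assumes "q \<in> grid 1" "\<omega> (1, q)" "somewhere G (subtree 1 q \<omega>)"
  shows "somewhere G \<omega>"
proof -
  obtain k r where r: "r \<in> grid k" "r \<in> chosen_squares (subtree 1 q \<omega>) k" "G (subtree k r (subtree 1 q \<omega>))"
    using assms(3) unfolding somewhere_def by blast
  have "q \<in> chosen_squares \<omega> 1"
    using assms chosen_squares_1_iff by blast
  with r have "graft k q r \<in> chosen_squares \<omega> (1 + k)"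
    unfolding chosen_squares_graft[OF assms(1) r(1)] by blast
  moreover have "graft k q r \<in> grid (1 + k)"
    using assms(1) r(1) by (rule graft_in_grid)
  ultimately show ?thesis
    unfolding somewhere_def using r subtree_subtree[OF r(1), of 1 q \<omega>] by (metis (no_types))
qed

text \<open>The right-hand side is the offspring generating function t -> (1 - p + p t)^4:
  independently, each of the four children is dropped or fails \<open>H\<close> in its
  subtree.\<close>

lemma prob_no_child:
  assumes [measurable]: "Measurable.pred M H"
  shows "\<P>(\<omega> in M. \<forall>q\<in>grid 1. \<not> (\<omega> (1, q) \<and> H (subtree 1 q \<omega>))) =
    (1 - p + p * \<P>(\<omega> in M. \<not> H \<omega>)) ^ 4"
proof -
  define I where "I = (\<lambda>q. insert (1, q) (labels_below 1 q))"
  have meas [measurable]: "Measurable.pred M (\<lambda>\<omega>. H (subtree 1 q \<omega>))" if "q \<in> grid 1" for q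
    using measurable_subtree[OF that] assms by (rule measurable_compose)
  have coin: "\<P>(\<omega> in M. \<not> (\<omega> (1, q) \<and> H (subtree 1 q \<omega>))) = 1 - p + p * \<P>(\<omega> in M. \<not> H \<omega>)"
    if q: "q \<in> grid 1" for q
  proof -
    note meas[OF q, measurable]
    have "\<P>(\<omega> in M. \<omega> (1, q) \<and> H (subtree 1 q \<omega>)) =
        \<P>(\<omega> in M. \<omega> (1, q)) * \<P>(\<omega> in M. H (subtree 1 q \<omega>))"
    proof (rule prob_conj_independent[where I = "{(1, q)}" and J = "labels_below 1 q"])
      show "determined_by (\<lambda>\<omega>. H (subtree 1 q \<omega>)) (labels_below 1 q)"
        by (rule determined_byI) (metis subtree_cong)
      show "{(1, q)} \<inter> labels_below 1 q = {}"
        by (auto simp: labels_below_def)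
      show "Measurable.pred M (\<lambda>\<omega>. H (subtree 1 q \<omega>))"
        by (rule meas[OF q])
    qed (auto simp: determined_by_def)
    also have "\<dots> = p * \<P>(\<omega> in M. H \<omega>)"
      using q by (simp add: prob_coin prob_subtree mem_square_labels_iff)
    also have "\<P>(\<omega> in M. H \<omega>) = 1 - \<P>(\<omega> in M. \<not> H \<omega>)"
      by (subst prob_neg) auto
    finally show ?thesis
      by (subst prob_neg) (simp_all add: algebra_simps del: One_nat_def)
  qed
  have "\<P>(\<omega> in M. \<forall>q\<in>grid 1. \<not> (\<omega> (1, q) \<and> H (subtree 1 q \<omega>))) =
      (\<Prod>q\<in>grid 1. \<P>(\<omega> in M. \<not> (\<omega> (1, q) \<and> H (subtree 1 q \<omega>))))"
  proof (rule prob_Ball_independent[where I = I])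
    fix q assume q: "q \<in> grid 1"
    show "determined_by (\<lambda>\<omega>. \<not> (\<omega> (1, q) \<and> H (subtree 1 q \<omega>))) (I q)"
      unfolding I_def by (rule determined_byI) (metis insertCI subtree_cong)
    note meas[OF q, measurable]
    show "Measurable.pred M (\<lambda>\<omega>. \<not> (\<omega> (1, q) \<and> H (subtree 1 q \<omega>)))"
      by measurable
  next
    have "(1, q) \<notin> labels_below 1 q'" for q q'
      by (auto simp: labels_below_def)
    then show "disjoint_family_on I (grid 1)"
      using labels_below_disjoint by (auto simp: disjoint_family_on_def I_def)
  qed simp
  also have "\<dots> = (1 - p + p * \<P>(\<omega> in M. \<not> H \<omega>)) ^ card (grid 1)"
    using coin by simp
  also have "card (grid 1) = 4"
    by (simp add: grid_def)
  finally show ?thesis .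
qed

text \<open>Convexity in terms of divided differences of the generating function, which also fixes
  1. If e < a, its secant over [e, a] has slope at least 1 and its secant over [e, 1] has slope
  exactly 1, whereas strict convexity makes the first slope smaller than the second.\<close>

lemma generating_function_fixpoint_unique:
  fixes a e :: real
  assumes a: "a \<le> (1 - p + p * a) ^ 4" and e: "e = (1 - p + p * e) ^ 4"
    and "0 \<le> e" "e \<le> a" "a < 1"
  shows "a = e"
proof (rule ccontr)
  assume "a \<noteq> e"
  with assms have "e < a" by simp
  define s where "s = 1 - p + p * a"
  define r where "r = 1 - p + p * e"
  have p0: "0 < p" using p_gt by simp
  have "s - r = p * (a - e)" "1 - r = p * (1 - e)" "1 - s = p * (1 - a)"
    by (auto simp: s_def r_def algebra_simps)
  have "s < 1"
    using \<open>1 - s = _\<close> p0 \<open>a < 1\<close> by (smt (verit) mult_pos_pos)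
  have "0 \<le> r" "0 \<le> s"
    using p0 p_less assms by (auto simp: r_def s_def)
  have "a - e \<le> s ^ 4 - r ^ 4"
    using a e by (simp add: s_def r_def)
  also have "\<dots> = (s - r) * (s ^ 3 + s\<^sup>2 * r + s * r\<^sup>2 + r ^ 3)"
    by (simp add: power_numeral_reduce algebra_simps)
  finally have "(a - e) * 1 \<le> (a - e) * (p * (s ^ 3 + s\<^sup>2 * r + s * r\<^sup>2 + r ^ 3))"
    using \<open>s - r = _\<close> by (simp add: mult_ac)
  then have 1: "1 \<le> p * (s ^ 3 + s\<^sup>2 * r + s * r\<^sup>2 + r ^ 3)"
    using \<open>e < a\<close> by simp
  have "(1 - e) * 1 = 1 - r ^ 4"
    using e by (simp add: r_def)
  also have "\<dots> = (1 - r) * (1 + r + r\<^sup>2 + r ^ 3)"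
    by (simp add: power_numeral_reduce algebra_simps)
  also have "\<dots> = (1 - e) * (p * (1 + r + r\<^sup>2 + r ^ 3))"
    using \<open>1 - r = _\<close> by (simp add: mult_ac)
  finally have 2: "1 = p * (1 + r + r\<^sup>2 + r ^ 3)"
    using assms by simp
  have "s ^ 3 < 1" "s\<^sup>2 * r \<le> r" "s * r\<^sup>2 \<le> r\<^sup>2"
    using \<open>0 \<le> s\<close> \<open>s < 1\<close> \<open>0 \<le> r\<close>
    by (auto intro!: mult_left_le_one_le power_le_one simp: power_less_one_iff)
  then have "s ^ 3 + s\<^sup>2 * r + s * r\<^sup>2 + r ^ 3 < 1 + r + r\<^sup>2 + r ^ 3"
    by simp
  with p0 have "p * (s ^ 3 + s\<^sup>2 * r + s * r\<^sup>2 + r ^ 3) < p * (1 + r + r\<^sup>2 + r ^ 3)"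
    by simp
  with 1 2 show False
    by simp
qed

text \<open>Both the extinction probability and the probability that \<open>G\<close> occurs in no subtree are related
  to the generating function of the offspring law, which by convexity has only one fixed point
  below one.\<close>

lemma zero_one_law:
  assumes G [measurable]: "Measurable.pred M G"
    and pos: "0 < \<P>(\<omega> in M. G \<omega>)" and surv: "\<And>\<omega>. G \<omega> \<Longrightarrow> survives \<omega>"
  shows "AE \<omega> in M. survives \<omega> \<longrightarrow> somewhere G \<omega>"
proof -
  define a where "a = \<P>(\<omega> in M. \<not> somewhere G \<omega>)"
  define e where "e = \<P>(\<omega> in M. \<not> survives \<omega>)"
  \<comment> \<open>Only an inequality: \<open>G\<close> may occur at the root without occurring
    below any chosen child.\<close>
  have "a \<le> \<P>(\<omega> in M. \<forall>q\<in>grid 1. \<not> (\<omega> (1, q) \<and> somewhere G (subtree 1 q \<omega>)))"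
    unfolding a_def
  proof (rule finite_measure_mono)
    have "Measurable.pred M (\<lambda>\<omega>. somewhere G (subtree 1 q \<omega>))" if "q \<in> grid 1" for q
      using measurable_subtree[OF that] measurable_somewhere[OF G] by (rule measurable_compose)
    note this[measurable]
    show "{\<omega> \<in> space M. \<forall>q\<in>grid 1. \<not> (\<omega> (1, q) \<and> somewhere G (subtree 1 q \<omega>))} \<in> events"
      by measurable
  qed (use somewhere_child in blast)
  also have "\<dots> = (1 - p + p * a) ^ 4"
    unfolding a_def by (rule prob_no_child) measurable
  finally have a: "a \<le> (1 - p + p * a) ^ 4" .
  have "e = \<P>(\<omega> in M. \<forall>q\<in>grid 1. \<not> (\<omega> (1, q) \<and> survives (subtree 1 q \<omega>)))"
    unfolding e_def by (subst survives_iff_child) simp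
  also have "\<dots> = (1 - p + p * e) ^ 4"
    unfolding e_def by (rule prob_no_child) measurable
  finally have e: "e = (1 - p + p * e) ^ 4" .
  have surv': "survives \<omega>" if "somewhere G \<omega>" for \<omega>
    using that surv survives_if_subtree unfolding somewhere_def by metis
  then have "e \<le> a"
    unfolding a_def e_def by (intro finite_measure_mono) auto
  have "somewhere G \<omega>" if "\<omega> \<in> space M" "G \<omega>" for \<omega>
  proof -
    \<comment> \<open>The root is one of the places where \<open>G\<close> may occur; cutting there
      returns the same point, since points of the space are extensional.\<close>
    have "subtree 0 (0, 0) \<omega> = restrict \<omega> square_labels"
      by (simp add: subtree_def graft_def)
    also have "\<dots> = \<omega>"
      using that by (simp add: percolation_def space_PiM PiE_restrict)
    finally have "(0, 0) \<in> grid 0 \<and> (0, 0) \<in> chosen_squares \<omega> 0 \<and> G (subtree 0 (0, 0) \<omega>)"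
      using that by (simp add: grid_def)
    then show ?thesis
      unfolding somewhere_def by blast
  qed
  then have "\<P>(\<omega> in M. G \<omega>) \<le> \<P>(\<omega> in M. somewhere G \<omega>)"
    by (intro finite_measure_mono) auto
  then have "a < 1"
    unfolding a_def using pos by (subst prob_neg) auto
  have "a = e"
    using generating_function_fixpoint_unique[OF a e _ \<open>e \<le> a\<close> \<open>a < 1\<close>] by (simp add: e_def)
  have "{\<omega> \<in> space M. \<not> somewhere G \<omega>} =
      {\<omega> \<in> space M. \<not> survives \<omega>} \<union> {\<omega> \<in> space M. survives \<omega> \<and> \<not> somewhere G \<omega>}"
    using surv' by auto
  then have "a = prob ({\<omega> \<in> space M. \<not> survives \<omega>} \<union> {\<omega> \<in> space M. survives \<omega> \<and> \<not> somewhere G \<omega>})"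
    by (simp add: a_def)
  also have "\<dots> = e + \<P>(\<omega> in M. survives \<omega> \<and> \<not> somewhere G \<omega>)"
    unfolding e_def by (rule finite_measure_Union) auto
  finally have "\<P>(\<omega> in M. survives \<omega> \<and> \<not> somewhere G \<omega>) = 0"
    using \<open>a = e\<close> by simp
  then have "{\<omega> \<in> space M. survives \<omega> \<and> \<not> somewhere G \<omega>} \<in> null_sets M"
    by (intro null_setsI) (auto simp: emeasure_eq_measure)
  then show ?thesis
    by (rule AE_I') auto
qed

end

section \<open>Lines crossing the percolation set\<close>

definition overlap :: "real \<Rightarrow> real \<Rightarrow> real \<Rightarrow> real \<Rightarrow> real" where
  "overlap a b c d = max 0 (min b d - max a c)"

lemma overlap_nonneg [simp]: "0 \<le> overlap a b c d"
  by (simp add: overlap_def)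

lemma overlap_le: "a \<le> b \<Longrightarrow> overlap a b c d \<le> b - a"
  by (auto simp: overlap_def)

lemma overlap_split_left: "a \<le> s \<Longrightarrow> s \<le> b \<Longrightarrow> overlap a s c d + overlap s b c d = overlap a b c d" if "c \<le> d"
  using that unfolding overlap_def by (auto simp: max_def min_def)

lemma overlap_commute: "overlap a b c d = overlap c d a b"
  by (simp add: overlap_def min.commute max.commute)

lemma overlap_split_right: "c \<le> s \<Longrightarrow> s \<le> d \<Longrightarrow> overlap a b c s + overlap a b s d = overlap a b c d" if "a \<le> b"
  using overlap_split_left[OF that] by (simp add: overlap_commute[of a b])

lemma overlap_lipschitz: "\<bar>overlap a b c d - overlap a b c' d'\<bar> \<le> \<bar>c - c'\<bar> + \<bar>d - d'\<bar>"
  unfolding overlap_def by (auto simp: max_def min_def abs_if)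

text \<open>The line with parameters \<open>\<alpha>\<close> and \<open>\<beta>\<close> consists of the points \<open>(\<alpha> + \<beta> * y, y)\<close>; for
  \<open>\<beta> \<ge> 0\<close> the following quantity is the length of the first projection of its intersection with
  the square.\<close>

definition chord :: "nat \<Rightarrow> nat \<times> nat \<Rightarrow> real \<Rightarrow> real \<Rightarrow> real" where
  "chord n q \<alpha> \<beta> = overlap (real (fst q) / 2 ^ n) (real (fst q + 1) / 2 ^ n)
     (\<alpha> + \<beta> * (real (snd q) / 2 ^ n)) (\<alpha> + \<beta> * (real (snd q + 1) / 2 ^ n))"

definition total_chord :: "nat \<Rightarrow> (nat \<times> nat) set \<Rightarrow> real \<Rightarrow> real \<Rightarrow> real" where
  "total_chord n S \<alpha> \<beta> = (\<Sum>q\<in>S. chord n q \<alpha> \<beta>)"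

definition children :: "(nat \<times> nat) set \<Rightarrow> (nat \<times> nat) set" where
  "children S = (\<Union>q\<in>S. subsquares q)"

lemma chord_nonneg [simp]: "0 \<le> chord n q \<alpha> \<beta>"
  by (simp add: chord_def)

lemma chord_le: "chord n q \<alpha> \<beta> \<le> 1 / 2 ^ n"
  using overlap_le[of "real (fst q) / 2 ^ n" "real (fst q + 1) / 2 ^ n"]
  unfolding chord_def by (simp add: field_simps)

lemma chord_lipschitz:
  assumes "q \<in> grid n"
  shows "\<bar>chord n q \<alpha> \<beta> - chord n q \<alpha>' \<beta>'\<bar> \<le> 2 * (\<bar>\<alpha> - \<alpha>'\<bar> + \<bar>\<beta> - \<beta>'\<bar>)"
proof -
  have *: "\<bar>(\<alpha> + \<beta> * t) - (\<alpha>' + \<beta>' * t)\<bar> \<le> \<bar>\<alpha> - \<alpha>'\<bar> + \<bar>\<beta> - \<beta>'\<bar>" if "0 \<le> t" "t \<le> 1" for t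
  proof -
    have "\<bar>(\<alpha> + \<beta> * t) - (\<alpha>' + \<beta>' * t)\<bar> = \<bar>(\<alpha> - \<alpha>') + (\<beta> - \<beta>') * t\<bar>"
      by (simp add: algebra_simps)
    also have "\<dots> \<le> \<bar>\<alpha> - \<alpha>'\<bar> + \<bar>\<beta> - \<beta>'\<bar> * t"
      using that by (intro order_trans[OF abs_triangle_ineq]) (simp add: abs_mult)
    also have "\<bar>\<beta> - \<beta>'\<bar> * t \<le> \<bar>\<beta> - \<beta>'\<bar>"
      using that by (simp add: mult_left_le)
    finally show ?thesis by simp
  qed
  have "snd q < 2 ^ n"
    using assms by (simp add: mem_grid_iff)
  then have "real (snd q + 1) \<le> real (2 ^ n)"
    by (simp only: of_nat_le_iff)
  then have "real (snd q) + 1 \<le> 2 ^ n"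
    by simp
  then have "0 \<le> real (snd q) / 2 ^ n" "real (snd q) / 2 ^ n \<le> 1"
    "0 \<le> real (snd q + 1) / 2 ^ n" "real (snd q + 1) / 2 ^ n \<le> 1"
    using \<open>snd q < 2 ^ n\<close> by (auto simp: divide_le_eq_1)
  from *[OF this(1,2)] *[OF this(3,4)] show ?thesis
    unfolding chord_def by (intro order_trans[OF overlap_lipschitz]) simp
qed

text \<open>Cutting the square halves both intervals whose overlap is the chord, and the overlap is
  additive in each of them. So passing to all children conserves the total chord, and a selection
  with probability p multiplies its mean by p.\<close>

lemma chord_subsquares:
  assumes "0 \<le> \<beta>"
  shows "(\<Sum>r\<in>subsquares q. chord (Suc n) r \<alpha> \<beta>) = chord n q \<alpha> \<beta>"
proof -
  obtain i j where q: "q = (i, j)" by (cases q)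
  define N where "N = (2::real) ^ Suc n"
  define x where "x = (\<lambda>i. real i / N)"
  define y where "y = (\<lambda>j. \<alpha> + \<beta> * (real j / N))"
  have N: "N > 0" by (simp add: N_def)
  have x: "x i \<le> x (Suc i)" for i
    using N by (simp add: x_def divide_right_mono)
  have y: "y i \<le> y (Suc i)" for i
    using N assms by (simp add: y_def mult_left_mono divide_right_mono)
  have half: "real a / 2 ^ n = real (2 * a) / N" for a
    by (simp add: N_def)
  have chord_Suc: "chord (Suc n) (a, b) \<alpha> \<beta> = overlap (x a) (x (Suc a)) (y b) (y (Suc b))" for a b
    by (simp add: chord_def x_def y_def N_def)
  have chord: "chord n q \<alpha> \<beta> = overlap (x (2 * i)) (x (2 * i + 2)) (y (2 * j)) (y (2 * j + 2))"
    unfolding chord_def half by (simp add: q x_def y_def)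
  have "(\<Sum>r\<in>subsquares q. chord (Suc n) r \<alpha> \<beta>) =
      (\<Sum>a\<in>{2 * i, 2 * i + 1}. \<Sum>b\<in>{2 * j, 2 * j + 1}. chord (Suc n) (a, b) \<alpha> \<beta>)"
    by (simp only: sum.cartesian_product q subsquares_def split_def prod.collapse fst_conv snd_conv)
  also have "\<dots> = (\<Sum>a\<in>{2 * i, 2 * i + 1}. overlap (x a) (x (Suc a)) (y (2 * j)) (y (2 * j + 2)))"
    using overlap_split_right[OF x y y, of _ "2 * j"] by (simp add: chord_Suc)
  also have "\<dots> = chord n q \<alpha> \<beta>"
    using overlap_split_left[OF order_trans[OF y y] x x, of "2 * i" "2 * j"] by (simp add: chord)
  finally show ?thesis .
qed

lemma total_chord_children:
  assumes "finite S" "0 \<le> \<beta>"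
  shows "total_chord (Suc n) (children S) \<alpha> \<beta> = total_chord n S \<alpha> \<beta>"
proof -
  have "subsquares q \<inter> subsquares q' = {}" if "q \<noteq> q'" for q q'
    using that by (metis disjoint_iff mem_subsquares_iff)
  moreover have "finite (subsquares q)" for q
    by (simp add: subsquares_def case_prod_beta)
  ultimately have "total_chord (Suc n) (children S) \<alpha> \<beta> = (\<Sum>q\<in>S. \<Sum>r\<in>subsquares q. chord (Suc n) r \<alpha> \<beta>)"
    unfolding total_chord_def children_def using assms(1)
    by (intro sum.UNION_disjoint) auto
  then show ?thesis
    using chord_subsquares[OF assms(2)] by (simp add: total_chord_def)
qed

text \<open>A crude estimate: at most 4^n squares times the Lipschitz bound for one chord. A net of
  width of order 8^-n makes up for it.\<close>

lemma total_chord_lipschitz: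
  assumes "S \<subseteq> grid n" "\<bar>\<alpha> - \<alpha>'\<bar> \<le> h" "\<bar>\<beta> - \<beta>'\<bar> \<le> h"
  shows "\<bar>total_chord n S \<alpha> \<beta> - total_chord n S \<alpha>' \<beta>'\<bar> \<le> 4 ^ n * (4 * h)"
proof -
  have "\<bar>total_chord n S \<alpha> \<beta> - total_chord n S \<alpha>' \<beta>'\<bar> \<le> (\<Sum>q\<in>S. \<bar>chord n q \<alpha> \<beta> - chord n q \<alpha>' \<beta>'\<bar>)"
    unfolding total_chord_def by (simp flip: sum_subtractf)
  also have "\<dots> \<le> (\<Sum>q\<in>S. 4 * h)"
    using assms by (intro sum_mono order_trans[OF chord_lipschitz]) auto
  also have "\<dots> = real (card S) * (4 * h)"
    by simp
  also have "card S \<le> card (grid n)"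
    using assms by (intro card_mono) auto
  then have "real (card S) * (4 * h) \<le> 4 ^ n * (4 * h)"
  proof (intro mult_right_mono)
    assume "card S \<le> card (grid n)"
    also have "card (grid n) = 4 ^ n"
      by (simp add: grid_def flip: power_mult_distrib)
    finally have "real (card S) \<le> real (4 ^ n)"
      by (simp only: of_nat_le_iff)
    then show "real (card S) \<le> 4 ^ n"
      by simp
    show "0 \<le> 4 * h"
      using assms(2) by simp
  qed
  finally show ?thesis .
qed

text \<open>The squares off the boundary of the unit square. Growth started from them yields only
  points at distance at least 2^-n from the boundary, the origin of the margin \<epsilon> in
  \<open>blocks\<close>.\<close>

definition inner_squares :: "nat \<Rightarrow> (nat \<times> nat) set" where
  "inner_squares n = {1..<2 ^ n - 1} \<times> {1..<2 ^ n - 1}"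

lemma inner_squares_subset_grid: "inner_squares n \<subseteq> grid n"
  by (auto simp: inner_squares_def grid_def)

lemma sum_overlap_left:
  assumes "a \<le> b" "c \<le> d" "mono x"
  shows "(\<Sum>i=a..<b. overlap (x i) (x (Suc i)) c d) = overlap (x a) (x b) c d"
  using assms(1)
proof (induction rule: dec_induct)
  case base
  then show ?case using assms(2) by (simp add: overlap_def)
next
  case (step k)
  then show ?case
    using overlap_split_left[OF assms(2), of "x a" "x k" "x (Suc k)"] monoD[OF assms(3)] by simp
qed

lemma total_chord_inner_squares:
  assumes "0 \<le> \<beta>" "1 \<le> n"
  shows "total_chord n (inner_squares n) \<alpha> \<beta> =
    overlap (1 / 2 ^ n) (1 - 1 / 2 ^ n) (\<alpha> + \<beta> * (1 / 2 ^ n)) (\<alpha> + \<beta> * (1 - 1 / 2 ^ n))"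
proof -
  define x where "x = (\<lambda>i. real i / 2 ^ n)"
  define y where "y = (\<lambda>j. \<alpha> + \<beta> * (real j / 2 ^ n))"
  define N where "N = (2::nat) ^ n - 1"
  have "mono x"
    by (auto simp: x_def mono_def divide_right_mono)
  have "mono y"
    using assms by (auto simp: y_def mono_def divide_right_mono mult_left_mono)
  have "(2::nat) ^ 1 \<le> 2 ^ n"
    using assms by (intro power_increasing) auto
  then have N: "1 \<le> N"
    unfolding N_def by simp
  have "total_chord n (inner_squares n) \<alpha> \<beta> = (\<Sum>i=1..<N. \<Sum>j=1..<N. overlap (x i) (x (Suc i)) (y j) (y (Suc j)))"
    by (simp add: total_chord_def inner_squares_def sum.cartesian_product chord_def x_def y_def N_def case_prod_beta)
  also have "\<dots> = (\<Sum>i=1..<N. overlap (x i) (x (Suc i)) (y 1) (y N))"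
    using N \<open>mono x\<close> \<open>mono y\<close> by (subst (1 2) overlap_commute, intro sum.cong sum_overlap_left) (auto simp: mono_def)
  also have "\<dots> = overlap (x 1) (x N) (y 1) (y N)"
    using N \<open>mono x\<close> \<open>mono y\<close> by (intro sum_overlap_left) (auto simp: mono_def)
  also have N_eq: "real N / 2 ^ n = 1 - 1 / 2 ^ n"
    by (simp add: N_def of_nat_diff diff_divide_distrib)
  have "overlap (x 1) (x N) (y 1) (y N) =
      overlap (1 / 2 ^ n) (1 - 1 / 2 ^ n) (\<alpha> + \<beta> * (1 / 2 ^ n)) (\<alpha> + \<beta> * (1 - 1 / 2 ^ n))"
    by (simp only: x_def y_def N_eq of_nat_1)
  finally show ?thesis .
qed

lemma chord_pos_imp_meets:
  assumes "0 < chord n q \<alpha> \<beta>" "0 < \<beta>"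
  obtains y where "(\<alpha> + \<beta> * y, y) \<in> dyadic_square n q"
proof -
  \<comment> \<open>The left end of the overlap of the two intervals.\<close>
  define x where "x = max (real (fst q) / 2 ^ n) (\<alpha> + \<beta> * (real (snd q) / 2 ^ n))"
  have x: "real (fst q) / 2 ^ n \<le> x" "x \<le> real (fst q + 1) / 2 ^ n"
    "\<alpha> + \<beta> * (real (snd q) / 2 ^ n) \<le> x" "x \<le> \<alpha> + \<beta> * (real (snd q + 1) / 2 ^ n)"
    using assms(1) unfolding chord_def overlap_def x_def by linarith+
  define y where "y = (x - \<alpha>) / \<beta>"
  have "t \<le> y \<longleftrightarrow> \<alpha> + \<beta> * t \<le> x" "y \<le> t \<longleftrightarrow> x \<le> \<alpha> + \<beta> * t" for t
    using assms(2) by (auto simp: y_def pos_le_divide_eq pos_divide_le_eq mult.commute)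
  with x(3,4) have "real (snd q) / 2 ^ n \<le> y" "y \<le> real (snd q + 1) / 2 ^ n"
    by blast+
  moreover have "\<alpha> + \<beta> * y = x"
    using assms(2) by (simp add: y_def)
  ultimately have "(\<alpha> + \<beta> * y, y) \<in> dyadic_square n q"
    using x(1,2) by (simp add: mem_dyadic_square_iff pos_le_divide_eq pos_divide_le_eq mult.commute)
  then show ?thesis by (rule that)
qed

text \<open>For positive \<beta> the corners where a line can clip the unit square marginally are
  (0, 1) and (1, 0). At height 1 the line is at least \<open>g\<close> to the right of the first, at
  height 0 at least \<open>g\<close> to the left of the second.\<close>

definition crossing_line :: "real \<Rightarrow> real \<Rightarrow> real \<Rightarrow> real \<Rightarrow> bool" where
  "crossing_line m g \<alpha> \<beta> \<longleftrightarrow> 1 / m \<le> \<beta> \<and> \<beta> \<le> m \<and> g \<le> \<alpha> + \<beta> \<and> \<alpha> \<le> 1 - g"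

text \<open>Stated for all finite levels, so that measurability follows level by level although the
  lines form an uncountable family; \<open>blocksD\<close> passes to the limit set. The margin
  \<epsilon> keeps the points found off the edges and later makes comparisons of positions
  strict.\<close>

definition blocks :: "real \<Rightarrow> real \<Rightarrow> real \<Rightarrow> config \<Rightarrow> bool" where
  "blocks m g \<epsilon> \<omega> \<longleftrightarrow> (\<forall>n \<alpha> \<beta>. crossing_line m g \<alpha> \<beta> \<longrightarrow>
     (\<exists>y. (\<alpha> + \<beta> * y, y) \<in> level_set \<omega> n \<inter> {\<epsilon>..1 - \<epsilon>} \<times> {\<epsilon>..1 - \<epsilon>}))"

lemma measurable_blocks [measurable]: "Measurable.pred (percolation p) (blocks m g \<epsilon>)"
proof -
  have "Measurable.pred (percolation p) (\<lambda>\<omega>. \<forall>\<alpha> \<beta>. crossing_line m g \<alpha> \<beta> \<longrightarrow>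
     (\<exists>y. (\<alpha> + \<beta> * y, y) \<in> level_set \<omega> n \<inter> {\<epsilon>..1 - \<epsilon>} \<times> {\<epsilon>..1 - \<epsilon>}))" for n
    unfolding level_set_def
    by (rule measurable_chosen_squares_pred[where R = "\<lambda>S. \<forall>\<alpha> \<beta>. crossing_line m g \<alpha> \<beta> \<longrightarrow>
      (\<exists>y. (\<alpha> + \<beta> * y, y) \<in> (\<Union>q\<in>S. dyadic_square n q) \<inter> {\<epsilon>..1 - \<epsilon>} \<times> {\<epsilon>..1 - \<epsilon>})"])
  note this[measurable]
  show ?thesis
    unfolding blocks_def by measurable
qed

lemma blocksD:
  assumes "blocks m g \<epsilon> \<omega>" "crossing_line m g \<alpha> \<beta>"
  obtains y where "(\<alpha> + \<beta> * y, y) \<in> percolation_set \<omega>" "\<epsilon> \<le> y" "y \<le> 1 - \<epsilon>"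
    "\<epsilon> \<le> \<alpha> + \<beta> * y" "\<alpha> + \<beta> * y \<le> 1 - \<epsilon>"
proof -
  define K where "K = (\<lambda>y. (\<alpha> + \<beta> * y, y)) ` {\<epsilon>..1 - \<epsilon>} \<inter> {\<epsilon>..1 - \<epsilon>} \<times> {\<epsilon>..1 - \<epsilon>}"
  have "compact K"
    unfolding K_def by (intro compact_Int compact_Times compact_continuous_image continuous_intros) auto
  moreover have "level_set \<omega> n \<inter> K \<noteq> {}" for n
  proof -
    obtain y where "(\<alpha> + \<beta> * y, y) \<in> level_set \<omega> n \<inter> {\<epsilon>..1 - \<epsilon>} \<times> {\<epsilon>..1 - \<epsilon>}"
      using assms unfolding blocks_def by blast
    then have "(\<alpha> + \<beta> * y, y) \<in> level_set \<omega> n \<inter> K"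
      unfolding K_def by auto
    then show ?thesis by blast
  qed
  ultimately have "percolation_set \<omega> \<inter> K \<noteq> {}"
    by (rule percolation_set_meets_compact)
  then show ?thesis
    using that unfolding K_def by auto
qed

section \<open>Growth of the total chord from one level to the next\<close>

context fractal_percolation
begin

text \<open>The exponent in Hoeffding's inequality has the sum of the squared weights as
  denominator. For weights between 0 and \<open>c\<close> this sum is at most \<open>c\<close> times
  the total weight, which leaves an exponent linear in the total weight.\<close>

lemma prob_weighted_coins_le:
  assumes T: "finite T" "T \<subseteq> square_labels" and w: "\<And>l. l \<in> T \<Longrightarrow> 0 \<le> w l \<and> w l \<le> c"
    and "0 < c" "s < p"
  shows "\<P>(\<omega> in M. (\<Sum>l\<in>T. of_bool (\<omega> l) * w l) < s * (\<Sum>l\<in>T. w l))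
    \<le> exp (- (2 * (p - s)\<^sup>2 * (\<Sum>l\<in>T. w l) / c))"
proof (cases "(\<Sum>l\<in>T. (w l)\<^sup>2) = 0")
  \<comment> \<open>With all weights zero the strict inequality is impossible, while Hoeffding's
    bound would divide by zero.\<close>
  case True
  then have "w l = 0" if "l \<in> T" for l
    using that T by (simp add: sum_nonneg_eq_0_iff)
  then show ?thesis by simp
next
  case False
  define W where "W = (\<Sum>l\<in>T. w l)"
  have sq: "0 < (\<Sum>l\<in>T. (w l)\<^sup>2)"
    using False by (simp add: less_le sum_nonneg)
  have "indep_vars (\<lambda>_. coin p) (\<lambda>l \<omega>. \<omega> l) T"
    using indep_vars_coins T(2) by (rule indep_vars_subset)
  then have indep: "indep_vars (\<lambda>_. borel) (\<lambda>l \<omega>. of_bool (\<omega> l) * w l) T"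
    by (rule indep_vars_compose2) simp
  have expect: "expectation (\<lambda>\<omega>. of_bool (\<omega> l) * w l) = p * w l" if "l \<in> T" for l
  proof -
    have "expectation (\<lambda>\<omega>. of_bool (\<omega> l) * w l) = expectation (\<lambda>\<omega>. indicat_real {\<omega> \<in> space M. \<omega> l} \<omega> * w l)"
      by (intro Bochner_Integration.integral_cong) (auto simp: indicator_def)
    also have "\<dots> = p * w l"
      using that T by (simp add: prob_coin subset_eq)
    finally show ?thesis .
  qed
  have mu: "p * W = (\<Sum>l\<in>T. expectation (\<lambda>\<omega>. of_bool (\<omega> l) * w l))"
    by (simp only: W_def sum_distrib_left expect cong: sum.cong)
  interpret H: Hoeffding_ineq M T "\<lambda>l \<omega>. of_bool (\<omega> l) * w l" "\<lambda>_. 0" w "p * W"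
  proof unfold_locales
    show "AE \<omega> in M. of_bool (\<omega> l) * w l \<in> {0..w l}" if "l \<in> T" for l
      using w[OF that] by auto
    show "p * W \<equiv> \<Sum>l\<in>T. expectation (\<lambda>\<omega>. of_bool (\<omega> l) * w l)"
      using mu by (rule eq_reflection)
  qed (use T indep in auto)
  have "0 \<le> W"
    unfolding W_def using w by (intro sum_nonneg) auto
  have "(\<Sum>l\<in>T. (w l)\<^sup>2) \<le> (\<Sum>l\<in>T. c * w l)"
    using w by (intro sum_mono) (auto simp: power2_eq_square mult_right_mono)
  then have sq_le: "(\<Sum>l\<in>T. (w l)\<^sup>2) \<le> c * W"
    by (simp add: W_def sum_distrib_left)
  have "\<P>(\<omega> in M. (\<Sum>l\<in>T. of_bool (\<omega> l) * w l) < s * W)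
      \<le> \<P>(\<omega> in M. (\<Sum>l\<in>T. of_bool (\<omega> l) * w l) \<le> p * W - (p - s) * W)"
  proof (rule finite_measure_mono)
    show "{\<omega> \<in> space M. (\<Sum>l\<in>T. of_bool (\<omega> l) * w l) \<le> p * W - (p - s) * W} \<in> events"
      by measurable
  qed (auto simp: algebra_simps)
  also have "\<dots> \<le> exp (- 2 * ((p - s) * W)\<^sup>2 / (\<Sum>l\<in>T. (w l - 0)\<^sup>2))"
    using \<open>s < p\<close> \<open>0 \<le> W\<close> sq by (intro H.Hoeffding_ineq_le) auto
  also have "\<dots> \<le> exp (- (2 * (p - s)\<^sup>2 * W / c))"
  proof -
    have "2 * (p - s)\<^sup>2 * W / c = 2 * ((p - s) * W)\<^sup>2 / (c * W)"
      using \<open>0 < c\<close> by (cases "W = 0") (simp_all add: power2_eq_square)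
    also have "\<dots> \<le> 2 * ((p - s) * W)\<^sup>2 / (\<Sum>l\<in>T. (w l)\<^sup>2)"
      using sq sq_le by (intro divide_left_mono) auto
    finally show ?thesis by simp
  qed
  finally show ?thesis
    by (simp add: W_def)
qed

text \<open>Only descendants of inner squares of level \<open>n0\<close> are kept, so the distance
  from the boundary persists at all later levels.\<close>

definition inner_chosen :: "nat \<Rightarrow> nat \<Rightarrow> (nat \<times> nat) set \<Rightarrow> (nat \<times> nat) set" where
  "inner_chosen n0 n S = {q \<in> S. ancestor (n - n0) q \<in> inner_squares n0}"

lemma inner_chosen_Suc:
  assumes "n0 \<le> n"
  shows "inner_chosen n0 (Suc n) (chosen_squares \<omega> (Suc n)) =
    {r \<in> children (inner_chosen n0 n (chosen_squares \<omega> n)). \<omega> (Suc n, r)}"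
  using assms
  by (auto simp: inner_chosen_def children_def chosen_squares_Suc_iff mem_subsquares_iff Suc_diff_le)

text \<open>Failure of one growth step at one line. The first conjunct confines it to a total chord
  of at least \<open>t\<close>, where Hoeffding's bound is strong.\<close>

definition shrinks :: "nat \<Rightarrow> real \<Rightarrow> real \<Rightarrow> nat \<Rightarrow> real \<Rightarrow> real \<Rightarrow> config \<Rightarrow> bool" where
  "shrinks n0 t s n \<alpha> \<beta> \<omega> \<longleftrightarrow>
     t \<le> total_chord n (inner_chosen n0 n (chosen_squares \<omega> n)) \<alpha> \<beta> \<and>
     total_chord (Suc n) (inner_chosen n0 (Suc n) (chosen_squares \<omega> (Suc n))) \<alpha> \<beta>
       < s * total_chord n (inner_chosen n0 n (chosen_squares \<omega> n)) \<alpha> \<beta>"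

lemma measurable_shrinks [measurable]: "Measurable.pred M (shrinks n0 t s n \<alpha> \<beta>)"
proof -
  have [measurable]: "(\<lambda>\<omega>. total_chord n (inner_chosen n0 n (chosen_squares \<omega> n)) \<alpha> \<beta>) \<in> borel_measurable M" for n
    using measurable_chosen_squares_pred[of "\<lambda>S. total_chord n (inner_chosen n0 n S) \<alpha> \<beta> \<le> y" n for y]
    unfolding pred_def by (rule borel_measurableI_le)
  show ?thesis
    unfolding shrinks_def by measurable
qed

text \<open>Given the collection of level \<open>n\<close>, one of finitely many, the tosses of the
  next level are still independent and carry weights of at most 2^-(n+1). The factor for the full
  start is kept because the failures together must weigh less than the start event, not merely less
  than 1.\<close>

lemma prob_shrinks_le:
  assumes "n0 \<le> n" "0 \<le> \<beta>" "s < p"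
  shows "\<P>(\<omega> in M. chosen_squares \<omega> n0 = grid n0 \<and> shrinks n0 t s n \<alpha> \<beta> \<omega>)
    \<le> \<P>(\<omega> in M. chosen_squares \<omega> n0 = grid n0) * exp (- (2 * (p - s)\<^sup>2 * t * 2 ^ Suc n))"
proof -
  define D where "D = inner_chosen n0 n"
  define w where "w = (\<lambda>l::nat \<times> nat \<times> nat. chord (Suc n) (snd l) \<alpha> \<beta>)"
  define T where "T = (\<lambda>S. Pair (Suc n) ` children (D S))"
  define \<S> where "\<S> = {S \<in> Pow (grid n). t \<le> total_chord n (D S) \<alpha> \<beta>}"
  define start where "start = (\<lambda>\<omega>. chosen_squares \<omega> n0 = grid n0)"
  define low where "low = (\<lambda>S \<omega>. (\<Sum>l\<in>T S. of_bool (\<omega> l) * w l) < s * (\<Sum>l\<in>T S. w l))"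
  define c where "c = exp (- (2 * (p - s)\<^sup>2 * t * 2 ^ Suc n))"
  have [measurable]: "Measurable.pred M (low S)" for S
    unfolding low_def by measurable
  have fin: "finite S" if "S \<in> \<S>" for S
    using that finite_subset[OF _ finite_grid] by (auto simp: \<S>_def)
  have finD: "finite (D S)" if "finite S" for S
    using that by (simp add: D_def inner_chosen_def)
  have finC: "finite (children S)" if "finite S" for S
    using that by (auto simp: children_def subsquares_def)
  have sum_w: "(\<Sum>l\<in>T S. w l) = total_chord n (D S) \<alpha> \<beta>" if "finite S" for S
    using total_chord_children[OF finD[OF that] assms(2)]
    by (simp add: T_def w_def sum.reindex inj_on_def total_chord_def)
  have next_level: "total_chord (Suc n) (inner_chosen n0 (Suc n) (chosen_squares \<omega> (Suc n))) \<alpha> \<beta> =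
      (\<Sum>l\<in>T (chosen_squares \<omega> n). of_bool (\<omega> l) * w l)" for \<omega>
  proof -
    have "finite (children (D (chosen_squares \<omega> n)))"
      by (intro finC finD) simp
    then show ?thesis
      unfolding inner_chosen_Suc[OF assms(1)] total_chord_def
      by (simp add: T_def w_def sum.reindex inj_on_def D_def sum.inter_filter Int_def of_bool_def if_distrib
          if_distribR cong: if_cong)
  qed
  have step: "\<P>(\<omega> in M. (start \<omega> \<and> chosen_squares \<omega> n = S) \<and>
        low S \<omega>)
      \<le> \<P>(\<omega> in M. start \<omega> \<and> chosen_squares \<omega> n = S) * c"
    if S: "S \<in> \<S>" for S
  proof -
    have TL: "T S \<subseteq> square_labels"
    proof -
      have "ancestor 1 r \<in> grid n \<Longrightarrow> r \<in> grid (Suc n)" for r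
        by (auto simp: mem_grid_iff ancestor_def)
      then show ?thesis
        using S by (auto simp: T_def \<S>_def D_def inner_chosen_def children_def mem_subsquares_iff mem_square_labels_iff)
    qed
    have "\<P>(\<omega> in M. (start \<omega> \<and> chosen_squares \<omega> n = S) \<and>
        low S \<omega>) =
      \<P>(\<omega> in M. start \<omega> \<and> chosen_squares \<omega> n = S) *
      \<P>(\<omega> in M. low S \<omega>)"
    proof (rule prob_conj_independent[where I = "labels_upto n" and J = "T S"])
      show "Measurable.pred M (\<lambda>\<omega>. start \<omega> \<and> chosen_squares \<omega> n = S)"
        unfolding start_def
        by (intro pred_intros_logic) (rule measurable_chosen_squares_pred)+
      show "determined_by (\<lambda>\<omega>. start \<omega> \<and> chosen_squares \<omega> n = S) (labels_upto n)"
      proof (rule determined_byI)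
        fix \<omega> \<omega>' :: config
        assume eq: "\<And>l. l \<in> labels_upto n \<Longrightarrow> \<omega> l = \<omega>' l"
        have "chosen_squares \<omega> k = chosen_squares \<omega>' k" if "k \<le> n" for k
          using that eq by (intro chosen_squares_cong) (auto simp: labels_upto_def)
        from this[OF assms(1)] this[OF order_refl] show "(start \<omega> \<and> chosen_squares \<omega> n = S) = (start \<omega>' \<and> chosen_squares \<omega>' n = S)"
          by (simp add: start_def)
      qed
      show "determined_by (low S) (T S)"
        by (rule determined_byI) (simp add: low_def cong: sum.cong)
      show "labels_upto n \<inter> T S = {}"
        by (auto simp: labels_upto_def T_def)
    qed measurable
    also have "\<P>(\<omega> in M. low S \<omega>)
        \<le> exp (- (2 * (p - s)\<^sup>2 * (\<Sum>l\<in>T S. w l) / (1 / 2 ^ Suc n)))"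
      unfolding low_def using TL S assms finC[OF finD[OF fin[OF S]]] chord_le[of "Suc n"]
      by (intro prob_weighted_coins_le) (auto simp: T_def w_def)
    also have "\<dots> \<le> c"
    proof -
      have "t \<le> (\<Sum>l\<in>T S. w l)"
        using S fin[OF S] by (simp add: sum_w \<S>_def)
      then have "2 * (p - s)\<^sup>2 * t * 2 ^ Suc n \<le> 2 * (p - s)\<^sup>2 * (\<Sum>l\<in>T S. w l) * 2 ^ Suc n"
        by (intro mult_right_mono mult_left_mono) auto
      then show ?thesis
        by (simp add: c_def)
    qed
    finally show ?thesis
      by (simp add: mult_left_mono)
  qed
  have [measurable]: "Measurable.pred M (\<lambda>\<omega>. chosen_squares \<omega> k = S)" for k S
    by (rule measurable_chosen_squares_pred)
  have [measurable]: "Measurable.pred M start"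
    unfolding start_def by measurable
  have fin\<S>: "finite \<S>"
    by (simp add: \<S>_def)
  have "\<P>(\<omega> in M. start \<omega> \<and> shrinks n0 t s n \<alpha> \<beta> \<omega>)
      \<le> prob (\<Union>S\<in>\<S>. {\<omega> \<in> space M. (start \<omega> \<and> chosen_squares \<omega> n = S) \<and>
        low S \<omega>})"
    (is "_ \<le> prob (\<Union>S\<in>\<S>. ?A S)")
  proof (rule finite_measure_mono)
    show "{\<omega> \<in> space M. start \<omega> \<and> shrinks n0 t s n \<alpha> \<beta> \<omega>} \<subseteq> (\<Union>S\<in>\<S>. ?A S)"
      using chosen_squares_subset_grid[of _ n]
      by (auto simp: shrinks_def next_level low_def sum_w \<S>_def D_def)
    show "(\<Union>S\<in>\<S>. ?A S) \<in> events"
      using fin\<S> by (intro sets.finite_UN) auto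
  qed
  also have "\<dots> \<le> (\<Sum>S\<in>\<S>. prob (?A S))"
    using fin\<S> by (intro finite_measure_subadditive_finite) auto
  also have "\<dots> \<le> (\<Sum>S\<in>\<S>. \<P>(\<omega> in M. start \<omega> \<and> chosen_squares \<omega> n = S) * c)"
    by (rule sum_mono) (rule step)
  also have "\<dots> = (\<Sum>S\<in>\<S>. \<P>(\<omega> in M. start \<omega> \<and> chosen_squares \<omega> n = S)) * c"
    by (simp add: sum_distrib_right)
  also have "(\<Sum>S\<in>\<S>. \<P>(\<omega> in M. start \<omega> \<and> chosen_squares \<omega> n = S)) =
      prob (\<Union>S\<in>\<S>. {\<omega> \<in> space M. start \<omega> \<and> chosen_squares \<omega> n = S})"
    using fin\<S> by (intro finite_measure_finite_Union[symmetric]) (auto simp: disjoint_family_on_def)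
  also have "\<dots> \<le> \<P>(\<omega> in M. start \<omega>)"
    by (intro finite_measure_mono) auto
  finally show ?thesis
    by (simp add: start_def c_def mult_right_mono)
qed

lemma prob_full_start_pos: "0 < \<P>(\<omega> in M. chosen_squares \<omega> n = grid n)"
proof -
  define F where "F = {l \<in> square_labels. fst l \<le> n}"
  have "F \<subseteq> (\<Union>k\<in>{..n}. Pair k ` grid k)"
    by (auto simp: F_def mem_square_labels_iff)
  then have "finite F"
    by (rule finite_subset) auto
  have "0 < p ^ card F"
    using p_gt by simp
  also have "\<dots> = (\<Prod>l\<in>F. \<P>(\<omega> in M. \<omega> l))"
    by (simp add: prob_coin F_def)
  also have "\<dots> = \<P>(\<omega> in M. \<forall>l\<in>F. \<omega> l)"
    using \<open>finite F\<close>
    by (intro prob_Ball_independent[where I = "\<lambda>l. {l}", symmetric])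
       (auto simp: determined_by_def disjoint_family_on_def)
  also have "\<dots> \<le> \<P>(\<omega> in M. chosen_squares \<omega> n = grid n)"
  proof (rule finite_measure_mono)
    have "chosen_squares \<omega> k = grid k" if "\<forall>l\<in>F. \<omega> l" "k \<le> n" for \<omega> k
      using that(2)
    proof (induction k)
      case (Suc k)
      have "q \<in> chosen_squares \<omega> (Suc k)" if "q \<in> grid (Suc k)" for q
      proof -
        have "(Suc k, q) \<in> F"
          using that Suc.prems by (simp add: F_def mem_square_labels_iff)
        moreover have "ancestor 1 q \<in> chosen_squares \<omega> k"
          using Suc that ancestor_in_grid[of q k 1] by simp
        ultimately show ?thesis
          using \<open>\<forall>l\<in>F. \<omega> l\<close> by (simp add: chosen_squares_Suc_iff)
      qed
      then show ?case
        using chosen_squares_subset_grid by blast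
    qed (simp add: grid_def lessThan_Suc)
    then show "{\<omega> \<in> space M. \<forall>l\<in>F. \<omega> l} \<subseteq> {\<omega> \<in> space M. chosen_squares \<omega> n = grid n}"
      by auto
    have "Measurable.pred M (\<lambda>\<omega>. chosen_squares \<omega> n = grid n)"
      by (rule measurable_chosen_squares_pred)
    then show "{\<omega> \<in> space M. chosen_squares \<omega> n = grid n} \<in> events"
      by measurable
  qed
  finally show ?thesis .
qed

end

text \<open>Up to a constant, 64^n counts the pairs of parameters in a net of width of order
  8^-n.\<close>

lemma summable_power_times_exp_neg_power:
  fixes c r :: real
  assumes "0 < c" "1 < r"
  shows "summable (\<lambda>n. 64 ^ n * exp (- (c * r ^ n)))"
proof (rule summable_comparison_test_ev)
  \<comment> \<open>The surplus factor 2^n in 128^n provides a geometric majorant.\<close>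
  have "((\<lambda>n. 128 ^ n * exp (- (c * r ^ n))) \<longlongrightarrow> 0) at_top"
    using assms by real_asymp
  then have "eventually (\<lambda>n. 128 ^ n * exp (- (c * r ^ n)) < 1) at_top"
    by (rule order_tendstoD) simp
  then show "eventually (\<lambda>n. norm (64 ^ n * exp (- (c * r ^ n))) \<le> (1 / 2) ^ n) at_top"
  proof eventually_elim
    case (elim n)
    have "(128::real) ^ n = 64 ^ n * 2 ^ n"
      by (simp flip: power_mult_distrib)
    with elim show ?case
      by (simp add: power_one_over field_simps)
  qed
qed (simp add: summable_geometric)

text \<open>Removing a frame of width e = 2^-n lowers the distances to the critical corners by at
  most (m + 1) * e \<le> g / 2, half of the margin. The other term 1 / (2 * m) is half of the
  smallest admissible \<beta>.\<close>

lemma total_chord_inner_squares_ge: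
  assumes "crossing_line m g \<alpha> \<beta>" "1 \<le> m" "0 < g" "2 \<le> n" "(m + 1) / 2 ^ n \<le> g / 2"
  shows "min (1 / (2 * m)) (g / 2) \<le> total_chord n (inner_squares n) \<alpha> \<beta>"
proof -
  define e where "e = 1 / (2::real) ^ n"
  have line: "1 / m \<le> \<beta>" "\<beta> \<le> m" "g \<le> \<alpha> + \<beta>" "\<alpha> \<le> 1 - g"
    using assms(1) by (auto simp: crossing_line_def)
  have "0 < 1 / m"
    using assms(2) by simp
  then have "0 < \<beta>"
    using line by linarith
  have "(2::real) ^ 2 \<le> 2 ^ n"
    using assms(4) by (intro power_increasing) auto
  then have e: "0 < e" "e \<le> 1 / 4"
    by (auto simp: e_def field_simps)
  have small: "(m + 1) * e \<le> g / 2"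
    using assms(5) by (simp add: e_def)
  have "\<beta> * e \<le> m * e"
    using line e by (intro mult_right_mono) auto
  with small have be: "\<beta> * e + e \<le> g / 2"
    by (simp add: algebra_simps)
  have "(1 / m) * (1 / 2) \<le> \<beta> * (1 - 2 * e)"
    using line e \<open>0 < 1 / m\<close> \<open>0 < \<beta>\<close> by (intro mult_mono) auto
  then have b: "1 / (2 * m) \<le> \<beta> - 2 * (\<beta> * e)"
    by (simp add: algebra_simps)
  have m: "1 / (2 * m) \<le> 1 / 2"
    using assms(2) by simp
  have "total_chord n (inner_squares n) \<alpha> \<beta> = overlap e (1 - e) (\<alpha> + \<beta> * e) (\<alpha> + \<beta> * (1 - e))"
    unfolding e_def using \<open>0 < \<beta>\<close> assms(4) by (intro total_chord_inner_squares) auto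
  also have "\<dots> \<ge> min (1 / (2 * m)) (g / 2)"
  proof -
    define k where "k = min (1 / (2 * m)) (g / 2)"
    have k: "k \<le> 1 / (2 * m)" "k \<le> g / 2"
      by (simp_all add: k_def)
    have \<beta>e: "\<beta> * (1 - e) = \<beta> - \<beta> * e"
      by (simp add: algebra_simps)
    have "k \<le> (1 - e) - e" "k \<le> (1 - e) - (\<alpha> + \<beta> * e)" "k \<le> (\<alpha> + \<beta> * (1 - e)) - e"
      "k \<le> (\<alpha> + \<beta> * (1 - e)) - (\<alpha> + \<beta> * e)"
      unfolding \<beta>e using k line e be b m by linarith+
    then have "k \<le> overlap e (1 - e) (\<alpha> + \<beta> * e) (\<alpha> + \<beta> * (1 - e))"
      unfolding overlap_def by linarith
    then show ?thesis
      by (simp only: k_def)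
  qed
  finally show ?thesis .
qed

lemma inner_square_bounds:
  assumes "q \<in> inner_squares n" "z \<in> dyadic_square n q"
  shows "z \<in> {1 / 2 ^ n..1 - 1 / 2 ^ n} \<times> {1 / 2 ^ n..1 - 1 / 2 ^ n}"
proof -
  have *: "1 / 2 ^ n \<le> t \<and> t \<le> 1 - 1 / 2 ^ n"
    if "a \<in> {1..<2 ^ n - 1}" "real a \<le> 2 ^ n * t" "2 ^ n * t \<le> real a + 1" for a :: nat and t :: real
  proof -
    have "a + 2 \<le> 2 ^ n"
      using that(1) by auto
    then have "real (a + 2) \<le> real (2 ^ n)"
      by (simp only: of_nat_le_iff)
    then have "real a + 2 \<le> 2 ^ n" "1 \<le> real a"
      using that(1) by auto
    with that(2,3) have "1 \<le> 2 ^ n * t" "2 ^ n * t \<le> 2 ^ n - 1"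
      by linarith+
    then show ?thesis
      by (simp add: field_simps)
  qed
  show ?thesis
    using assms *[of "fst q" "fst z"] *[of "snd q" "snd z"]
    by (auto simp: inner_squares_def mem_dyadic_square_iff mem_Times_iff)
qed

section \<open>Positive probability of meeting all crossing lines at once\<close>

context fractal_percolation
begin

lemma grid_parameter:
  fixes h t :: real
  assumes "0 < h" "\<bar>t\<bar> \<le> A"
  shows "\<bar>t - real_of_int \<lfloor>t / h\<rfloor> * h\<bar> \<le> h" "\<lfloor>t / h\<rfloor> \<in> {-(\<lceil>A / h\<rceil> + 1)..\<lceil>A / h\<rceil>}"
proof -
  have 1: "real_of_int \<lfloor>t / h\<rfloor> \<le> t / h" "t / h \<le> real_of_int \<lfloor>t / h\<rfloor> + 1"
    by linarith+
  then have 2: "real_of_int \<lfloor>t / h\<rfloor> * h \<le> t" "t \<le> (real_of_int \<lfloor>t / h\<rfloor> + 1) * h"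
    using floor_divide_lower[OF assms(1), of t] floor_divide_upper[OF assms(1), of t] by auto
  then show "\<bar>t - real_of_int \<lfloor>t / h\<rfloor> * h\<bar> \<le> h"
    by (simp add: algebra_simps)
  have "t / h \<le> A / h" "- (A / h) \<le> t / h"
    using assms divide_right_mono[of t A h] divide_right_mono[of "- A" t h] by simp_all
  then have "real_of_int \<lfloor>t / h\<rfloor> \<le> of_int \<lceil>A / h\<rceil>" "real_of_int (-(\<lceil>A / h\<rceil> + 1)) \<le> of_int \<lfloor>t / h\<rfloor>"
    using 1 le_of_int_ceiling[of "A / h"] unfolding of_int_minus of_int_add of_int_1 by linarith+
  then show "\<lfloor>t / h\<rfloor> \<in> {-(\<lceil>A / h\<rceil> + 1)..\<lceil>A / h\<rceil>}"
    by (simp only: of_int_le_iff atLeastAtMost_iff simp_thms)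
qed

text \<open>Only a full start up to level \<open>n0\<close> is forced. The union bound over all
  later levels and net lines loses strictly less than the probability of this start.\<close>

lemma prob_blocks_pos:
  assumes "1 \<le> m" "0 < g"
  obtains \<epsilon> where "0 < \<epsilon>" "\<epsilon> < 1" "0 < \<P>(\<omega> in M. blocks m g \<epsilon> \<omega>)"
proof -
  \<comment> \<open>\<open>q\<close> and \<open>s\<close> divide the interval from 1/2 to p into
    thirds. A net line keeps the fraction \<open>s\<close> in each step, \<open>q\<close> is the
    rate that remains after the rounding errors, and 2 * q > 1 makes the exponents grow.\<close>
  define q where "q = (1 + p) / 3"
  define s where "s = (1 / 2 + 2 * p) / 3"
  have qs: "1 / 2 < q" "q < s" "s < p" "q < 1" "s < 1"
    using p_gt p_less by (auto simp: q_def s_def)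
  define \<kappa> where "\<kappa> = min (1 / (2 * m)) (g / 2)"
  have \<kappa>: "0 < \<kappa>"
    using assms by (simp add: \<kappa>_def)
  \<comment> \<open>Width 8^-n against the Lipschitz factor 4^(n+1) leaves an error of order 2^-n,
    and \<open>(1 / 2) ^ n \<le> q ^ k\<close>. The divisor 64 makes the error at most a quarter of
    (s - q) * \<kappa> * q^k.\<close>
  define h where "h = (\<lambda>n. (s - q) * \<kappa> / 64 / 8 ^ n :: real)"
  have h: "0 < h n" for n
    using qs \<kappa> by (simp add: h_def)
  define A where "A = (\<lambda>n. \<lceil>(m + 1) / h n\<rceil>)"
  define net :: "nat \<Rightarrow> (int \<times> int) set" where "net = (\<lambda>n. {-(A n + 1)..A n} \<times> {0..A n})"
  define R where "R = (m + 1) * 64 / ((s - q) * \<kappa>)"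
  define K where "K = 2 * R + 4"
  define c where "c = 2 * (p - s)\<^sup>2 * \<kappa>"
  define f where "f = (\<lambda>n. K\<^sup>2 * (64 ^ n * exp (- (c * (2 * q) ^ n))))"
  have card_net: "real (card (net n)) \<le> K\<^sup>2 * 64 ^ n" for n
  proof -
    have "0 \<le> (m + 1) / h n"
      using h[of n] assms by simp
    then have A0: "0 \<le> A n"
      by (simp add: A_def)
    have "real_of_int (A n) \<le> (m + 1) / h n + 1"
      unfolding A_def by linarith
    also have "(m + 1) / h n = R * 8 ^ n"
      by (simp add: h_def R_def)
    finally have "real_of_int (A n) \<le> R * 8 ^ n + 1" .
    moreover have "1 \<le> (8::real) ^ n"
      by simp
    ultimately have "2 * real_of_int (A n) + 2 \<le> 2 * (R * 8 ^ n) + 4 * 8 ^ n"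
      by linarith
    also have "\<dots> = K * 8 ^ n"
      by (simp add: K_def algebra_simps)
    finally have AK: "2 * real_of_int (A n) + 2 \<le> K * 8 ^ n" .
    have "real (card (net n)) = (2 * real_of_int (A n) + 2) * (real_of_int (A n) + 1)"
      using A0 by (simp add: net_def card_cartesian_product)
    also have "\<dots> \<le> (K * 8 ^ n) * (K * 8 ^ n)"
      using A0 AK by (intro mult_mono) auto
    also have "\<dots> = K\<^sup>2 * 64 ^ n"
      by (simp add: power2_eq_square flip: power_mult_distrib)
    finally show ?thesis .
  qed
  have "0 < c"
    using qs \<kappa> by (simp add: c_def)
  then have "summable f"
    unfolding f_def using qs by (intro summable_mult summable_power_times_exp_neg_power) auto
  \<comment> \<open>Beyond \<open>N\<close> the failure bounds sum to less than 1; choosing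
    \<open>n0\<close> at least \<open>N\<close> leaves only this tail.\<close>
  from suminf_exist_split[OF _ this, of 1]
  obtain N where N: "\<And>n. n \<ge> N \<Longrightarrow> norm (\<Sum>i. f (i + n)) < 1"
    by auto
  have "((\<lambda>n. (m + 1) / 2 ^ n) \<longlongrightarrow> 0) at_top"
    by real_asymp
  then have "eventually (\<lambda>n. (m + 1) / 2 ^ n < g / 2) at_top"
    by (rule order_tendstoD) (use assms in simp)
  then have "eventually (\<lambda>n. (m + 1) / 2 ^ n < g / 2 \<and> N \<le> n \<and> 2 \<le> n) at_top"
    using eventually_ge_at_top[of N] eventually_ge_at_top[of 2] by eventually_elim simp
  then obtain n0 where n0: "(m + 1) / 2 ^ n0 < g / 2" "N \<le> n0" "2 \<le> n0"
    by (auto simp: eventually_at_top_linorder)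
  define \<epsilon> where "\<epsilon> = 1 / (2::real) ^ n0"
  define D where "D = (\<lambda>\<omega> k. inner_chosen n0 (n0 + k) (chosen_squares \<omega> (n0 + k)))"
  define start where "start = (\<lambda>\<omega>. chosen_squares \<omega> n0 = grid n0)"
  \<comment> \<open>Rounding a line to the net costs at most half of the bound \<kappa> * q^k, hence
    this threshold.\<close>
  define bad where "bad = (\<lambda>k \<omega>. \<exists>l\<in>net (n0 + k).
    shrinks n0 (\<kappa> / 2 * q ^ k) s (n0 + k) (real_of_int (fst l) * h (n0 + k)) (real_of_int (snd l) * h (n0 + k)) \<omega>)"
  have fin_net: "finite (net n)" for n
    by (simp add: net_def)
  have D_grid: "D \<omega> k \<subseteq> grid (n0 + k)" for \<omega> k
    using chosen_squares_subset_grid by (auto simp: D_def inner_chosen_def)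
  \<comment> \<open>Each step rounds the line to the net, uses that no failure occurs there, and
    rounds back. Both rounding errors are paid for by s - q.\<close>
  have grow: "\<kappa> * q ^ k \<le> total_chord (n0 + k) (D \<omega> k) \<alpha> \<beta>"
    if "start \<omega>" "\<And>k. \<not> bad k \<omega>" "crossing_line m g \<alpha> \<beta>" for \<omega> k \<alpha> \<beta>
    using that(3)
  proof (induction k arbitrary: \<alpha> \<beta>)
    case 0
    have "D \<omega> 0 = inner_squares n0"
      using that(1) inner_squares_subset_grid[of n0] by (auto simp: D_def inner_chosen_def start_def)
    then show ?case
      using total_chord_inner_squares_ge[OF 0 assms] n0 by (simp add: \<kappa>_def)
  next
    case (Suc k)
    define n where "n = n0 + k"
    define a where "a = real_of_int \<lfloor>\<alpha> / h n\<rfloor> * h n"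
    define b where "b = real_of_int \<lfloor>\<beta> / h n\<rfloor> * h n"
    define err where "err = (s - q) * \<kappa> / 4 * q ^ k"
    have line: "1 / m \<le> \<beta>" "\<beta> \<le> m" "g \<le> \<alpha> + \<beta>" "\<alpha> \<le> 1 - g"
      using Suc.prems by (auto simp: crossing_line_def)
    have "0 < 1 / m"
      using assms(1) by simp
    with line assms have bounds: "0 \<le> \<beta>" "\<bar>\<beta>\<bar> \<le> m + 1" "\<bar>\<alpha>\<bar> \<le> m + 1"
      by linarith+
    note ga = grid_parameter[OF h[of n] bounds(3)]
    note gb = grid_parameter[OF h[of n] bounds(2)]
    have "0 \<le> \<lfloor>\<beta> / h n\<rfloor>"
      using bounds(1) h[of n] by simp
    then have b0: "0 \<le> b"
      using h[of n] by (simp add: b_def)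
    have net: "(\<lfloor>\<alpha> / h n\<rfloor>, \<lfloor>\<beta> / h n\<rfloor>) \<in> net n"
      using ga(2) gb(2) \<open>0 \<le> \<lfloor>\<beta> / h n\<rfloor>\<close> by (simp add: net_def A_def)
    have "(1 / 2) ^ n \<le> q ^ k"
    proof -
      have "(1 / 2) ^ n \<le> (1 / 2 :: real) ^ k"
        by (rule power_decreasing) (auto simp: n_def)
      also have "\<dots> \<le> q ^ k"
        using qs by (intro power_mono) auto
      finally show ?thesis .
    qed
    then have "(s - q) * \<kappa> / 4 * (1 / 2) ^ n \<le> err"
      unfolding err_def using qs \<kappa> by (intro mult_left_mono) auto
    moreover have "4 ^ Suc n * (4 * h n) = (s - q) * \<kappa> / 4 * (1 / 2) ^ n"
    proof -
      have "(8::real) ^ n = 4 ^ n * 2 ^ n"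
        by (simp flip: power_mult_distrib)
      then show ?thesis
        by (simp add: h_def power_one_over)
    qed
    ultimately have err: "4 ^ Suc n * (4 * h n) \<le> err"
      by simp
    have err': "4 ^ n * (4 * h n) \<le> err"
      using err h[of n] by (intro order_trans[OF _ err] mult_right_mono) auto
    have "\<bar>total_chord n (D \<omega> k) \<alpha> \<beta> - total_chord n (D \<omega> k) a b\<bar> \<le> err"
      using ga(1) gb(1) D_grid[of \<omega> k] unfolding a_def b_def n_def[symmetric]
      by (intro order_trans[OF total_chord_lipschitz err']) auto
    moreover have "\<kappa> * q ^ k \<le> total_chord n (D \<omega> k) \<alpha> \<beta>"
      unfolding n_def by (rule Suc.IH) (rule Suc.prems)
    ultimately have lower: "\<kappa> * q ^ k - err \<le> total_chord n (D \<omega> k) a b"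
      by linarith
    have e4: "err = (s - q) / 4 * (\<kappa> * q ^ k)"
      by (simp add: err_def)
    have "(s - q) / 4 * (\<kappa> * q ^ k) \<le> 1 / 2 * (\<kappa> * q ^ k)"
      using qs \<kappa> by (intro mult_right_mono) auto
    moreover have "\<kappa> / 2 * q ^ k = 1 / 2 * (\<kappa> * q ^ k)"
      by simp
    ultimately have "\<kappa> / 2 * q ^ k \<le> total_chord n (D \<omega> k) a b"
      using lower e4 by linarith
    moreover have "\<not> shrinks n0 (\<kappa> / 2 * q ^ k) s n a b \<omega>"
      using that(2)[of k] net unfolding bad_def n_def a_def b_def by force
    ultimately have "s * total_chord n (D \<omega> k) a b \<le> total_chord (Suc n) (D \<omega> (Suc k)) a b"
      by (simp add: shrinks_def D_def n_def)
    moreover have "s * (\<kappa> * q ^ k - err) \<le> s * total_chord n (D \<omega> k) a b"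
      using lower qs by (intro mult_left_mono) auto
    moreover have "\<bar>total_chord (Suc n) (D \<omega> (Suc k)) \<alpha> \<beta> - total_chord (Suc n) (D \<omega> (Suc k)) a b\<bar> \<le> err"
      using ga(1) gb(1) D_grid[of \<omega> "Suc k"] unfolding a_def b_def n_def
      by (intro order_trans[OF total_chord_lipschitz err[unfolded n_def]]) auto
    ultimately have "s * (\<kappa> * q ^ k - err) - err \<le> total_chord (Suc n) (D \<omega> (Suc k)) \<alpha> \<beta>"
      by linarith
    moreover have "\<kappa> * q ^ Suc k \<le> s * (\<kappa> * q ^ k - err) - err"
    proof -
      have pos: "0 \<le> \<kappa> * q ^ k"
        using \<kappa> qs by simp
      have "s * err \<le> err"
        using qs pos by (intro mult_left_le_one_le) (auto simp: e4)
      moreover have "s * (\<kappa> * q ^ k) - 2 * err - q * (\<kappa> * q ^ k) = (s - q) / 2 * (\<kappa> * q ^ k)"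
        by (simp add: e4 field_simps)
      moreover have "0 \<le> (s - q) / 2 * (\<kappa> * q ^ k)"
        using qs pos by simp
      ultimately show ?thesis
        by (simp add: algebra_simps)
    qed
    ultimately show ?case
      by (simp add: n_def)
  qed
  have blocks: "blocks m g \<epsilon> \<omega>" if "start \<omega>" "\<And>k. \<not> bad k \<omega>" for \<omega>
    unfolding blocks_def
  proof (intro allI impI)
    fix n \<alpha> \<beta> assume line: "crossing_line m g \<alpha> \<beta>"
    have "0 < 1 / m" "1 / m \<le> \<beta>"
      using assms line by (auto simp: crossing_line_def)
    then have "0 < \<beta>"
      by linarith
    have "0 < \<kappa> * q ^ n"
      using \<kappa> qs by simp
    also have "\<dots> \<le> total_chord (n0 + n) (D \<omega> n) \<alpha> \<beta>"
      by (rule grow) (use that line in auto)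
    finally obtain r where r: "r \<in> D \<omega> n" "0 < chord (n0 + n) r \<alpha> \<beta>"
      unfolding total_chord_def by (metis chord_nonneg less_le sum.not_neutral_contains_not_neutral)
    obtain y where y: "(\<alpha> + \<beta> * y, y) \<in> dyadic_square (n0 + n) r"
      using chord_pos_imp_meets[OF r(2) \<open>0 < \<beta>\<close>] .
    then have "(\<alpha> + \<beta> * y, y) \<in> dyadic_square n0 (ancestor n r)"
      using dyadic_square_ancestor by blast
    moreover have "ancestor n r \<in> inner_squares n0" "r \<in> chosen_squares \<omega> (n0 + n)"
      using r(1) by (auto simp: D_def inner_chosen_def)
    ultimately have "(\<alpha> + \<beta> * y, y) \<in> {\<epsilon>..1 - \<epsilon>} \<times> {\<epsilon>..1 - \<epsilon>}"
      unfolding \<epsilon>_def using inner_square_bounds by blast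
    moreover have "(\<alpha> + \<beta> * y, y) \<in> level_set \<omega> (n0 + n)"
      using y \<open>r \<in> chosen_squares _ _\<close> unfolding level_set_def by blast
    then have "(\<alpha> + \<beta> * y, y) \<in> level_set \<omega> n"
      using level_set_antimono[of n "n0 + n"] by auto
    ultimately show "\<exists>y. (\<alpha> + \<beta> * y, y) \<in> level_set \<omega> n \<inter> {\<epsilon>..1 - \<epsilon>} \<times> {\<epsilon>..1 - \<epsilon>}"
      by blast
  qed
  have [measurable]: "Measurable.pred M start"
    unfolding start_def by (rule measurable_chosen_squares_pred)
  have [measurable]: "Measurable.pred M (bad k)" for k
    unfolding bad_def using fin_net by measurable
  define P where "P = \<P>(\<omega> in M. start \<omega>)"
  have "0 < P"
    unfolding P_def start_def by (rule prob_full_start_pos)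
  have bad_le: "\<P>(\<omega> in M. start \<omega> \<and> bad k \<omega>) \<le> P * f (k + n0)" for k
  proof -
    define n where "n = n0 + k"
    define B where "B = (\<lambda>l. {\<omega> \<in> space M. start \<omega> \<and>
      shrinks n0 (\<kappa> / 2 * q ^ k) s n (real_of_int (fst l) * h n) (real_of_int (snd l) * h n) \<omega>})"
    have [measurable]: "B l \<in> events" for l
      unfolding B_def by measurable
    have B: "prob (B l) \<le> P * exp (- (c * (2 * q) ^ n))" if "l \<in> net n" for l
    proof -
      have "0 \<le> real_of_int (snd l) * h n"
        using that h[of n] by (auto simp: net_def)
      then have "prob (B l) \<le> P * exp (- (2 * (p - s)\<^sup>2 * (\<kappa> / 2 * q ^ k) * 2 ^ Suc n))"
        unfolding B_def P_def start_def using qs by (intro prob_shrinks_le) (auto simp: n_def)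
      also have "\<dots> \<le> P * exp (- (c * (2 * q) ^ n))"
      proof -
        have "q ^ n \<le> q ^ k"
          using qs by (intro power_decreasing) (auto simp: n_def)
        then have "c * (2 ^ n * q ^ n) \<le> c * (2 ^ n * q ^ k)"
          using \<open>0 < c\<close> by (intro mult_left_mono) auto
        also have "\<dots> = 2 * (p - s)\<^sup>2 * (\<kappa> / 2 * q ^ k) * 2 ^ Suc n"
          by (simp add: c_def)
        finally show ?thesis
          using \<open>0 < P\<close> by (simp add: power_mult_distrib)
      qed
      finally show ?thesis .
    qed
    have "{\<omega> \<in> space M. start \<omega> \<and> bad k \<omega>} = (\<Union>l\<in>net n. B l)"
      by (auto simp: bad_def B_def n_def)
    also have "prob \<dots> \<le> (\<Sum>l\<in>net n. prob (B l))"
      using fin_net by (intro finite_measure_subadditive_finite) auto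
    also have "\<dots> \<le> (\<Sum>l\<in>net n. P * exp (- (c * (2 * q) ^ n)))"
      by (rule sum_mono) (rule B)
    also have "\<dots> = real (card (net n)) * (P * exp (- (c * (2 * q) ^ n)))"
      by simp
    also have "\<dots> \<le> (K\<^sup>2 * 64 ^ n) * (P * exp (- (c * (2 * q) ^ n)))"
      using \<open>0 < P\<close> by (intro mult_right_mono card_net) auto
    also have "\<dots> = P * f (k + n0)"
      by (simp add: f_def n_def add.commute)
    finally show ?thesis .
  qed
  have sum_f: "summable (\<lambda>k. f (k + n0))"
    using \<open>summable f\<close> by (simp add: summable_iff_shift)
  then have sum_Pf: "summable (\<lambda>k. P * f (k + n0))"
    by (rule summable_mult)
  have f_nonneg: "0 \<le> f n" for n
    by (simp add: f_def)
  have sum_bad: "summable (\<lambda>k. \<P>(\<omega> in M. start \<omega> \<and> bad k \<omega>))"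
    using bad_le by (intro summable_comparison_test'[OF sum_Pf, of 0]) auto
  have "prob (\<Union>k. {\<omega> \<in> space M. start \<omega> \<and> bad k \<omega>}) \<le> (\<Sum>k. \<P>(\<omega> in M. start \<omega> \<and> bad k \<omega>))"
    using sum_bad by (intro finite_measure_subadditive_countably) auto
  also have "\<dots> \<le> (\<Sum>k. P * f (k + n0))"
    using bad_le sum_bad sum_Pf by (intro suminf_le) auto
  also have "\<dots> = P * (\<Sum>k. f (k + n0))"
    using sum_f by (rule suminf_mult)
  also have "\<dots> < P * 1"
    using N[OF n0(2)] \<open>0 < P\<close> by (intro mult_strict_left_mono) auto
  finally have less: "prob (\<Union>k. {\<omega> \<in> space M. start \<omega> \<and> bad k \<omega>}) < P"
    by simp
  have "P \<le> prob ({\<omega> \<in> space M. blocks m g \<epsilon> \<omega>} \<union> (\<Union>k. {\<omega> \<in> space M. start \<omega> \<and> bad k \<omega>}))"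
    unfolding P_def using blocks by (intro finite_measure_mono) auto
  also have "\<dots> \<le> \<P>(\<omega> in M. blocks m g \<epsilon> \<omega>) + prob (\<Union>k. {\<omega> \<in> space M. start \<omega> \<and> bad k \<omega>})"
    by (intro measure_Un_le) auto
  finally have "0 < \<P>(\<omega> in M. blocks m g \<epsilon> \<omega>)"
    using less by linarith
  moreover have "0 < \<epsilon>" "\<epsilon> < 1"
    using n0(3) by (auto simp: \<epsilon>_def one_less_power)
  ultimately show ?thesis
    using that by blast
qed

end

section \<open>Counting unblocked squares\<close>

text \<open>Lexicographic order. A line with \<beta> > 0, followed upwards, meets the squares of a
  level in this order, so one order fixed in advance serves all tubes.\<close>

definition precedes :: "nat \<times> nat \<Rightarrow> nat \<times> nat \<Rightarrow> bool" where
  "precedes q' q \<longleftrightarrow> fst q' < fst q \<or> fst q' = fst q \<and> snd q' < snd q"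

lemma precedes_linear: "q \<noteq> q' \<Longrightarrow> precedes q q' \<or> precedes q' q"
  by (cases q; cases q') (auto simp: precedes_def)

text \<open>Nothing is demanded of the subtree of \<open>q\<close> itself. Hence the event reads no
  toss strictly below \<open>q\<close> and is independent of whether \<open>q\<close>
  blocks.\<close>

definition unblocked :: "(config \<Rightarrow> bool) \<Rightarrow> nat \<Rightarrow> (nat \<times> nat \<Rightarrow> bool) \<Rightarrow>
    nat \<times> nat \<Rightarrow> config \<Rightarrow> bool" where
  "unblocked B k T q \<omega> \<longleftrightarrow> T q \<and> q \<in> chosen_squares \<omega> k \<and>
     (\<forall>q'\<in>grid k. precedes q' q \<and> T q' \<and> q' \<in> chosen_squares \<omega> k \<longrightarrow> \<not> B (subtree k q' \<omega>))"

lemma measurable_unblocked [measurable]: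
  assumes [measurable]: "Measurable.pred (percolation p) B"
  shows "Measurable.pred (percolation p) (unblocked B k T q)"
proof -
  have "Measurable.pred (percolation p) (\<lambda>\<omega>. B (subtree k q \<omega>))" if "q \<in> grid k" for q
    using measurable_subtree[OF that] assms by (rule measurable_compose)
  note this[measurable]
  show ?thesis
    unfolding unblocked_def by measurable
qed

text \<open>With the square enlarged to side 1, the horizontal distance by which the line passes to
  the right of the upper left corner; \<open>gap_below\<close> is the distance to the left of the
  lower right corner. They are \<alpha> + \<beta> and 1 - \<alpha> of \<open>crossing_line\<close>
  for the enlarged line.\<close>

definition gap_above :: "nat \<Rightarrow> nat \<times> nat \<Rightarrow> real \<Rightarrow> real \<Rightarrow> real" where
  "gap_above k q \<alpha> \<beta> = 2 ^ k * \<alpha> + \<beta> * (real (snd q) + 1) - real (fst q)"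

definition gap_below :: "nat \<Rightarrow> nat \<times> nat \<Rightarrow> real \<Rightarrow> real \<Rightarrow> real" where
  "gap_below k q \<alpha> \<beta> = real (fst q) + 1 - (2 ^ k * \<alpha> + \<beta> * real (snd q))"

definition good_square :: "real \<Rightarrow> nat \<Rightarrow> nat \<times> nat \<Rightarrow> real \<times> real \<Rightarrow> real \<Rightarrow> bool" where
  "good_square g k q x \<beta> \<longleftrightarrow> g \<le> gap_above k q (fst x - \<beta> * snd x) \<beta> \<and> g \<le> gap_below k q (fst x - \<beta> * snd x) \<beta>"

text \<open>Two lines through \<open>x\<close> with parameters this close differ horizontally by at
  most \<open>g\<close> sides of level \<open>k\<close>, as long as the height differs from that of
  \<open>x\<close> by at most 1 + X.\<close>

definition mesh :: "real \<Rightarrow> real \<Rightarrow> nat \<Rightarrow> real" where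
  "mesh g X k = g / ((1 + X) * 2 ^ k)"

text \<open>Tube \<open>r\<close> is represented by the line through \<open>x\<close> with parameter
  \<open>r * mesh g X k\<close>. The last two conditions put the square into the upper right
  quadrant of \<open>x\<close>, so that its points on such a line lie beyond
  \<open>x\<close>.\<close>

definition candidate :: "real \<Rightarrow> real \<Rightarrow> nat \<Rightarrow> nat \<Rightarrow> real \<times> real \<Rightarrow> nat \<times> nat \<Rightarrow> bool" where
  "candidate g X k r x q \<longleftrightarrow> good_square (2 * g) k q x (real r * mesh g X k) \<and>
     fst x \<le> real (fst q) / 2 ^ k \<and> snd x \<le> real (snd q) / 2 ^ k"

definition unblocked_set :: "real \<Rightarrow> real \<Rightarrow> real \<Rightarrow> real \<Rightarrow> nat \<Rightarrow> nat \<Rightarrow> real \<times> real \<Rightarrow>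
    config \<Rightarrow> (nat \<times> nat) set" where
  "unblocked_set m g \<epsilon> X k r x \<omega> = {q \<in> grid k. unblocked (blocks m g \<epsilon>) k (candidate g X k r x) q \<omega>}"

definition tube_count :: "real \<Rightarrow> real \<Rightarrow> real \<Rightarrow> nat \<Rightarrow> nat" where
  "tube_count m g X k = nat \<lfloor>m / mesh g X k\<rfloor>"

definition visible_count :: "real \<Rightarrow> real \<Rightarrow> real \<Rightarrow> real \<Rightarrow> nat \<Rightarrow> real \<times> real \<Rightarrow>
    config \<Rightarrow> real" where
  "visible_count m g \<epsilon> X k x \<omega> = (\<Sum>r\<le>tube_count m g X k. real (card (unblocked_set m g \<epsilon> X k r x \<omega>)))"

text \<open>A covering square of level \<open>n\<close> is charged to a square of some level up to
  \<open>n\<close>, hence the sum; 2^-n is its side length. The lower limit is what Fatou's lemma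
  controls, and covers along a subsequence of levels bound the Hausdorff measure.\<close>

definition mean_count :: "real \<Rightarrow> real \<Rightarrow> real \<Rightarrow> real \<Rightarrow> real \<times> real \<Rightarrow>
    config \<Rightarrow> ennreal" where
  "mean_count m g \<epsilon> X x \<omega> = liminf (\<lambda>n. ennreal ((\<Sum>k\<le>n. visible_count m g \<epsilon> X k x \<omega>) / 2 ^ n))"

lemma card_unblocked_set:
  "real (card (unblocked_set m g \<epsilon> X k r x \<omega>)) =
    (\<Sum>q\<in>grid k. of_bool (unblocked (blocks m g \<epsilon>) k (candidate g X k r x) q \<omega>))"
  by (simp add: unblocked_set_def of_bool_def sum.If_cases Int_def)

lemma measurable_visible_count [measurable]:
  "visible_count m g \<epsilon> X k x \<in> borel_measurable (percolation p)"
  unfolding visible_count_def card_unblocked_set by measurable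

lemma measurable_mean_count [measurable]:
  "mean_count m g \<epsilon> X x \<in> borel_measurable (percolation p)"
  unfolding mean_count_def by measurable

lemma measurable_candidate [measurable]:
  "Measurable.pred lborel (\<lambda>x. candidate g X k r x q)"
proof -
  have [measurable]: "(fst :: real \<times> real \<Rightarrow> real) \<in> borel_measurable lborel"
    "(snd :: real \<times> real \<Rightarrow> real) \<in> borel_measurable lborel"
    by (auto intro!: borel_measurable_continuous_onI continuous_intros)
  show ?thesis
    unfolding candidate_def good_square_def gap_above_def gap_below_def by measurable
qed

text \<open>Joint measurability prepares the exchange of quantifiers in
  \<open>AE_AE_visible_counts_finite\<close>.\<close>

lemma measurable_mean_count_joint:
  "(\<lambda>z. mean_count m g \<epsilon> X (fst z) (snd z)) \<in> borel_measurable (lborel \<Otimes>\<^sub>M percolation p)"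
proof -
  have blocks: "Measurable.pred (percolation p) (\<lambda>\<omega>. blocks m g \<epsilon> (subtree k q \<omega>))" if "q \<in> grid k" for k q
    using measurable_subtree[OF that] measurable_blocks by (rule measurable_compose)
  have [measurable]: "Measurable.pred (lborel \<Otimes>\<^sub>M percolation p) (\<lambda>z. candidate g X k r (fst z) q)" for k r q
    using measurable_fst measurable_candidate by (rule measurable_compose)
  have [measurable]: "Measurable.pred (lborel \<Otimes>\<^sub>M percolation p) (\<lambda>z. q \<in> chosen_squares (snd z) k)" for k q
    using measurable_snd measurable_chosen_squares by (rule measurable_compose)
  have [measurable]: "Measurable.pred (lborel \<Otimes>\<^sub>M percolation p) (\<lambda>z. blocks m g \<epsilon> (subtree k q (snd z)))"
    if "q \<in> grid k" for k q
    using measurable_snd blocks[OF that] by (rule measurable_compose)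
  show ?thesis
    unfolding mean_count_def visible_count_def card_unblocked_set unblocked_def by measurable
qed

section \<open>Expected number of unblocked squares\<close>

context fractal_percolation
begin

text \<open>The events that \<open>q\<close> is unblocked and itself blocks are disjoint for
  different \<open>q\<close>, since the earlier square would block the later one. By independence
  each has the probability of being unblocked times that of \<open>B\<close>, and together they have
  probability at most 1.\<close>

lemma sum_prob_unblocked_le:
  assumes [measurable]: "Measurable.pred M B" and pos: "0 < \<P>(\<omega> in M. B \<omega>)"
  shows "(\<Sum>q\<in>grid k. \<P>(\<omega> in M. unblocked B k T q \<omega>)) \<le> 1 / \<P>(\<omega> in M. B \<omega>)"
proof -
  define A where "A = (\<lambda>q. {\<omega> \<in> space M. unblocked B k T q \<omega> \<and> B (subtree k q \<omega>)})"
  have meas: "Measurable.pred M (\<lambda>\<omega>. B (subtree k q \<omega>))" if "q \<in> grid k" for q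
    using measurable_subtree[OF that] assms(1) by (rule measurable_compose)
  have A: "A q \<in> events" if "q \<in> grid k" for q
  proof -
    note meas[OF that, measurable]
    show ?thesis
      unfolding A_def by measurable
  qed
  have prob_A: "prob (A q) = \<P>(\<omega> in M. unblocked B k T q \<omega>) * \<P>(\<omega> in M. B \<omega>)"
    if q: "q \<in> grid k" for q
  proof -
    note meas[OF q, measurable]
    have "prob (A q) = \<P>(\<omega> in M. unblocked B k T q \<omega>) * \<P>(\<omega> in M. B (subtree k q \<omega>))"
      unfolding A_def
    proof (rule prob_conj_independent[where I = "- labels_below k q" and J = "labels_below k q"])
      show "determined_by (unblocked B k T q) (- labels_below k q)"
      proof (rule determined_byI)
        fix \<omega> \<omega>' :: config
        assume eq: "\<And>l. l \<in> - labels_below k q \<Longrightarrow> \<omega> l = \<omega>' l"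
        have "chosen_squares \<omega> k = chosen_squares \<omega>' k"
          using eq labels_below_disjoint_upto[of k q] by (intro chosen_squares_cong) blast
        moreover have "subtree k q' \<omega> = subtree k q' \<omega>'" if "precedes q' q" for q'
        proof (rule subtree_cong)
          fix l assume "l \<in> labels_below k q'"
          moreover have "q' \<noteq> q"
            using that by (auto simp: precedes_def)
          ultimately have "l \<notin> labels_below k q"
            using labels_below_disjoint by blast
          then show "\<omega> l = \<omega>' l"
            using eq by simp
        qed
        ultimately show "unblocked B k T q \<omega> = unblocked B k T q \<omega>'"
          unfolding unblocked_def by (metis (no_types, lifting))
      qed
      show "determined_by (\<lambda>\<omega>. B (subtree k q \<omega>)) (labels_below k q)"
        by (rule determined_byI) (metis subtree_cong)
    qed (use meas[OF q] in \<open>auto intro: measurable_unblocked\<close>)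
    then show ?thesis
      using q by (simp add: prob_subtree)
  qed
  have "disjoint_family_on A (grid k)"
  proof -
    have "A q \<inter> A q' = {}" if "precedes q q'" "q \<in> grid k" for q q'
      using that by (auto simp: A_def unblocked_def)
    then have "A q \<inter> A q' = {}" if "q \<in> grid k" "q' \<in> grid k" "q \<noteq> q'" for q q'
      using that precedes_linear by blast
    then show ?thesis
      by (simp add: disjoint_family_on_def)
  qed
  then have "(\<Sum>q\<in>grid k. prob (A q)) = prob (\<Union>q\<in>grid k. A q)"
    using A by (intro finite_measure_finite_Union[symmetric]) auto
  also have "\<dots> \<le> 1"
    by simp
  finally show ?thesis
    using pos by (simp add: prob_A field_simps flip: sum_distrib_left)
qed

lemma nn_integral_visible_count_le:
  assumes "0 < g" "0 \<le> X" "1 \<le> m" and pos: "0 < \<P>(\<omega> in M. blocks m g \<epsilon> \<omega>)"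
  shows "(\<integral>\<^sup>+\<omega>. ennreal (visible_count m g \<epsilon> X k x \<omega>) \<partial>M)
    \<le> ennreal ((m * (1 + X) / g + 1) / \<P>(\<omega> in M. blocks m g \<epsilon> \<omega>) * 2 ^ k)"
proof -
  define c where "c = \<P>(\<omega> in M. blocks m g \<epsilon> \<omega>)"
  define N where "N = tube_count m g X k"
  have eq: "m / mesh g X k = m * (1 + X) / g * 2 ^ k"
    using assms by (simp add: mesh_def)
  have "real N \<le> m * (1 + X) / g * 2 ^ k"
    unfolding N_def tube_count_def eq using assms
    by (simp add: of_nat_nat)
  moreover have "1 \<le> (2::real) ^ k"
    by simp
  ultimately have "real (Suc N) \<le> m * (1 + X) / g * 2 ^ k + 2 ^ k"
    unfolding of_nat_Suc by linarith
  then have N: "real (Suc N) \<le> (m * (1 + X) / g + 1) * 2 ^ k"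
    by (simp add: algebra_simps)
  have count: "(\<integral>\<^sup>+\<omega>. ennreal (real (card (unblocked_set m g \<epsilon> X k r x \<omega>))) \<partial>M) \<le> ennreal (1 / c)" for r
  proof -
    define U where "U = (\<lambda>q. {\<omega> \<in> space M. unblocked (blocks m g \<epsilon>) k (candidate g X k r x) q \<omega>})"
    have [measurable]: "U q \<in> events" for q
      unfolding U_def by measurable
    have "(\<integral>\<^sup>+\<omega>. ennreal (real (card (unblocked_set m g \<epsilon> X k r x \<omega>))) \<partial>M) =
        (\<integral>\<^sup>+\<omega>. (\<Sum>q\<in>grid k. indicator (U q) \<omega>) \<partial>M)"
      unfolding card_unblocked_set
      by (intro nn_integral_cong) (simp add: U_def indicator_def of_bool_def sum.If_cases Int_def ennreal_of_nat_eq_real_of_nat)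
    also have "\<dots> = (\<Sum>q\<in>grid k. emeasure M (U q))"
      by (simp add: nn_integral_sum)
    also have "\<dots> = ennreal (\<Sum>q\<in>grid k. prob (U q))"
      by (simp add: emeasure_eq_measure sum_ennreal)
    also have "\<dots> \<le> ennreal (1 / c)"
      unfolding U_def c_def using pos by (intro ennreal_leI sum_prob_unblocked_le) auto
    finally show ?thesis .
  qed
  have "(\<integral>\<^sup>+\<omega>. ennreal (visible_count m g \<epsilon> X k x \<omega>) \<partial>M) =
      (\<integral>\<^sup>+\<omega>. (\<Sum>r\<le>N. ennreal (real (card (unblocked_set m g \<epsilon> X k r x \<omega>)))) \<partial>M)"
    unfolding visible_count_def N_def by (simp add: sum_ennreal)
  also have "\<dots> = (\<Sum>r\<le>N. \<integral>\<^sup>+\<omega>. ennreal (real (card (unblocked_set m g \<epsilon> X k r x \<omega>))) \<partial>M)"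
    unfolding card_unblocked_set by (intro nn_integral_sum) measurable
  also have "\<dots> \<le> (\<Sum>r\<le>N. ennreal (1 / c))"
    by (intro sum_mono count)
  also have "\<dots> = ennreal (real (Suc N) * (1 / c))"
    using pos unfolding c_def
    by (subst ennreal_mult) (simp_all add: ennreal_of_nat_eq_real_of_nat del: of_nat_Suc)
  also have "\<dots> \<le> ennreal ((m * (1 + X) / g + 1) * 2 ^ k * (1 / c))"
    using N pos by (intro ennreal_leI mult_right_mono) (auto simp: c_def)
  finally show ?thesis
    by (simp add: c_def)
qed

text \<open>The powers 2^k up to k = n sum to less than 2 * 2^n, so the normalised means stay below
  2 * C and Fatou's lemma applies.\<close>

lemma AE_mean_count_finite:
  assumes "0 < g" "0 \<le> X" "1 \<le> m" and pos: "0 < \<P>(\<omega> in M. blocks m g \<epsilon> \<omega>)"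
  shows "AE \<omega> in M. mean_count m g \<epsilon> X x \<omega> < \<infinity>"
proof -
  define C where "C = (m * (1 + X) / g + 1) / \<P>(\<omega> in M. blocks m g \<epsilon> \<omega>)"
  have C: "0 \<le> C"
    using assms by (simp add: C_def)
  have nonneg: "0 \<le> visible_count m g \<epsilon> X k x \<omega>" for k \<omega>
    by (simp add: visible_count_def sum_nonneg)
  have bound: "(\<integral>\<^sup>+\<omega>. ennreal ((\<Sum>k\<le>n. visible_count m g \<epsilon> X k x \<omega>) / 2 ^ n) \<partial>M) \<le> ennreal (2 * C)" for n
  proof -
    have "(\<integral>\<^sup>+\<omega>. ennreal ((\<Sum>k\<le>n. visible_count m g \<epsilon> X k x \<omega>) / 2 ^ n) \<partial>M) =
        (\<integral>\<^sup>+\<omega>. ennreal (1 / 2 ^ n) * (\<Sum>k\<le>n. ennreal (visible_count m g \<epsilon> X k x \<omega>)) \<partial>M)"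
      using nonneg by (intro nn_integral_cong) (simp add: sum_ennreal sum_nonneg flip: ennreal_mult)
    also have "\<dots> = ennreal (1 / 2 ^ n) * (\<Sum>k\<le>n. \<integral>\<^sup>+\<omega>. ennreal (visible_count m g \<epsilon> X k x \<omega>) \<partial>M)"
      by (simp add: nn_integral_cmult nn_integral_sum)
    also have "\<dots> \<le> ennreal (1 / 2 ^ n) * (\<Sum>k\<le>n. ennreal (C * 2 ^ k))"
      unfolding C_def using assms by (intro mult_left_mono sum_mono nn_integral_visible_count_le) auto
    also have "\<dots> = ennreal (1 / 2 ^ n * (\<Sum>k\<le>n. C * 2 ^ k))"
      using C by (subst sum_ennreal) (auto simp: sum_nonneg simp flip: ennreal_mult)
    also have "(\<Sum>k\<le>n. C * 2 ^ k) = C * (2 ^ Suc n - 1)"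
      by (induction n) (simp_all add: algebra_simps)
    also have "ennreal (1 / 2 ^ n * (C * (2 ^ Suc n - 1))) \<le> ennreal (2 * C)"
      using C by (intro ennreal_leI) (simp add: field_simps)
    finally show ?thesis .
  qed
  have "(\<integral>\<^sup>+\<omega>. mean_count m g \<epsilon> X x \<omega> \<partial>M) \<le>
      liminf (\<lambda>n. \<integral>\<^sup>+\<omega>. ennreal ((\<Sum>k\<le>n. visible_count m g \<epsilon> X k x \<omega>) / 2 ^ n) \<partial>M)"
    unfolding mean_count_def by (rule nn_integral_liminf) measurable
  also have "\<dots> \<le> liminf (\<lambda>n. ennreal (2 * C))"
    by (rule Liminf_mono) (simp add: bound)
  also have "\<dots> = ennreal (2 * C)"
    by (rule Liminf_const) simp
  finally have "(\<integral>\<^sup>+\<omega>. mean_count m g \<epsilon> X x \<omega> \<partial>M) \<noteq> \<infinity>"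
    by (auto simp: top_unique)
  then have "AE \<omega> in M. mean_count m g \<epsilon> X x \<omega> \<noteq> \<infinity>"
    by (intro nn_integral_noteq_infinite) measurable
  then show ?thesis
    by eventually_elim (simp add: less_top)
qed

end

section \<open>Hausdorff measure\<close>

lemma hausdorff1_delta_mono: "A \<subseteq> B \<Longrightarrow> hausdorff1_delta \<delta> A \<le> hausdorff1_delta \<delta> B"
  unfolding hausdorff1_delta_def by (rule INF_superset_mono) auto

lemma hausdorff1_mono: "A \<subseteq> B \<Longrightarrow> hausdorff1 A \<le> hausdorff1 B"
  unfolding hausdorff1_def by (intro SUP_mono') (rule hausdorff1_delta_mono)

lemma hausdorff1_le_finite_covers:
  fixes A :: "'a::metric_space set"
  assumes "\<And>\<delta>. 0 < \<delta> \<Longrightarrow> \<exists>F d. finite F \<and> A \<subseteq> \<Union>F \<and> (\<forall>U\<in>F. bounded U \<and> diameter U \<le> d) \<and>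
    0 \<le> d \<and> d \<le> \<delta> \<and> real (card F) * d \<le> K"
  shows "hausdorff1 A \<le> ennreal K"
  unfolding hausdorff1_def
proof (rule SUP_least)
  fix \<delta> :: real assume "\<delta> \<in> {0<..}"
  then obtain F :: "'a set set" and d where F: "finite F" "A \<subseteq> \<Union>F" "\<And>U. U \<in> F \<Longrightarrow> bounded U \<and> diameter U \<le> d"
    and d: "0 \<le> d" "d \<le> \<delta>" "real (card F) * d \<le> K"
    using assms[of \<delta>] by auto
  obtain f where f: "bij_betw f {0..<card F} F"
    using ex_bij_betw_nat_finite[OF F(1)] by blast
  define U where "U = (\<lambda>i. if i < card F then f i else {})"
  have fU: "f i \<in> F" if "i < card F" for i
    using f that by (auto simp: bij_betw_def)
  have "A \<subseteq> (\<Union>i. U i)"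
  proof
    fix a assume "a \<in> A"
    then obtain V where "V \<in> F" "a \<in> V"
      using F(2) by blast
    from \<open>V \<in> F\<close> have "V \<in> f ` {0..<card F}"
      using f by (simp add: bij_betw_def)
    then obtain i where "i < card F" "f i = V"
      by auto
    with \<open>a \<in> V\<close> show "a \<in> (\<Union>i. U i)"
      by (auto simp: U_def)
  qed
  moreover have U: "bounded (U i) \<and> diameter (U i) \<le> d" for i
    using F(3) fU d by (auto simp: U_def diameter_empty)
  ultimately have "hausdorff1_delta \<delta> A \<le> (\<Sum>i. ennreal (diameter (U i)))"
    unfolding hausdorff1_delta_def using d by (intro INF_lower) (auto intro: order_trans)
  also have "\<dots> = (\<Sum>i<card F. ennreal (diameter (U i)))"
    by (intro suminf_finite) (auto simp: U_def diameter_empty)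
  also have "\<dots> \<le> (\<Sum>i<card F. ennreal d)"
    using U by (intro sum_mono ennreal_leI) auto
  also have "\<dots> = ennreal (real (card F) * d)"
    using d by (simp add: ennreal_mult ennreal_of_nat_eq_real_of_nat)
  also have "\<dots> \<le> ennreal K"
    using d by (intro ennreal_leI)
  finally show "hausdorff1_delta \<delta> A \<le> ennreal K" .
qed

lemma hausdorff1_subsingleton: "A \<subseteq> {a} \<Longrightarrow> hausdorff1 A = 0"
  using hausdorff1_le_finite_covers[of A 0]
  by (force intro!: exI[of _ "{{a}}"] simp: le_zero_eq)

lemma hausdorff1_image_le:
  fixes f :: "'a::metric_space \<Rightarrow> 'b::metric_space"
  assumes f: "\<And>a b. dist (f a) (f b) \<le> dist a b"
  shows "hausdorff1 (f ` A) \<le> hausdorff1 A"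
proof -
  have "hausdorff1_delta \<delta> (f ` A) \<le> hausdorff1_delta \<delta> A" for \<delta>
    unfolding hausdorff1_delta_def
  proof (rule INF_mono)
    fix U :: "nat \<Rightarrow> 'a set"
    assume "U \<in> {U. A \<subseteq> (\<Union>i. U i) \<and> (\<forall>i. bounded (U i) \<and> diameter (U i) \<le> \<delta>)}"
    then have U: "A \<subseteq> (\<Union>i. U i)" "\<And>i. bounded (U i)" "\<And>i. diameter (U i) \<le> \<delta>"
      by auto
    have bounded: "bounded (f ` U i)" for i
    proof -
      obtain x e where "\<forall>y\<in>U i. dist x y \<le> e"
        using U(2)[of i] unfolding bounded_def by blast
      then have "\<forall>y\<in>f ` U i. dist (f x) y \<le> e"
        using f order_trans by fast
      then show ?thesis
        unfolding bounded_def by blast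
    qed
    have diam: "diameter (f ` U i) \<le> diameter (U i)" for i
    proof (cases "U i = {}")
      case False
      have "dist (f a) (f b) \<le> diameter (U i)" if "a \<in> U i" "b \<in> U i" for a b
        using f[of a b] diameter_bounded_bound[OF U(2) that] by simp
      with False show ?thesis
        by (subst diameter_def) (auto intro!: cSUP_least)
    qed simp
    show "\<exists>V\<in>{V. f ` A \<subseteq> (\<Union>i. V i) \<and> (\<forall>i. bounded (V i) \<and> diameter (V i) \<le> \<delta>)}.
        (\<Sum>i. ennreal (diameter (V i))) \<le> (\<Sum>i. ennreal (diameter (U i)))"
    proof (rule bexI)
      show "(\<Sum>i. ennreal (diameter (f ` U i))) \<le> (\<Sum>i. ennreal (diameter (U i)))"
        using diam by (intro suminf_le ennreal_leI) auto
      have "f ` A \<subseteq> (\<Union>i. f ` U i)"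
        using U(1) by (simp add: image_UN[symmetric] image_mono)
      moreover have "diameter (f ` U i) \<le> \<delta>" for i
        using diam[of i] U(3)[of i] by (rule order_trans)
      ultimately show "(\<lambda>i. f ` U i) \<in> {V. f ` A \<subseteq> (\<Union>i. V i) \<and> (\<forall>i. bounded (V i) \<and> diameter (V i) \<le> \<delta>)}"
        using bounded by simp
    qed
  qed
  then show ?thesis
    unfolding hausdorff1_def by (intro SUP_mono')
qed

text \<open>Each covering set is replaced by a closed interval about the image of one of its points
  with radius L times the diameter. These intervals are measurable and cover [s, t], so their
  lengths add up to at least t - s. The scale of the cover does not enter, so the bound is taken at
  \<delta> = 1.\<close>

lemma hausdorff1_pos_if_interval_image:
  fixes f :: "'a::metric_space \<Rightarrow> real"
  assumes f: "\<And>a b. a \<in> A \<Longrightarrow> b \<in> A \<Longrightarrow> \<bar>f a - f b\<bar> \<le> L * dist a b"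
    and L: "0 < L" and "s < t" "{s..t} \<subseteq> f ` A"
  shows "0 < hausdorff1 A"
proof -
  have "ennreal ((t - s) / (2 * L)) \<le> hausdorff1_delta 1 A"
    unfolding hausdorff1_delta_def
  proof (rule INF_greatest)
    fix U :: "nat \<Rightarrow> 'a set"
    assume "U \<in> {U. A \<subseteq> (\<Union>i. U i) \<and> (\<forall>i. bounded (U i) \<and> diameter (U i) \<le> 1)}"
    then have U: "A \<subseteq> (\<Union>i. U i)" "\<And>i. bounded (U i)"
      by auto
    define c where "c = (\<lambda>i. f (SOME a. a \<in> A \<inter> U i))"
    define V where "V = (\<lambda>i. cball (c i) (L * diameter (U i)))"
    have V: "f a \<in> V i" if "a \<in> A" "a \<in> U i" for a i
    proof -
      define b where "b = (SOME b. b \<in> A \<inter> U i)"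
      have "b \<in> A \<inter> U i"
        unfolding b_def by (rule someI[of _ a]) (use that in auto)
      then have "\<bar>f b - f a\<bar> \<le> L * dist b a" "dist b a \<le> diameter (U i)"
        using f that diameter_bounded_bound[OF U(2)] by auto
      then have "\<bar>f b - f a\<bar> \<le> L * diameter (U i)"
        using L by (meson mult_left_mono less_imp_le order_trans)
      moreover have "c i = f b"
        by (simp add: c_def b_def)
      ultimately show ?thesis
        by (simp add: V_def dist_real_def)
    qed
    have "f ` A \<subseteq> (\<Union>i. V i)"
    proof (rule image_subsetI)
      fix a assume "a \<in> A"
      with U(1) obtain i where "a \<in> U i"
        by auto
      with V[OF \<open>a \<in> A\<close>] show "f a \<in> (\<Union>i. V i)"
        by (intro UN_I) auto
    qed
    with assms(4) have "{s..t} \<subseteq> (\<Union>i. V i)"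
      by (rule order_trans)
    then have "emeasure lborel {s..t} \<le> emeasure lborel (\<Union>i. V i)"
      by (intro emeasure_mono) (auto simp: V_def)
    also have "\<dots> \<le> (\<Sum>i. emeasure lborel (V i))"
      by (intro emeasure_subadditive_countably) (auto simp: V_def)
    also have "\<dots> = (\<Sum>i. ennreal (2 * L) * ennreal (diameter (U i)))"
      using L U(2) by (intro suminf_cong)
        (simp add: V_def cball_eq_atLeastAtMost diameter_ge_0 flip: ennreal_mult)
    also have "\<dots> = ennreal (2 * L) * (\<Sum>i. ennreal (diameter (U i)))"
      by (rule ennreal_suminf_cmult)
    finally have "ennreal (t - s) \<le> ennreal (2 * L) * (\<Sum>i. ennreal (diameter (U i)))"
      using \<open>s < t\<close> by simp
    then have "ennreal (1 / (2 * L)) * ennreal (t - s) \<le>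
        ennreal (1 / (2 * L)) * (ennreal (2 * L) * (\<Sum>i. ennreal (diameter (U i))))"
      by (rule mult_left_mono) simp
    also have "\<dots> = (\<Sum>i. ennreal (diameter (U i)))"
      using L by (simp flip: mult.assoc ennreal_mult)
    also have "ennreal (1 / (2 * L)) * ennreal (t - s) = ennreal ((t - s) / (2 * L))"
      using L \<open>s < t\<close> by (simp flip: ennreal_mult)
    finally show "ennreal ((t - s) / (2 * L)) \<le> (\<Sum>i. ennreal (diameter (U i)))" .
  qed
  also have "\<dots> \<le> hausdorff1 A"
    unfolding hausdorff1_def by (rule SUP_upper) simp
  finally have "ennreal ((t - s) / (2 * L)) \<le> hausdorff1 A" .
  moreover have "0 < ennreal ((t - s) / (2 * L))"
    using L \<open>s < t\<close> by simp
  ultimately show ?thesis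
    by (rule less_le_trans[rotated])
qed

lemma sigma_finite_hausdorff1_countable:
  assumes "countable \<B>" "A = \<Union>\<B>" "\<And>B. B \<in> \<B> \<Longrightarrow> hausdorff1 B < \<infinity>"
  shows "sigma_finite_hausdorff1 A"
proof (cases "\<B> = {}")
  case True
  with assms have "A = {}"
    by simp
  then show ?thesis
    unfolding sigma_finite_hausdorff1_def
    by (intro exI[of _ "\<lambda>_. {}"]) (simp add: hausdorff1_subsingleton[of "{}" undefined])
next
  case False
  then show ?thesis
    unfolding sigma_finite_hausdorff1_def using assms
    by (intro exI[of _ "from_nat_into \<B>"]) (auto simp: from_nat_into)
qed

section \<open>Covering the visible part\<close>

text \<open>This is dx/dy, the parameter \<beta> of the line through both points. On horizontal
  lines division by zero gives 0, outside the positive ranges considered.\<close>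

definition slope :: "real \<times> real \<Rightarrow> real \<times> real \<Rightarrow> real" where
  "slope x a = (fst a - fst x) / (snd a - snd x)"

definition cone :: "real \<Rightarrow> real \<times> real \<Rightarrow> (real \<times> real) set" where
  "cone m x = {a. snd x < snd a \<and> 1 / m \<le> slope x a \<and> slope x a \<le> m}"

lemma slope_mult: "snd a \<noteq> snd x \<Longrightarrow> slope x a * (snd a - snd x) = fst a - fst x"
  by (simp add: slope_def)

lemma dist_le_slope:
  assumes "snd a \<noteq> snd x"
  shows "dist x a \<le> (\<bar>slope x a\<bar> + 1) * \<bar>snd a - snd x\<bar>"
proof -
  have "dist x a = dist a x"
    by (rule dist_commute)
  also have "\<dots> \<le> \<bar>fst a - fst x\<bar> + \<bar>snd a - snd x\<bar>"
    by (simp add: dist_prod_def dist_real_def sqrt_sum_squares_le_sum_abs)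
  also have "\<bar>fst a - fst x\<bar> = \<bar>slope x a\<bar> * \<bar>snd a - snd x\<bar>"
    unfolding slope_mult[OF assms, symmetric] by (rule abs_mult)
  finally show ?thesis
    by (simp add: distrib_right)
qed

lemma diameter_dyadic_square: "diameter (dyadic_square n q) \<le> 2 / 2 ^ n"
proof (rule diameter_le)
  show "dyadic_square n q \<noteq> {} \<or> (0::real) \<le> 2 / 2 ^ n"
    by simp
  fix z w assume "z \<in> dyadic_square n q" "w \<in> dyadic_square n q"
  then have "\<bar>2 ^ n * fst z - 2 ^ n * fst w\<bar> \<le> 1" "\<bar>2 ^ n * snd z - 2 ^ n * snd w\<bar> \<le> 1"
    by (auto simp: mem_dyadic_square_iff abs_le_iff)
  then have "2 ^ n * \<bar>fst z - fst w\<bar> \<le> 1" "2 ^ n * \<bar>snd z - snd w\<bar> \<le> 1"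
    by (simp_all add: abs_mult flip: right_diff_distrib)
  then have "\<bar>fst z - fst w\<bar> + \<bar>snd z - snd w\<bar> \<le> 2 / 2 ^ n"
    by (simp add: field_simps)
  moreover have "norm (z - w) \<le> \<bar>fst z - fst w\<bar> + \<bar>snd z - snd w\<bar>"
    by (simp add: norm_prod_def sqrt_sum_squares_le_sum_abs)
  ultimately show "norm (z - w) \<le> 2 / 2 ^ n"
    by simp
qed

lemma good_square_perturb:
  assumes "good_square c k q x \<beta>" "\<bar>\<beta> - \<beta>'\<bar> \<le> mesh g X k" "q \<in> grid k" "\<bar>snd x\<bar> \<le> X" "0 < g"
  shows "good_square (c - g) k q x \<beta>'"
proof -
  have X: "0 \<le> X"
    using assms(4) by simp
  have "snd q < 2 ^ k"
    using assms(3) by (simp add: mem_grid_iff)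
  then have "real (snd q + 1) \<le> real (2 ^ k)"
    by (simp only: of_nat_le_iff)
  then have q: "real (snd q) + 1 \<le> 2 ^ k"
    by simp
  have "2 ^ k * \<bar>snd x\<bar> \<le> 2 ^ k * X"
    using assms(4) by (intro mult_left_mono) auto
  then have sx: "\<bar>2 ^ k * snd x\<bar> \<le> 2 ^ k * X"
    by (simp add: abs_mult)
  have *: "\<bar>(\<beta> - \<beta>') * t\<bar> \<le> g" if "\<bar>t\<bar> \<le> 2 ^ k * (1 + X)" for t
  proof -
    have "\<bar>(\<beta> - \<beta>') * t\<bar> \<le> mesh g X k * (2 ^ k * (1 + X))"
      unfolding abs_mult using that assms by (intro mult_mono) auto
    also have "\<dots> = g"
      using X by (simp add: mesh_def)
    finally show ?thesis .
  qed
  have "\<bar>real (snd q) + 1 - 2 ^ k * snd x\<bar> \<le> 2 ^ k * (1 + X)" "\<bar>real (snd q) - 2 ^ k * snd x\<bar> \<le> 2 ^ k * (1 + X)"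
    using q sx unfolding distrib_left mult_1_right by linarith+
  from this[THEN *] show ?thesis
    using assms(1) by (auto simp: good_square_def gap_above_def gap_below_def algebra_simps abs_le_iff)
qed

lemma blocks_subtree_hit:
  assumes blocks: "blocks m g \<epsilon> (subtree k q \<omega>)" and q: "q \<in> chosen_squares \<omega> k"
    and good: "good_square g k q x \<beta>" and \<beta>: "1 / m \<le> \<beta>" "\<beta> \<le> m"
  obtains b y z where "b \<in> percolation_set \<omega>" "fst b - fst x = \<beta> * (snd b - snd x)"
    "2 ^ k * fst b = real (fst q) + y" "\<epsilon> \<le> y" "y \<le> 1 - \<epsilon>"
    "2 ^ k * snd b = real (snd q) + z" "\<epsilon> \<le> z" "z \<le> 1 - \<epsilon>"
proof -
  define \<alpha> where "\<alpha> = fst x - \<beta> * snd x"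
  \<comment> \<open>The first parameter of the line once \<open>q\<close> is enlarged to the unit
    square; the enlargement leaves \<beta> unchanged.\<close>
  define \<alpha>' where "\<alpha>' = 2 ^ k * \<alpha> + \<beta> * real (snd q) - real (fst q)"
  have "crossing_line m g \<alpha>' \<beta>"
    using good \<beta> by (simp add: crossing_line_def good_square_def gap_above_def gap_below_def \<alpha>'_def \<alpha>_def algebra_simps)
  from blocksD[OF blocks this] obtain z where z: "(\<alpha>' + \<beta> * z, z) \<in> percolation_set (subtree k q \<omega>)"
    "\<epsilon> \<le> z" "z \<le> 1 - \<epsilon>" "\<epsilon> \<le> \<alpha>' + \<beta> * z" "\<alpha>' + \<beta> * z \<le> 1 - \<epsilon>" .
  define b where "b = zoom_in k q (\<alpha>' + \<beta> * z, z)"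
  have b1: "2 ^ k * fst b = real (fst q) + (\<alpha>' + \<beta> * z)" and b2: "2 ^ k * snd b = real (snd q) + z"
    by (simp_all add: b_def zoom_in_def)
  have "2 ^ k * fst b = 2 ^ k * \<alpha> + \<beta> * (2 ^ k * snd b)"
    unfolding b1 b2 by (simp add: \<alpha>'_def algebra_simps)
  then have "2 ^ k * fst b = 2 ^ k * (\<alpha> + \<beta> * snd b)"
    by (simp add: algebra_simps)
  then have "fst b = \<alpha> + \<beta> * snd b"
    by simp
  then have "fst b - fst x = \<beta> * (snd b - snd x)"
    by (simp add: \<alpha>_def algebra_simps)
  moreover have "b \<in> percolation_set \<omega>"
    unfolding b_def using q z(1) by (rule zoom_in_percolation_set)
  ultimately show ?thesis
    using that b1 b2 z(2-5) by blast
qed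

text \<open>Replacing the line of sight by the representative of its tube makes \<open>q\<close> a
  candidate with margin 2 * g. A blocking candidate before \<open>q\<close> keeps margin
  \<open>g\<close> for the true line of sight, hence contains a point of the set on this line
  strictly before \<open>a\<close>, against visibility.\<close>

lemma visible_imp_unblocked:
  assumes a: "a \<in> visible_part x (percolation_set \<omega>)" "a \<in> cone m x"
    and q: "q \<in> chosen_squares \<omega> k" "a \<in> dyadic_square k q" "good_square (3 * g) k q x (slope x a)"
      "fst x \<le> real (fst q) / 2 ^ k" "snd x \<le> real (snd q) / 2 ^ k"
    and par: "1 \<le> m" "0 < g" "\<bar>snd x\<bar> \<le> X" "0 < \<epsilon>"
  shows "\<exists>r\<le>tube_count m g X k. q \<in> unblocked_set m g \<epsilon> X k r x \<omega>"
proof -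
  define \<beta> where "\<beta> = slope x a"
  define \<alpha> where "\<alpha> = fst x - \<beta> * snd x"
  define h where "h = mesh g X k"
  define r where "r = nat \<lfloor>\<beta> / h\<rfloor>"
  have X: "0 \<le> X"
    using par(3) by simp
  have h: "0 < h"
    using par X by (simp add: h_def mesh_def)
  have less: "snd x < snd a" and \<beta>: "1 / m \<le> \<beta>" "\<beta> \<le> m"
    using a(2) by (auto simp: cone_def \<beta>_def)
  have "0 < 1 / m"
    using par by simp
  then have \<beta>0: "0 < \<beta>"
    using \<beta> by linarith
  have line_a: "fst a = \<alpha> + \<beta> * snd a"
    using slope_mult[of a x] less by (simp add: \<alpha>_def \<beta>_def algebra_simps)
  have q_grid: "q \<in> grid k"
    using q(1) chosen_squares_subset_grid by blast
  have "real_of_int \<lfloor>\<beta> / h\<rfloor> = real r"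
    using \<beta>0 h by (simp add: r_def)
  then have rh: "real r * h \<le> \<beta>" "\<beta> \<le> (real r + 1) * h"
    using floor_divide_lower[OF h, of \<beta>] floor_divide_upper[OF h, of \<beta>] by auto
  then have close: "\<bar>\<beta> - real r * h\<bar> \<le> mesh g X k"
    by (simp add: h_def[symmetric] algebra_simps)
  have "r \<le> tube_count m g X k"
    unfolding r_def tube_count_def h_def[symmetric] using \<beta> h by (intro nat_mono floor_mono divide_right_mono) auto
  moreover have "candidate g X k r x q"
    using good_square_perturb[OF q(3)[folded \<beta>_def] close q_grid par(3,2)] q(4,5)
    by (simp add: candidate_def h_def)
  moreover have "\<not> blocks m g \<epsilon> (subtree k q' \<omega>)"
    if q': "q' \<in> grid k" "precedes q' q" "candidate g X k r x q'" "q' \<in> chosen_squares \<omega> k" for q'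
  proof
    assume blocks: "blocks m g \<epsilon> (subtree k q' \<omega>)"
    have "\<bar>real r * h - \<beta>\<bar> \<le> mesh g X k"
      using close by (simp add: abs_minus_commute)
    then have "good_square (2 * g - g) k q' x \<beta>"
      using q' par unfolding candidate_def h_def by (intro good_square_perturb[of "2 * g"]) auto
    then have "good_square g k q' x \<beta>"
      by simp
    from blocks_subtree_hit[OF blocks q'(4) this \<beta>] obtain b y z where bE: "b \<in> percolation_set \<omega>"
      and line_b': "fst b - fst x = \<beta> * (snd b - snd x)"
      and b1: "2 ^ k * fst b = real (fst q') + y" and y: "\<epsilon> \<le> y" "y \<le> 1 - \<epsilon>"
      and b2: "2 ^ k * snd b = real (snd q') + z" and z: "\<epsilon> \<le> z" "z \<le> 1 - \<epsilon>" .
    have line_b: "fst b = \<alpha> + \<beta> * snd b"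
      using line_b' by (simp add: \<alpha>_def algebra_simps)
    \<comment> \<open>Otherwise neither coordinate of \<open>a\<close> exceeds that of
      \<open>b\<close>. By the margin \<epsilon>, \<open>b\<close> stays strictly below the far
      edges of \<open>q'\<close>, so the indices of \<open>q\<close> would not exceed those of
      \<open>q'\<close>, contrary to \<open>precedes q' q\<close>.\<close>
    have "snd b < snd a"
    proof (rule ccontr)
      assume "\<not> snd b < snd a"
      then have "snd a \<le> snd b" "fst a \<le> fst b"
        using \<beta>0 by (auto simp: line_a line_b)
      then have "2 ^ k * snd a \<le> 2 ^ k * snd b" "2 ^ k * fst a \<le> 2 ^ k * fst b"
        by simp_all
      then have "real (snd q) < real (snd q') + 1" "real (fst q) < real (fst q') + 1"
        using q(2) y z par(4) unfolding mem_dyadic_square_iff b1 b2 by linarith+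
      then have "snd q \<le> snd q'" "fst q \<le> fst q'"
        by linarith+
      then show False
        using q'(2) by (auto simp: precedes_def)
    qed
    \<comment> \<open>The quadrant condition of \<open>candidate\<close> prevents \<open>b\<close>
      from lying behind \<open>x\<close>.\<close>
    moreover have "snd x \<le> snd b"
    proof -
      have "snd x \<le> real (snd q') / 2 ^ k"
        using q'(3) by (simp add: candidate_def)
      also have "\<dots> \<le> snd b"
        using b2 z(1) par(4) by (simp add: pos_divide_le_eq mult.commute)
      finally show ?thesis .
    qed
    moreover define t where "t = (snd a - snd b) / (snd a - snd x)"
    ultimately have t: "0 \<le> t" "t \<le> 1"
      using less by (auto simp: t_def divide_le_eq_1)
    have t_eq: "t * (snd a - snd x) = snd a - snd b"
      using less by (simp add: t_def)
    have "b = (1 - t) *\<^sub>R a + t *\<^sub>R x"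
    proof (rule prod_eqI)
      show snd_eq: "snd b = snd ((1 - t) *\<^sub>R a + t *\<^sub>R x)"
        using t_eq by (simp add: algebra_simps)
      have "fst x = \<alpha> + \<beta> * snd x"
        by (simp add: \<alpha>_def)
      then show "fst b = fst ((1 - t) *\<^sub>R a + t *\<^sub>R x)"
        unfolding line_b snd_eq by (simp add: line_a algebra_simps)
    qed
    then have "b \<in> closed_segment a x"
      using t by (auto simp: closed_segment_def)
    with bE have "b = a"
      using a(1) by (auto simp: visible_part_def)
    with \<open>snd b < snd a\<close> show False
      by simp
  qed
  ultimately show ?thesis
    using q(1) q_grid unfolding unblocked_set_def unblocked_def by blast
qed

section \<open>Lines that cross squares only near a corner\<close>

definition gap :: "bool \<Rightarrow> nat \<Rightarrow> nat \<times> nat \<Rightarrow> real \<Rightarrow> real \<Rightarrow> real" where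
  "gap b = (if b then gap_above else gap_below)"

text \<open>\<open>True\<close> stands for the upper left corner, which \<open>gap_above\<close>
  measures, \<open>False\<close> for the lower right one; the subsquare lies \<open>j\<close>
  generations below \<open>q\<close>.\<close>

definition corner :: "bool \<Rightarrow> nat \<Rightarrow> nat \<times> nat \<Rightarrow> nat \<times> nat" where
  "corner b j q = graft j q (if b then (0, 2 ^ j - 1) else (2 ^ j - 1, 0))"

lemma gap_nonneg:
  assumes "fst a = \<alpha> + \<beta> * snd a" "a \<in> dyadic_square k q" "0 < \<beta>"
  shows "0 \<le> gap b k q \<alpha> \<beta>"
proof -
  have "2 ^ k * fst a = 2 ^ k * \<alpha> + \<beta> * (2 ^ k * snd a)"
    using assms(1) by (simp add: algebra_simps)
  moreover have "\<beta> * real (snd q) \<le> \<beta> * (2 ^ k * snd a)" "\<beta> * (2 ^ k * snd a) \<le> \<beta> * (real (snd q) + 1)"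
    using assms by (auto simp: mem_dyadic_square_iff intro!: mult_left_mono)
  ultimately have "0 \<le> gap_above k q \<alpha> \<beta>" "0 \<le> gap_below k q \<alpha> \<beta>"
    using assms(2) unfolding gap_above_def gap_below_def mem_dyadic_square_iff by linarith+
  then show ?thesis
    by (simp add: gap_def)
qed

text \<open>In its use \<open>6 * g\<close> is at most 1 and at most \<beta>, so the two gaps cannot
  both be small: a line close to one critical corner is not close to the other.\<close>

lemma gap_sum: "gap b k q \<alpha> \<beta> + gap (\<not> b) k q \<alpha> \<beta> = 1 + \<beta>"
  by (cases b) (simp_all add: gap_def gap_above_def gap_below_def algebra_simps)

lemma child_eq: "q = (2 * fst (ancestor 1 q) + fst q mod 2, 2 * snd (ancestor 1 q) + snd q mod 2)"
  by (cases q) (simp add: ancestor_def)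

text \<open>Measured in its own side, the child at the corner has twice the gap. For any other child
  at least min 1 \<beta> \<ge> 6 * g is subtracted, which makes the gap negative, so the line would
  miss that child.\<close>

lemma child_of_small_gap:
  assumes "gap b k (ancestor 1 q) \<alpha> \<beta> < 3 * g" "6 * g \<le> 1" "6 * g \<le> \<beta>"
    and nonneg: "0 \<le> gap b (Suc k) q \<alpha> \<beta>"
  shows "q = (2 * fst (ancestor 1 q) + of_bool (\<not> b), 2 * snd (ancestor 1 q) + of_bool b)"
    and "gap b (Suc k) q \<alpha> \<beta> = 2 * gap b k (ancestor 1 q) \<alpha> \<beta>"
proof -
  obtain i j s t where q: "q = (2 * i + s, 2 * j + t)" "ancestor 1 q = (i, j)" "s \<le> 1" "t \<le> 1"
    using child_eq[of q] by (metis prod.collapse not_mod_2_eq_0_eq_1 le_numeral_extra(4) zero_le)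
  have eq: "gap b (Suc k) q \<alpha> \<beta> = 2 * gap b k (ancestor 1 q) \<alpha> \<beta> -
      (if b then \<beta> * (1 - real t) + real s else (1 - real s) + \<beta> * real t)"
    unfolding q(2) by (simp add: gap_def gap_above_def gap_below_def q(1) algebra_simps)
  have "(s = 0 \<or> s = 1) \<and> (t = 0 \<or> t = 1)"
    using q(3,4) by auto
  then have "s = of_bool (\<not> b) \<and> t = of_bool b"
    using assms nonneg eq by (auto split: if_splits)
  then show "q = (2 * fst (ancestor 1 q) + of_bool (\<not> b), 2 * snd (ancestor 1 q) + of_bool b)"
    "gap b (Suc k) q \<alpha> \<beta> = 2 * gap b k (ancestor 1 q) \<alpha> \<beta>"
    using q eq by (simp_all split: if_splits)
qed

lemma corner_Suc: "corner b (Suc j) q = (2 * fst (corner b j q) + of_bool (\<not> b), 2 * snd (corner b j q) + of_bool b)"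
proof -
  have "2 * (2 ^ j - 1) + 1 = (2 ^ Suc j - 1 :: nat)"
    by (cases "(2::nat) ^ j") simp_all
  then show ?thesis
    by (simp add: corner_def graft_def algebra_simps)
qed

text \<open>A line that crosses a square only near its upper left or lower right corner stays, as long
  as this situation persists under subdivision, in the subsquare at that corner.\<close>

lemma bad_squares_corner:
  assumes line: "fst a = \<alpha> + \<beta> * snd a" and \<beta>: "0 < \<beta>" and g: "6 * g \<le> 1" "6 * g \<le> \<beta>" "0 < g"
    and a: "a \<in> dyadic_square (k + j) q"
    and bad: "\<And>i. i < j \<Longrightarrow> \<exists>b. gap b (k + i) (ancestor (j - i) q) \<alpha> \<beta> < 3 * g"
  shows "\<exists>b. q = corner b j (ancestor j q)"
proof (cases "j = 0")
  case True
  then show ?thesis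
    by (simp add: corner_def graft_def)
next
  case False
  have mem: "a \<in> dyadic_square (k + i) (ancestor (j - i) q)" if "i \<le> j" for i
    using a dyadic_square_ancestor[of "k + i" "j - i" q] that by auto
  have anc: "ancestor 1 (ancestor (j - Suc i) q) = ancestor (j - i) q" if "i < j" for i
    using that by (simp add: Suc_diff_Suc)
  obtain b where b: "gap b k (ancestor j q) \<alpha> \<beta> < 3 * g"
    using bad[of 0] False by auto
  \<comment> \<open>The bound is 6 * g because one generation doubles a gap below 3 * g.\<close>
  have "ancestor (j - i) q = corner b i (ancestor j q) \<and> gap b (k + i) (ancestor (j - i) q) \<alpha> \<beta> < 6 * g"
    if "i \<le> j" for i
    using that
  proof (induction i)
    case 0
    then show ?case
      using b g by (simp add: corner_def graft_def)
  next
    case (Suc i)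
    obtain c where c: "gap c (k + i) (ancestor (j - i) q) \<alpha> \<beta> < 3 * g"
      using bad[of i] Suc.prems by auto
    \<comment> \<open>The corner cannot change: gaps below 6 * g and 3 * g do not add up to 1 +
      \<beta>.\<close>
    have "c = b"
      using c Suc gap_sum[of b "k + i" "ancestor (j - i) q" \<alpha> \<beta>] g by (cases "c = b") auto
    with c have small: "gap b (k + i) (ancestor (j - i) q) \<alpha> \<beta> < 3 * g"
      by simp
    have "0 \<le> gap b (Suc (k + i)) (ancestor (j - Suc i) q) \<alpha> \<beta>"
      using gap_nonneg[OF line mem[OF Suc.prems] \<beta>] by simp
    note child = child_of_small_gap[OF _ g(1,2) this, unfolded anc[OF Suc_le_lessD[OF Suc.prems]], OF small]
    have "ancestor (j - i) q = corner b i (ancestor j q)"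
      using Suc by simp
    with child(1) have "ancestor (j - Suc i) q = corner b (Suc i) (ancestor j q)"
      unfolding corner_Suc by simp
    with child(2) small show ?case
      by simp
  qed
  from this[of j] show ?thesis
    by auto
qed

text \<open>The squares of level \<open>n\<close> charged to a deepest good ancestor
  \<open>q\<close>: the path to them passes through one of its four children and then stays at one
  of two corners.\<close>

definition corner_descendants :: "nat \<Rightarrow> nat \<Rightarrow> nat \<times> nat \<Rightarrow> (nat \<times> nat) set" where
  "corner_descendants k n q = (if k = n then {q} else
     (\<lambda>(b, s). corner b (n - Suc k) (graft 1 q s)) ` (UNIV \<times> grid 1))"

lemma card_corner_descendants: "card (corner_descendants k n q) \<le> 8"
proof -
  have "card (f ` (UNIV \<times> grid 1)) \<le> 8" for f :: "bool \<times> nat \<times> nat \<Rightarrow> nat \<times> nat"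
    using card_image_le[of "UNIV \<times> grid 1" f] by (simp add: grid_def card_cartesian_product)
  then show ?thesis
    by (simp add: corner_descendants_def)
qed

lemma finite_corner_descendants [simp]: "finite (corner_descendants k n q)"
  by (simp add: corner_descendants_def)

text \<open>The first set takes care of squares without a good ancestor from level \<open>n0\<close>
  on; its size is bounded independently of \<open>n\<close>.\<close>

definition cover_squares :: "real \<Rightarrow> real \<Rightarrow> real \<Rightarrow> real \<Rightarrow> nat \<Rightarrow> nat \<Rightarrow> real \<times> real \<Rightarrow>
    config \<Rightarrow> (nat \<times> nat) set" where
  "cover_squares m g \<epsilon> X n0 n x \<omega> = (\<lambda>(b, r). corner b (n - n0) r) ` (UNIV \<times> grid n0) \<union>
      (\<Union>k\<le>n. \<Union>r\<le>tube_count m g X k. \<Union>q\<in>unblocked_set m g \<epsilon> X k r x \<omega>. corner_descendants k n q)"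

text \<open>In the cone both coordinate offsets are comparable to the distance from
  \<open>x\<close>. Hence small squares around such points lie in the upper right quadrant of
  \<open>x\<close>, as \<open>candidate\<close> demands.\<close>

lemma cone_offset:
  assumes "a \<in> cone m x" "1 \<le> m" "d \<le> dist x a" "0 \<le> d"
  shows "d / (m * (m + 1)) \<le> fst a - fst x" "d / (m * (m + 1)) \<le> snd a - snd x"
proof -
  define \<beta> where "\<beta> = slope x a"
  define s where "s = snd a - snd x"
  have s: "0 < s" and \<beta>: "1 / m \<le> \<beta>" "\<beta> \<le> m"
    using assms(1) by (auto simp: cone_def \<beta>_def s_def)
  have fst: "fst a - fst x = \<beta> * s"
    using s by (simp add: \<beta>_def s_def slope_def)
  have \<beta>0: "0 < \<beta>"
    using \<beta> assms(2) by (smt (verit) divide_pos_pos)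
  have "dist x a \<le> (\<beta> + 1) * s"
    using dist_le_slope[of a x] s \<beta>0 by (simp add: \<beta>_def s_def)
  also have "\<dots> \<le> (m + 1) * s"
    using \<beta> s by (intro mult_right_mono) auto
  finally have d: "d / (m + 1) \<le> s"
    using assms by (simp add: field_simps)
  have "d / (m * (m + 1)) \<le> d / (m + 1)"
    using assms by (intro divide_left_mono) auto
  with d show "d / (m * (m + 1)) \<le> snd a - snd x"
    by (simp add: s_def)
  have "1 / m * (d / (m + 1)) \<le> \<beta> * s"
    using d \<beta> \<beta>0 assms by (intro mult_mono) auto
  then show "d / (m * (m + 1)) \<le> fst a - fst x"
    by (simp add: fst)
qed

text \<open>The square of level \<open>n\<close> around \<open>a\<close> is charged to its deepest
  good ancestor of level at least \<open>n0\<close>, which is unblocked by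
  \<open>visible_imp_unblocked\<close>. All generations in between are bad, so
  \<open>bad_squares_corner\<close> leaves few possibilities.\<close>

lemma visible_in_cover:
  assumes a: "a \<in> visible_part x (percolation_set \<omega>)" "a \<in> cone m x"
    and par: "1 \<le> m" "0 < g" "6 * g \<le> 1 / m" "\<bar>snd x\<bar> \<le> X" "0 < \<epsilon>"
    and n0: "1 / 2 ^ n0 \<le> fst a - fst x" "1 / 2 ^ n0 \<le> snd a - snd x" "n0 \<le> n"
  obtains q where "a \<in> dyadic_square n q"
    "q \<in> cover_squares m g \<epsilon> X n0 n x \<omega>"
proof -
  define \<beta> where "\<beta> = slope x a"
  define \<alpha> where "\<alpha> = fst x - \<beta> * snd x"
  have less: "snd x < snd a" and \<beta>: "1 / m \<le> \<beta>"
    using a(2) by (auto simp: cone_def \<beta>_def)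
  have g: "6 * g \<le> \<beta>" "0 < \<beta>" "6 * g \<le> 1"
  proof -
    have "1 / m \<le> 1"
      using par by simp
    with \<beta> par show "6 * g \<le> \<beta>" "0 < \<beta>" "6 * g \<le> 1"
      by linarith+
  qed
  have line: "fst a = \<alpha> + \<beta> * snd a"
    using slope_mult[of a x] less by (simp add: \<alpha>_def \<beta>_def algebra_simps)
  have "a \<in> level_set \<omega> n"
    using a(1) by (auto simp: visible_part_def percolation_set_eq)
  then obtain q where q: "q \<in> chosen_squares \<omega> n" "a \<in> dyadic_square n q"
    by (auto simp: level_set_def)
  define good where "good = (\<lambda>k. good_square (3 * g) k (ancestor (n - k) q) x \<beta>)"
  have not_good: "\<exists>b. gap b k (ancestor (n - k) q) \<alpha> \<beta> < 3 * g" if "\<not> good k" for k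
    using that by (auto simp: good_def good_square_def \<alpha>_def gap_def ex_bool_eq)
  show ?thesis
  proof (cases "\<exists>k\<in>{n0..n}. good k")
    case True
    define k where "k = Max {k \<in> {n0..n}. good k}"
    have "k \<in> {k \<in> {n0..n}. good k}"
      unfolding k_def using True by (intro Max_in) auto
    then have k: "n0 \<le> k" "k \<le> n" "good k"
      by auto
    have bad: "\<not> good i" if "k < i" "i \<le> n" for i
    proof
      assume "good i"
      then have "i \<le> k"
        unfolding k_def using that k by (intro Max_ge) auto
      with that show False by simp
    qed
    define R where "R = ancestor (n - k) q"
    have R: "R \<in> chosen_squares \<omega> k"
      unfolding R_def using q(1) k(2) ancestor_chosen[of q \<omega> k "n - k"] by simp
    have aR: "a \<in> dyadic_square k R"
      unfolding R_def using q(2) k(2) dyadic_square_ancestor[of k "n - k" q] by auto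
    have "1 / 2 ^ k \<le> 1 / (2::real) ^ n0"
      using k(1) by (intro divide_left_mono power_increasing) auto
    then have off: "fst x \<le> fst a - 1 / 2 ^ k" "snd x \<le> snd a - 1 / 2 ^ k"
      using n0 by linarith+
    have "fst a - 1 / 2 ^ k \<le> real (fst R) / 2 ^ k" "snd a - 1 / 2 ^ k \<le> real (snd R) / 2 ^ k"
    proof -
      have "t - 1 / 2 ^ k \<le> u / 2 ^ k" if "2 ^ k * t \<le> u + 1" for t u :: real
      proof -
        have "t \<le> (u + 1) / 2 ^ k"
          using that by (simp add: pos_le_divide_eq mult.commute)
        then show ?thesis
          by (simp add: add_divide_distrib)
      qed
      then show "fst a - 1 / 2 ^ k \<le> real (fst R) / 2 ^ k" "snd a - 1 / 2 ^ k \<le> real (snd R) / 2 ^ k"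
        using aR by (auto simp: mem_dyadic_square_iff)
    qed
    with off have quadrant: "fst x \<le> real (fst R) / 2 ^ k" "snd x \<le> real (snd R) / 2 ^ k"
      by linarith+
    obtain r where r: "r \<le> tube_count m g X k" "R \<in> unblocked_set m g \<epsilon> X k r x \<omega>"
      using visible_imp_unblocked[OF a R aR _ quadrant par(1,2,4,5)] k(3)
      by (auto simp: good_def R_def \<beta>_def)
    have "q \<in> corner_descendants k n R"
    proof (cases "k = n")
      case True
      then show ?thesis
        by (simp add: corner_descendants_def R_def)
    next
      case False
      define j where "j = n - Suc k"
      define P where "P = ancestor j q"
      have j: "Suc k + j = n"
        using False k(2) by (simp add: j_def)
      have "\<exists>b. q = corner b j P"
        unfolding P_def
      proof (rule bad_squares_corner[OF line g(2,3,1) par(2)])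
        show "a \<in> dyadic_square (Suc k + j) q"
          using q(2) j by simp
        fix i assume "i < j"
        then have "\<not> good (Suc k + i)"
          using j by (intro bad) auto
        moreover have "n - (Suc k + i) = j - i"
          using j by simp
        ultimately show "\<exists>b. gap b (Suc k + i) (ancestor (j - i) q) \<alpha> \<beta> < 3 * g"
          using not_good[of "Suc k + i"] by simp
      qed
      moreover have "P = graft 1 R (fst P mod 2, snd P mod 2)"
      proof -
        have "1 + j = n - k"
          using j by simp
        then have "R = ancestor 1 P"
          unfolding R_def P_def by simp
        then show ?thesis
          using child_eq[of P] by (simp add: graft_def)
      qed
      moreover have "(fst P mod 2, snd P mod 2) \<in> grid 1"
        by (simp add: mem_grid_iff)
      ultimately show ?thesis
        using False unfolding corner_descendants_def j_def[symmetric] by force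
    qed
    then show ?thesis
      using that[OF q(2)] r k(2) unfolding cover_squares_def by blast
  next
    case False
    have "\<exists>b. q = corner b (n - n0) (ancestor (n - n0) q)"
    proof (rule bad_squares_corner[OF line g(2,3,1) par(2)])
      show "a \<in> dyadic_square (n0 + (n - n0)) q"
        using q(2) n0(3) by simp
      fix i assume "i < n - n0"
      then have "\<not> good (n0 + i)" "n - (n0 + i) = n - n0 - i"
        using False by auto
      then show "\<exists>b. gap b (n0 + i) (ancestor (n - n0 - i) q) \<alpha> \<beta> < 3 * g"
        using not_good[of "n0 + i"] by simp
    qed
    moreover have "ancestor (n - n0) q \<in> grid n0"
      using q(1) chosen_squares_subset_grid[of \<omega> n] ancestor_in_grid[of q n0 "n - n0"] n0(3) by auto
    ultimately show ?thesis
      using that[OF q(2)] unfolding cover_squares_def by force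
  qed
qed

lemma hausdorff1_visible_cone_finite:
  assumes x: "x \<notin> percolation_set \<omega>" and par: "1 \<le> m" "0 < g" "6 * g \<le> 1 / m" "\<bar>snd x\<bar> \<le> X" "0 < \<epsilon>"
    and fin: "mean_count m g \<epsilon> X x \<omega> < \<infinity>"
  shows "hausdorff1 (visible_part x (percolation_set \<omega>) \<inter> cone m x) < \<infinity>"
proof -
  define S where "S = (\<lambda>n. \<Sum>k\<le>n. visible_count m g \<epsilon> X k x \<omega>)"
  have S0: "0 \<le> S n" for n
    by (simp add: S_def visible_count_def sum_nonneg)
  obtain K where K: "0 \<le> K" "mean_count m g \<epsilon> X x \<omega> = ennreal K"
    using fin by (auto simp: less_top_ennreal)
  have "mean_count m g \<epsilon> X x \<omega> < ennreal (K + 1)"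
    using K by (simp add: ennreal_less_iff)
  moreover have "mean_count m g \<epsilon> X x \<omega> = liminf (\<lambda>n. ennreal (S n / 2 ^ n))"
    by (simp add: mean_count_def S_def)
  \<comment> \<open>A finite lower limit controls infinitely many levels, and each cover below uses
    only one of them.\<close>
  ultimately have freq: "\<exists>\<^sub>\<infinity>n. ennreal (S n / 2 ^ n) < ennreal (K + 1)"
    unfolding cofinite_eq_sequentially frequently_def
    using Liminf_bounded[of "ennreal (K + 1)" "\<lambda>n. ennreal (S n / 2 ^ n)" sequentially]
    by (auto simp: not_less)
  obtain d where d: "0 < d" "\<And>a. a \<in> percolation_set \<omega> \<Longrightarrow> d \<le> dist x a"
    using separate_point_closed[OF compact_imp_closed[OF compact_percolation_set] x] by blast
  define \<rho> where "\<rho> = d / (m * (m + 1))"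
  have "0 < \<rho>"
    using d par by (simp add: \<rho>_def)
  then obtain n0 where "(1 / 2) ^ n0 < \<rho>"
    using real_arch_pow_inv[of \<rho> "1 / 2"] by auto
  then have n0: "1 / 2 ^ n0 \<le> \<rho>"
    by (simp add: power_one_over)
  define D where "D = (\<lambda>n. cover_squares m g \<epsilon> X n0 n x \<omega>)"
  have fin_unblocked: "finite (unblocked_set m g \<epsilon> X k r x \<omega>)" for k r
    by (simp add: unblocked_set_def)
  have fin_D: "finite (D n)" for n
    using fin_unblocked by (simp add: D_def cover_squares_def)
  have card_D: "real (card (D n)) \<le> 2 * 4 ^ n0 + 8 * S n" for n
  proof -
    have grid: "card (f ` (UNIV \<times> grid n0)) \<le> 2 * 4 ^ n0" for f :: "bool \<times> nat \<times> nat \<Rightarrow> nat \<times> nat"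
      using card_image_le[of "UNIV \<times> grid n0" f]
      by (simp add: grid_def card_cartesian_product flip: power_mult_distrib)
    have "card (\<Union>k\<le>n. \<Union>r\<le>tube_count m g X k. \<Union>q\<in>unblocked_set m g \<epsilon> X k r x \<omega>. corner_descendants k n q)
        \<le> (\<Sum>k\<le>n. \<Sum>r\<le>tube_count m g X k. \<Sum>q\<in>unblocked_set m g \<epsilon> X k r x \<omega>. card (corner_descendants k n q))"
      using fin_unblocked by (intro order_trans[OF card_UN_le] sum_mono) auto
    also have "\<dots> \<le> (\<Sum>k\<le>n. \<Sum>r\<le>tube_count m g X k. \<Sum>q\<in>unblocked_set m g \<epsilon> X k r x \<omega>. 8)"
      by (intro sum_mono card_corner_descendants)
    finally have "card (D n) \<le> 2 * 4 ^ n0 + (\<Sum>k\<le>n. \<Sum>r\<le>tube_count m g X k. card (unblocked_set m g \<epsilon> X k r x \<omega>) * 8)"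
      unfolding D_def cover_squares_def using grid by (intro order_trans[OF card_Un_le] add_mono) auto
    then have "real (card (D n)) \<le> real (2 * 4 ^ n0 + (\<Sum>k\<le>n. \<Sum>r\<le>tube_count m g X k. card (unblocked_set m g \<epsilon> X k r x \<omega>) * 8))"
      by (simp only: of_nat_le_iff)
    also have "\<dots> = 2 * 4 ^ n0 + 8 * S n"
      by (simp add: S_def visible_count_def sum_distrib_left mult.commute)
    finally show ?thesis .
  qed
  \<comment> \<open>For n > 2 * n0 the at most 2 * 4^n0 initial squares, of diameter at most 2 /
    2^n, contribute at most 4. The others, at most 8 for each unblocked square, contribute at most
    16 * (K + 1).\<close>
  have "hausdorff1 (visible_part x (percolation_set \<omega>) \<inter> cone m x) \<le> ennreal (4 + 16 * (K + 1))"
  proof (rule hausdorff1_le_finite_covers)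
    fix \<delta> :: real assume "0 < \<delta>"
    then obtain n1 where n1: "(1 / 2) ^ n1 < \<delta> / 2"
      using real_arch_pow_inv[of "\<delta> / 2" "1 / 2"] by auto
    obtain n where n: "n > n1 + 2 * n0" "ennreal (S n / 2 ^ n) < ennreal (K + 1)"
      using freq unfolding INFM_nat by blast
    then have Sn: "S n / 2 ^ n \<le> K + 1"
      using S0 by (simp add: ennreal_less_iff del: ennreal_plus)
    define W where "W = visible_part x (percolation_set \<omega>) \<inter> cone m x"
    define F where "F = dyadic_square n ` D n"
    have "W \<subseteq> \<Union>F"
    proof
      fix a assume "a \<in> W"
      then have a: "a \<in> visible_part x (percolation_set \<omega>)" "a \<in> cone m x"
        by (auto simp: W_def)
      then have "d \<le> dist x a"
        using d(2) by (simp add: visible_part_def)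
      from cone_offset[OF a(2) par(1) this] n0 d(1)
      have "1 / 2 ^ n0 \<le> fst a - fst x" "1 / 2 ^ n0 \<le> snd a - snd x"
        unfolding \<rho>_def by linarith+
      from visible_in_cover[OF a par this, of n] n(1) show "a \<in> \<Union>F"
        unfolding F_def D_def by (smt (verit) UnionI image_eqI le_add2 less_imp_le mult_2 order_trans add_leD2)
    qed
    moreover have "2 / 2 ^ n \<le> \<delta>"
    proof -
      have "(1 / 2) ^ n \<le> (1 / 2 :: real) ^ n1"
        using n(1) by (intro power_decreasing) auto
      with n1 show ?thesis
        by (simp add: power_one_over)
    qed
    moreover have "real (card F) * (2 / 2 ^ n) \<le> 4 + 16 * (K + 1)"
    proof -
      have "card F \<le> card (D n)"
        unfolding F_def using fin_D by (rule card_image_le)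
      then have "real (card F) \<le> 2 * 4 ^ n0 + 8 * S n"
        using card_D[of n] by linarith
      then have "real (card F) * (2 / 2 ^ n) \<le> (2 * 4 ^ n0 + 8 * S n) * (2 / 2 ^ n)"
        by (intro mult_right_mono) auto
      also have "\<dots> = 4 * (4 ^ n0 / 2 ^ n) + 16 * (S n / 2 ^ n)"
        by (simp add: field_simps)
      finally have "real (card F) * (2 / 2 ^ n) \<le> 4 * (4 ^ n0 / 2 ^ n) + 16 * (S n / 2 ^ n)" .
      moreover have "4 * (4 ^ n0 / 2 ^ n) \<le> (4::real)"
      proof -
        have "(4::real) ^ n0 = 2 ^ (2 * n0)"
          by (simp add: power_mult)
        also have "\<dots> \<le> 2 ^ n"
          using n(1) by (intro power_increasing) auto
        finally show ?thesis
          by (simp add: pos_divide_le_eq)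
      qed
      moreover have "16 * (S n / 2 ^ n) \<le> 16 * (K + 1)"
        using Sn by simp
      ultimately show ?thesis
        by (meson add_mono order_trans)
    qed
    moreover have "\<forall>U\<in>F. bounded U \<and> diameter U \<le> 2 / 2 ^ n"
      using diameter_dyadic_square by (auto simp: F_def compact_imp_bounded)
    ultimately show "\<exists>F d. finite F \<and> visible_part x (percolation_set \<omega>) \<inter> cone m x \<subseteq> \<Union>F \<and>
        (\<forall>U\<in>F. bounded U \<and> diameter U \<le> d) \<and> 0 \<le> d \<and> d \<le> \<delta> \<and> real (card F) * d \<le> 4 + 16 * (K + 1)"
      using fin_D[of n] unfolding W_def F_def by (intro exI[of _ "dyadic_square n ` D n"] exI[of _ "2 / 2 ^ n"]) auto
  qed
  then show ?thesis
    by (rule le_less_trans) simp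
qed

section \<open>Lower bound for the visible part\<close>

lemma nearest_point_visible:
  assumes "compact E" "b \<in> E" "x \<notin> E"
  obtains a where "a \<in> visible_part x E" "a \<in> closed_segment b x"
proof -
  have "compact (closed_segment b x \<inter> E)" "closed_segment b x \<inter> E \<noteq> {}"
    using assms by (auto intro: compact_Int_closed compact_imp_closed)
  moreover have "continuous_on (closed_segment b x \<inter> E) (dist x)"
    by (intro continuous_intros)
  ultimately obtain a where a: "a \<in> closed_segment b x \<inter> E"
    and min: "\<And>c. c \<in> closed_segment b x \<inter> E \<Longrightarrow> dist x a \<le> dist x c"
    using continuous_attains_inf[of "closed_segment b x \<inter> E" "dist x"] by blast
  have "c = a" if c: "c \<in> closed_segment a x" "c \<in> E" for c
  proof -
    obtain t where t: "0 \<le> t" "t \<le> 1" "c = (1 - t) *\<^sub>R a + t *\<^sub>R x"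
      using c(1) by (auto simp: closed_segment_def)
    have "c \<in> closed_segment b x"
      using a c(1) subset_closed_segment[of a x b x] by auto
    then have "dist x a \<le> dist x c"
      using min c by blast
    also have "x - c = (1 - t) *\<^sub>R (x - a)"
      unfolding t(3) by (simp add: algebra_simps)
    then have "dist x c = (1 - t) * dist x a"
      using t by (simp add: dist_norm)
    finally have "t * dist x a \<le> 0"
      by (simp add: algebra_simps)
    moreover have "0 < dist x a"
      using a assms by auto
    ultimately have "t = 0"
      using t by (simp add: mult_le_0_iff)
    then show ?thesis
      using t by simp
  qed
  then have "a \<in> visible_part x E"
    using a by (auto simp: visible_part_def)
  then show ?thesis
    using a that by blast
qed

lemma slope_lipschitz:
  assumes "\<bar>slope x b\<bar> \<le> m" "0 < s" "s \<le> \<bar>snd a - snd x\<bar>" "s \<le> \<bar>snd b - snd x\<bar>"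
  shows "\<bar>slope x a - slope x b\<bar> \<le> (1 + m) / s * dist a b"
proof -
  have ne: "snd a - snd x \<noteq> 0" "snd b - snd x \<noteq> 0"
    using assms by auto
  have "slope x b * (snd b - snd x) = fst b - fst x"
    using ne by (intro slope_mult) simp
  then have "(fst a - fst x) - slope x b * (snd a - snd x) = (fst a - fst b) - slope x b * (snd a - snd b)"
    by (simp add: algebra_simps)
  moreover have "(slope x a - slope x b) * (snd a - snd x) = (fst a - fst x) - slope x b * (snd a - snd x)"
    using slope_mult[of a x] ne by (simp add: left_diff_distrib)
  ultimately have "\<bar>slope x a - slope x b\<bar> * \<bar>snd a - snd x\<bar> = \<bar>(fst a - fst b) - slope x b * (snd a - snd b)\<bar>"
    by (metis abs_mult)
  also have "\<dots> \<le> \<bar>fst a - fst b\<bar> + \<bar>slope x b\<bar> * \<bar>snd a - snd b\<bar>"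
    by (metis abs_mult abs_triangle_ineq4)
  also have "\<dots> \<le> dist a b + m * dist a b"
  proof (intro add_mono mult_mono)
    show "\<bar>fst a - fst b\<bar> \<le> dist a b" "\<bar>snd a - snd b\<bar> \<le> dist a b"
      using dist_fst_le[of a b] dist_snd_le[of a b] by (simp_all add: dist_real_def)
  qed (use assms in auto)
  finally have "\<bar>slope x a - slope x b\<bar> * \<bar>snd a - snd x\<bar> \<le> (1 + m) * dist a b"
    by (simp add: algebra_simps)
  moreover have "\<bar>slope x a - slope x b\<bar> * s \<le> \<bar>slope x a - slope x b\<bar> * \<bar>snd a - snd x\<bar>"
    using assms by (intro mult_left_mono) auto
  ultimately show ?thesis
    using assms(2) by (simp add: field_simps)
qed

definition centre :: "nat \<Rightarrow> nat \<times> nat \<Rightarrow> real \<times> real" where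
  "centre k q = ((real (fst q) + 1 / 2) / 2 ^ k, (real (snd q) + 1 / 2) / 2 ^ k)"

text \<open>The line from \<open>x\<close> through the centre of the blocking square has margin at
  least 1/2, so all slopes near its own keep margin \<open>g\<close> and hit the set. On each such
  segment the point of the set nearest to \<open>x\<close> is visible and has the same slope. The
  slope is Lipschitz on these points because they stay away from \<open>x\<close>.\<close>

lemma hausdorff1_visible_pos:
  assumes x: "x \<notin> percolation_set \<omega>" and q: "q \<in> chosen_squares \<omega> k"
    and blocks: "blocks m g \<epsilon> (subtree k q \<omega>)"
    and par: "1 \<le> m" "0 < g" "6 * g \<le> 1 / m" "0 < \<epsilon>"
    and centre: "snd (centre k q) \<noteq> snd x" "1 / m < slope x (centre k q)" "slope x (centre k q) < m"
  shows "0 < hausdorff1 (visible_part x (percolation_set \<omega>))"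
proof -
  define \<beta>0 where "\<beta>0 = slope x (centre k q)"
  \<comment> \<open>No orientation is imposed, unlike in \<open>cone\<close>: with a positive slope
    \<open>x\<close> may lie below left or above right of the points.\<close>
  define A where "A = {a \<in> visible_part x (percolation_set \<omega>). snd a \<noteq> snd x \<and> 1 / m \<le> slope x a \<and> slope x a \<le> m}"
  define \<eta> where "\<eta> = min (mesh g \<bar>snd x\<bar> k) (min (\<beta>0 - 1 / m) (m - \<beta>0))"
  have \<eta>: "0 < \<eta>"
    using par centre by (simp add: \<eta>_def \<beta>0_def mesh_def add_pos_nonneg)
  have m: "0 < 1 / m" "1 / m \<le> 1"
    using par by auto
  have q_grid: "q \<in> grid k"
    using q chosen_squares_subset_grid by blast
  have good0: "good_square (1 / 2) k q x \<beta>0"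
  proof -
    have "\<beta>0 * (snd (centre k q) - snd x) = fst (centre k q) - fst x"
      using centre(1) by (simp add: \<beta>0_def slope_def)
    then have "2 ^ k * (\<beta>0 * (snd (centre k q) - snd x)) = 2 ^ k * (fst (centre k q) - fst x)"
      by simp
    then have "\<beta>0 * (2 ^ k * snd (centre k q)) - \<beta>0 * (2 ^ k * snd x) = 2 ^ k * fst (centre k q) - 2 ^ k * fst x"
      by (simp add: algebra_simps)
    moreover have "2 ^ k * fst (centre k q) = real (fst q) + 1 / 2" "2 ^ k * snd (centre k q) = real (snd q) + 1 / 2"
      by (simp_all add: centre_def)
    ultimately have "2 ^ k * (fst x - \<beta>0 * snd x) = real (fst q) + 1 / 2 - \<beta>0 * (real (snd q) + 1 / 2)"
      by (simp add: algebra_simps)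
    moreover have "0 < \<beta>0"
      using centre(2) m unfolding \<beta>0_def by linarith
    ultimately show ?thesis
      by (simp add: good_square_def gap_above_def gap_below_def algebra_simps)
  qed
  have "{\<beta>0 - \<eta>..\<beta>0 + \<eta>} \<subseteq> slope x ` A"
  proof
    fix \<beta> assume \<beta>: "\<beta> \<in> {\<beta>0 - \<eta>..\<beta>0 + \<eta>}"
    then have "\<bar>\<beta>0 - \<beta>\<bar> \<le> mesh g \<bar>snd x\<bar> k" "1 / m \<le> \<beta>" "\<beta> \<le> m"
      by (auto simp: \<eta>_def abs_le_iff)
    have "good_square (1 / 2 - g) k q x \<beta>"
      using good0 \<open>\<bar>\<beta>0 - \<beta>\<bar> \<le> _\<close> q_grid par by (intro good_square_perturb) auto
    moreover have "g \<le> 1 / 2 - g"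
      using par m by linarith
    ultimately have "good_square g k q x \<beta>"
      by (auto simp: good_square_def)
    from blocks_subtree_hit[OF blocks q this \<open>1 / m \<le> \<beta>\<close> \<open>\<beta> \<le> m\<close>] obtain b
      where bE: "b \<in> percolation_set \<omega>" and line_b: "fst b - fst x = \<beta> * (snd b - snd x)"
      by metis
    obtain a where a: "a \<in> visible_part x (percolation_set \<omega>)" "a \<in> closed_segment b x"
      using nearest_point_visible[OF compact_percolation_set bE x] .
    obtain t where t: "a = (1 - t) *\<^sub>R b + t *\<^sub>R x"
      using a(2) by (auto simp: closed_segment_def)
    have "snd a - snd x = (1 - t) * (snd b - snd x)"
      unfolding t by (simp add: algebra_simps)
    moreover have "fst a - fst x = (1 - t) * (fst b - fst x)"
      unfolding t by (simp add: algebra_simps)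
    ultimately have line_a: "fst a - fst x = \<beta> * (snd a - snd x)"
      using line_b by simp
    have "a \<noteq> x"
      using a(1) x by (auto simp: visible_part_def)
    have "snd a \<noteq> snd x"
    proof
      assume "snd a = snd x"
      with line_a have "fst a = fst x"
        by simp
      with \<open>snd a = snd x\<close> \<open>a \<noteq> x\<close> show False
        by (simp add: prod_eq_iff)
    qed
    with line_a have "slope x a = \<beta>"
      by (simp add: slope_def)
    then show "\<beta> \<in> slope x ` A"
      using a(1) \<open>snd a \<noteq> snd x\<close> \<open>1 / m \<le> \<beta>\<close> \<open>\<beta> \<le> m\<close> by (auto simp: A_def)
  qed
  moreover obtain d where d: "0 < d" "\<And>a. a \<in> percolation_set \<omega> \<Longrightarrow> d \<le> dist x a"
    using separate_point_closed[OF compact_imp_closed[OF compact_percolation_set] x] by blast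
  define s where "s = d / (m + 1)"
  have "0 < s"
    using d par by (simp add: s_def)
  have A_far: "s \<le> \<bar>snd a - snd x\<bar>" if "a \<in> A" for a
  proof -
    have a': "snd a \<noteq> snd x" "1 / m \<le> slope x a" "slope x a \<le> m" "d \<le> dist x a"
      using that d(2) by (auto simp: A_def visible_part_def)
    moreover have "0 < slope x a"
      using a'(2) m(1) by linarith
    ultimately have a: "snd a \<noteq> snd x" "0 < slope x a" "slope x a \<le> m" "d \<le> dist x a"
      by blast+
    have "dist x a \<le> (slope x a + 1) * \<bar>snd a - snd x\<bar>"
      using dist_le_slope[OF a(1)] a(2) by simp
    also have "\<dots> \<le> (m + 1) * \<bar>snd a - snd x\<bar>"
      using a by (intro mult_right_mono) auto
    finally show ?thesis
      using a(4) par by (simp add: s_def field_simps)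
  qed
  have "\<bar>slope x a - slope x b\<bar> \<le> (1 + m) / s * dist a b" if "a \<in> A" "b \<in> A" for a b
  proof (rule slope_lipschitz)
    have "1 / m \<le> slope x b" "slope x b \<le> m"
      using that by (auto simp: A_def)
    with m(1) show "\<bar>slope x b\<bar> \<le> m"
      by linarith
  qed (use that A_far \<open>0 < s\<close> in auto)
  ultimately have "0 < hausdorff1 A"
    using \<eta> \<open>0 < s\<close> par by (intro hausdorff1_pos_if_interval_image[of A "slope x" "(1 + m) / s" "\<beta>0 - \<eta>" "\<beta>0 + \<eta>"]) auto
  also have "\<dots> \<le> hausdorff1 (visible_part x (percolation_set \<omega>))"
    by (rule hausdorff1_mono) (auto simp: A_def)
  finally show ?thesis .
qed

section \<open>Rotation by a right angle\<close>

definition rotate_square :: "nat \<Rightarrow> nat \<times> nat \<Rightarrow> nat \<times> nat" where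
  "rotate_square n q = (2 ^ n - 1 - snd q, fst q)"

text \<open>\<open>turn\<close> is the counterclockwise quarter turn about the centre of the unit
  square. Since the coins are read at turned labels, the percolation set moves by the inverse
  \<open>unturn\<close>.\<close>

definition rotate_config :: "config \<Rightarrow> config" where
  "rotate_config \<omega> = (\<lambda>l\<in>square_labels. \<omega> (fst l, rotate_square (fst l) (snd l)))"

definition turn :: "real \<times> real \<Rightarrow> real \<times> real" where
  "turn z = (1 - snd z, fst z)"

definition unturn :: "real \<times> real \<Rightarrow> real \<times> real" where
  "unturn z = (snd z, 1 - fst z)"

lemma turn_unturn [simp]: "turn (unturn z) = z" and unturn_turn [simp]: "unturn (turn z) = z"
  by (simp_all add: turn_def unturn_def)

lemma dist_turn: "dist (turn a) (turn b) = dist a b"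
  by (simp add: turn_def dist_prod_def dist_real_def power2_commute add.commute)

lemma dist_unturn: "dist (unturn a) (unturn b) = dist a b"
  using dist_turn[of "unturn a" "unturn b"] by simp

lemma dist_unturn_funpow: "dist ((unturn ^^ s) a) ((unturn ^^ s) b) = dist a b"
  by (induction s) (simp_all add: dist_unturn)

lemma dist_turn_funpow: "dist ((turn ^^ s) a) ((turn ^^ s) b) = dist a b"
  by (induction s) (simp_all add: dist_turn)

lemma turn_unturn_funpow [simp]: "(turn ^^ s) ((unturn ^^ s) z) = z"
  by (induction s arbitrary: z) (simp_all add: funpow_swap1)

lemma inj_unturn_funpow: "inj (unturn ^^ s)"
  by (metis injI turn_unturn_funpow)

lemma unturn_funpow_cases:
  "(unturn ^^ 1) z = (snd z, 1 - fst z)" "(unturn ^^ 2) z = (1 - fst z, 1 - snd z)"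
  "(unturn ^^ 3) z = (1 - snd z, fst z)"
  by (simp_all add: unturn_def numeral_2_eq_2 numeral_3_eq_3)

lemma rotate_square_in_grid: "q \<in> grid n \<Longrightarrow> rotate_square n q \<in> grid n"
  by (auto simp: mem_grid_iff rotate_square_def)

lemma rotate_square_inj: "inj_on (rotate_square n) (grid n)"
  by (rule inj_onI) (auto simp: rotate_square_def mem_grid_iff prod_eq_iff)

lemma rotate_square_surj:
  assumes "r \<in> grid n"
  obtains q where "q \<in> grid n" "r = rotate_square n q"
proof
  show "(snd r, 2 ^ n - 1 - fst r) \<in> grid n"
    using assms by (auto simp: mem_grid_iff)
  show "r = rotate_square n (snd r, 2 ^ n - 1 - fst r)"
  proof -
    have "fst r \<le> 2 ^ n - 1"
      using assms by (auto simp: mem_grid_iff)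
    from diff_diff_cancel[OF this] show ?thesis
      by (simp add: rotate_square_def prod_eq_iff)
  qed
qed

lemma ancestor_rotate_square:
  assumes "q \<in> grid (Suc n)"
  shows "ancestor 1 (rotate_square (Suc n) q) = rotate_square n (ancestor 1 q)"
proof -
  have "(2 * N - 1 - b) div 2 = N - 1 - b div 2" if "b < 2 * N" for N b :: nat
    using that by linarith
  moreover have "snd q < 2 * 2 ^ n"
    using assms by (simp add: mem_grid_iff)
  ultimately have "(2 * 2 ^ n - 1 - snd q) div 2 = 2 ^ n - 1 - snd q div 2"
    by blast
  then show ?thesis
    by (simp add: ancestor_def rotate_square_def)
qed

lemma chosen_squares_rotate:
  assumes "q \<in> grid n"
  shows "q \<in> chosen_squares (rotate_config \<omega>) n \<longleftrightarrow> rotate_square n q \<in> chosen_squares \<omega> n"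
  using assms
proof (induction n arbitrary: q)
  case 0
  then have "q = (0, 0)"
    by (auto simp: grid_def)
  then show ?case
    by (simp add: rotate_square_def)
next
  case (Suc n)
  have "ancestor 1 q \<in> grid n"
    using Suc.prems ancestor_in_grid[of q n 1] by simp
  moreover have "rotate_config \<omega> (Suc n, q) = \<omega> (Suc n, rotate_square (Suc n) q)"
    using Suc.prems by (simp add: rotate_config_def mem_square_labels_iff)
  ultimately show ?case
    using Suc.IH[of "ancestor 1 q"] ancestor_rotate_square[OF Suc.prems] by (simp add: chosen_squares_Suc_iff)
qed

lemma dyadic_square_rotate:
  assumes "q \<in> grid n"
  shows "z \<in> dyadic_square n q \<longleftrightarrow> turn z \<in> dyadic_square n (rotate_square n q)"
proof -
  have "snd q < 2 ^ n"
    using assms by (simp add: mem_grid_iff)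
  then have eq: "real (2 ^ n - 1 - snd q) = 2 ^ n - 1 - real (snd q)"
    by (simp add: of_nat_diff)
  show ?thesis
    unfolding mem_dyadic_square_iff turn_def rotate_square_def fst_conv snd_conv eq right_diff_distrib mult_1_right
    by (intro iffI; elim conjE; intro conjI; linarith)
qed

lemma level_set_rotate: "z \<in> level_set (rotate_config \<omega>) n \<longleftrightarrow> turn z \<in> level_set \<omega> n"
proof
  assume "z \<in> level_set (rotate_config \<omega>) n"
  then obtain q where q: "q \<in> chosen_squares (rotate_config \<omega>) n" "z \<in> dyadic_square n q"
    by (auto simp: level_set_def)
  then have "q \<in> grid n"
    using chosen_squares_subset_grid by blast
  with q have "rotate_square n q \<in> chosen_squares \<omega> n" "turn z \<in> dyadic_square n (rotate_square n q)"
    using chosen_squares_rotate[of q n \<omega>] dyadic_square_rotate[of q n z] by simp_all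
  then show "turn z \<in> level_set \<omega> n"
    unfolding level_set_def by (rule UN_I)
next
  assume "turn z \<in> level_set \<omega> n"
  then obtain r where r: "r \<in> chosen_squares \<omega> n" "turn z \<in> dyadic_square n r"
    by (auto simp: level_set_def)
  then have "r \<in> grid n"
    using chosen_squares_subset_grid by blast
  then obtain q where q: "q \<in> grid n" "r = rotate_square n q"
    by (rule rotate_square_surj)
  with r have "q \<in> chosen_squares (rotate_config \<omega>) n" "z \<in> dyadic_square n q"
    using chosen_squares_rotate[of q n \<omega>] dyadic_square_rotate[of q n z] by simp_all
  then show "z \<in> level_set (rotate_config \<omega>) n"
    unfolding level_set_def by (rule UN_I)
qed

lemma percolation_set_rotate: "percolation_set (rotate_config \<omega>) = unturn ` percolation_set \<omega>"
proof -
  have "z \<in> percolation_set (rotate_config \<omega>) \<longleftrightarrow> turn z \<in> percolation_set \<omega>" for z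
    by (simp add: percolation_set_eq level_set_rotate)
  moreover have "z \<in> unturn ` E \<longleftrightarrow> turn z \<in> E" for z E
    using image_eqI[of z unturn "turn z" E] by auto
  ultimately show ?thesis
    by blast
qed

lemma visible_part_unturn: "visible_part (unturn x) (unturn ` E) = unturn ` visible_part x E"
proof -
  have inj: "inj unturn"
    using inj_unturn_funpow[of 1] by simp
  have "unturn ((1 - u) *\<^sub>R a + u *\<^sub>R b) = (1 - u) *\<^sub>R unturn a + u *\<^sub>R unturn b" for u a b
    by (rule prod_eqI) (simp_all add: unturn_def algebra_simps)
  then have "closed_segment (unturn a) (unturn x) = unturn ` closed_segment a x" for a
    by (simp add: closed_segment_image_interval image_image)
  then have iff: "closed_segment (unturn a) (unturn x) \<inter> unturn ` E = {unturn a} \<longleftrightarrow> closed_segment a x \<inter> E = {a}" for a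
    using inj_image_eq_iff[OF inj, of "closed_segment a x \<inter> E" "{a}"] by (simp add: image_Int[OF inj])
  have "unturn a \<in> visible_part (unturn x) (unturn ` E) \<longleftrightarrow> a \<in> visible_part x E" for a
    unfolding visible_part_def mem_Collect_eq iff inj_image_mem_iff[OF inj] ..
  moreover have "visible_part (unturn x) (unturn ` E) \<subseteq> range unturn"
    by (auto simp: visible_part_def)
  ultimately show ?thesis
    by blast
qed

lemma percolation_set_rotate_funpow:
  "percolation_set ((rotate_config ^^ s) \<omega>) = (unturn ^^ s) ` percolation_set \<omega>"
  by (induction s) (simp_all add: percolation_set_rotate image_comp)

lemma visible_part_rotate_funpow:
  "visible_part ((unturn ^^ s) x) (percolation_set ((rotate_config ^^ s) \<omega>)) =
    (unturn ^^ s) ` visible_part x (percolation_set \<omega>)"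
  by (induction s) (simp_all add: percolation_set_rotate visible_part_unturn image_comp)

lemma mem_percolation_set_rotate_funpow:
  "(unturn ^^ s) x \<in> percolation_set ((rotate_config ^^ s) \<omega>) \<longleftrightarrow> x \<in> percolation_set \<omega>"
  unfolding percolation_set_rotate_funpow by (simp add: inj_image_mem_iff[OF inj_unturn_funpow])

lemma rotate_label_in_labels: "l \<in> square_labels \<Longrightarrow> (fst l, rotate_square (fst l) (snd l)) \<in> square_labels"
  by (cases l) (simp add: mem_square_labels_iff rotate_square_in_grid)

lemma measurable_rotate_config [measurable]: "rotate_config \<in> percolation p \<rightarrow>\<^sub>M percolation p"
  unfolding percolation_def rotate_config_def[abs_def]
  by (rule measurable_restrict, rule measurable_component_singleton, rule rotate_label_in_labels)

lemma distr_rotate_config: "distr (percolation p) (percolation p) rotate_config = percolation p"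
proof -
  have "inj_on (\<lambda>l. (fst l, rotate_square (fst l) (snd l))) square_labels"
  proof (rule inj_onI)
    fix l l' :: "nat \<times> nat \<times> nat"
    assume "l \<in> square_labels" "l' \<in> square_labels"
      "(fst l, rotate_square (fst l) (snd l)) = (fst l', rotate_square (fst l') (snd l'))"
    then show "l = l'"
      using inj_onD[OF rotate_square_inj[of "fst l"], of "snd l" "snd l'"]
      by (cases l; cases l') (simp add: mem_square_labels_iff)
  qed
  moreover have "(\<lambda>l. (fst l, rotate_square (fst l) (snd l))) \<in> square_labels \<rightarrow> square_labels"
    using rotate_label_in_labels by blast
  ultimately show ?thesis
    using distr_PiM_reindex[of square_labels "\<lambda>_. coin p"
        "\<lambda>l. (fst l, rotate_square (fst l) (snd l))" square_labels]
    by (simp add: percolation_def rotate_config_def[abs_def] measure_pmf.prob_space_axioms)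
qed

lemma AE_rotate_funpow:
  assumes "AE \<omega> in percolation p. P \<omega>"
  shows "AE \<omega> in percolation p. P ((rotate_config ^^ s) \<omega>)"
proof (induction s)
  case 0
  then show ?case using assms by simp
next
  case (Suc s)
  then have "AE \<omega> in distr (percolation p) (percolation p) rotate_config. P ((rotate_config ^^ s) \<omega>)"
    by (simp only: distr_rotate_config)
  from AE_distrD[OF measurable_rotate_config this] show ?case
    by (simp add: funpow_swap1)
qed

lemma measurable_rotate_funpow [measurable]: "(rotate_config ^^ s) \<in> percolation p \<rightarrow>\<^sub>M percolation p"
  by (induction s) (auto intro: measurable_comp[OF _ measurable_rotate_config] simp: id_def)

lemma measurable_unturn_funpow [measurable]: "(unturn ^^ s) \<in> lborel \<rightarrow>\<^sub>M lborel"
proof -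
  have "continuous_on UNIV (unturn ^^ s)"
  proof (induction s)
    case (Suc s)
    have "continuous_on UNIV unturn"
      unfolding unturn_def by (intro continuous_intros)
    with Suc show ?case
      by (auto intro: continuous_on_compose2 simp: comp_def)
  qed (simp add: id_def)
  then show ?thesis
    by (simp add: borel_measurable_continuous_onI)
qed

section \<open>Finiteness of the visible part\<close>

text \<open>1 / (6 * m) is the largest margin compatible with
  \<open>6 * g \<le> 1 / m\<close>.\<close>

abbreviation standard_blocks :: "(nat \<Rightarrow> real) \<Rightarrow> nat \<Rightarrow> config \<Rightarrow> bool" where
  "standard_blocks e m \<equiv> blocks (real m) (1 / (6 * real m)) (e m)"

text \<open>\<open>s\<close> counts quarter turns. All parameters are natural numbers, so a
  countable intersection of almost sure events covers every direction and the condition is jointly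
  measurable.\<close>

definition visible_counts_finite :: "(nat \<Rightarrow> real) \<Rightarrow> real \<times> real \<Rightarrow> config \<Rightarrow> bool" where
  "visible_counts_finite e x \<omega> \<longleftrightarrow> (\<forall>m s X. 1 \<le> m \<longrightarrow>
     mean_count (real m) (1 / (6 * real m)) (e m) (real X) ((unturn ^^ s) x) ((rotate_config ^^ s) \<omega>) < \<infinity>)"

definition cone_part :: "nat \<Rightarrow> nat \<Rightarrow> real \<times> real \<Rightarrow> (real \<times> real) set \<Rightarrow> (real \<times> real) set" where
  "cone_part m s x E = {a \<in> visible_part x E. (unturn ^^ s) a \<in> cone (real m) ((unturn ^^ s) x)}"

text \<open>Directions parallel to the axes belong to no cone, but each contains at most one visible
  point.\<close>

definition axis_part :: "nat \<Rightarrow> real \<times> real \<Rightarrow> (real \<times> real) set \<Rightarrow> (real \<times> real) set" where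
  "axis_part s x E = {a \<in> visible_part x E. fst ((unturn ^^ s) a) = fst ((unturn ^^ s) x) \<and>
     snd ((unturn ^^ s) x) < snd ((unturn ^^ s) a)}"

lemma hausdorff1_cone_part_finite:
  assumes fin: "visible_counts_finite e x \<omega>" and "x \<notin> percolation_set \<omega>" "1 \<le> m" "0 < e m"
  shows "hausdorff1 (cone_part m s x (percolation_set \<omega>)) < \<infinity>"
proof -
  define V where "V = visible_part ((unturn ^^ s) x) (percolation_set ((rotate_config ^^ s) \<omega>)) \<inter>
    cone (real m) ((unturn ^^ s) x)"
  obtain X :: nat where X: "\<bar>snd ((unturn ^^ s) x)\<bar> \<le> real X"
    using real_arch_simple by blast
  have "hausdorff1 V < \<infinity>"
    unfolding V_def
  proof (rule hausdorff1_visible_cone_finite[OF _ _ _ _ X \<open>0 < e m\<close>])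
    show "mean_count (real m) (1 / (6 * real m)) (e m) (real X) ((unturn ^^ s) x) ((rotate_config ^^ s) \<omega>) < \<infinity>"
      using fin \<open>1 \<le> m\<close> unfolding visible_counts_finite_def by blast
  qed (use assms in \<open>auto simp: mem_percolation_set_rotate_funpow\<close>)
  moreover have "hausdorff1 (cone_part m s x (percolation_set \<omega>)) \<le> hausdorff1 V"
  proof -
    have "cone_part m s x (percolation_set \<omega>) \<subseteq> (turn ^^ s) ` V"
    proof
      fix a assume "a \<in> cone_part m s x (percolation_set \<omega>)"
      then have "(unturn ^^ s) a \<in> V"
        by (auto simp: V_def cone_part_def visible_part_rotate_funpow)
      then show "a \<in> (turn ^^ s) ` V"
        by (metis image_eqI turn_unturn_funpow)
    qed
    then have "hausdorff1 (cone_part m s x (percolation_set \<omega>)) \<le> hausdorff1 ((turn ^^ s) ` V)"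
      by (rule hausdorff1_mono)
    also have "\<dots> \<le> hausdorff1 V"
      by (rule hausdorff1_image_le) (simp add: dist_turn_funpow)
    finally show ?thesis .
  qed
  ultimately show ?thesis
    by (rule le_less_trans[rotated])
qed

lemma visible_above_unique:
  fixes a b x :: "real \<times> real"
  assumes "a \<in> visible_part x E" "b \<in> visible_part x E" "fst a = fst x" "fst b = fst x"
    and "snd x < snd a" "snd a \<le> snd b"
  shows "a = b"
proof -
  define t where "t = (snd b - snd a) / (snd b - snd x)"
  have t: "0 \<le> t" "t \<le> 1"
    using assms by (auto simp: t_def divide_le_eq_1)
  have "t * (snd b - snd x) = snd b - snd a"
    using assms by (simp add: t_def)
  then have "a = (1 - t) *\<^sub>R b + t *\<^sub>R x"
    using assms by (intro prod_eqI) (simp_all add: algebra_simps)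
  then have "a \<in> closed_segment b x"
    using t by (auto simp: closed_segment_def)
  then show ?thesis
    using assms(1,2) by (auto simp: visible_part_def)
qed

lemma hausdorff1_axis_part: "hausdorff1 (axis_part s x (percolation_set \<omega>)) = 0"
proof -
  have unique: "a = b" if "a \<in> axis_part s x (percolation_set \<omega>)" "b \<in> axis_part s x (percolation_set \<omega>)"
    "snd ((unturn ^^ s) a) \<le> snd ((unturn ^^ s) b)" for a b
  proof -
    have "(unturn ^^ s) a = (unturn ^^ s) b"
      using that unfolding axis_part_def
      by (intro visible_above_unique[of _ "(unturn ^^ s) x" "percolation_set ((rotate_config ^^ s) \<omega>)"])
         (auto simp: visible_part_rotate_funpow)
    then show ?thesis
      by (metis turn_unturn_funpow)
  qed
  have "\<exists>b. axis_part s x (percolation_set \<omega>) \<subseteq> {b}"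
    using unique by (metis insertCI linear subsetI)
  then show ?thesis
    using hausdorff1_subsingleton by blast
qed

text \<open>The plane without \<open>x\<close> splits into four half-open quadrants, each with one
  of its bounding half-axes, which quarter turns carry into one another.\<close>

lemma visible_direction_cases:
  assumes "a \<noteq> x"
  obtains s where "snd ((unturn ^^ s) x) < snd ((unturn ^^ s) a)" "fst ((unturn ^^ s) x) \<le> fst ((unturn ^^ s) a)"
proof -
  consider "snd x < snd a" "fst x \<le> fst a" | "fst a < fst x" "snd x \<le> snd a"
    | "snd a < snd x" "fst a \<le> fst x" | "fst x < fst a" "snd a \<le> snd x"
    using assms by (metis linorder_not_le nle_le prod_eqI)
  then show ?thesis
  proof cases
    case 1
    then show ?thesis using that[of 0] by simp
  next
    case 2
    then show ?thesis using that[of 1] by (simp add: unturn_def)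
  next
    case 3
    then show ?thesis using that[of 2] by (simp add: unturn_funpow_cases)
  next
    case 4
    then show ?thesis using that[of 3] by (simp add: unturn_funpow_cases)
  qed
qed

lemma mem_cone_eventually:
  assumes "snd x < snd a" "fst x < fst a"
  obtains m :: nat where "1 \<le> m" "a \<in> cone (real m) x"
proof -
  define \<beta> where "\<beta> = slope x a"
  have "0 < \<beta>"
    using assms by (simp add: \<beta>_def slope_def)
  obtain m :: nat where m: "max 1 (max \<beta> (1 / \<beta>)) \<le> real m"
    using real_arch_simple by blast
  then have "1 \<le> m" "\<beta> \<le> real m" "1 / \<beta> \<le> real m"
    by auto
  moreover have "1 / real m \<le> \<beta>"
    using \<open>1 / \<beta> \<le> real m\<close> \<open>0 < \<beta>\<close> \<open>1 \<le> m\<close> by (simp add: field_simps)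
  ultimately show ?thesis
    using that assms by (auto simp: cone_def \<beta>_def)
qed

lemma sigma_finite_visible_part:
  assumes fin: "visible_counts_finite e x \<omega>" and x: "x \<notin> percolation_set \<omega>" and e: "\<And>m. 0 < e m"
  shows "sigma_finite_hausdorff1 (visible_part x (percolation_set \<omega>))"
proof (rule sigma_finite_hausdorff1_countable)
  define \<B> where "\<B> = (\<lambda>(m, s). cone_part (Suc m) s x (percolation_set \<omega>)) ` UNIV \<union>
    (\<lambda>s. axis_part s x (percolation_set \<omega>)) ` UNIV"
  show "countable \<B>"
    by (simp add: \<B>_def)
  show "hausdorff1 B < \<infinity>" if "B \<in> \<B>" for B
    using that hausdorff1_cone_part_finite[OF fin x] e by (auto simp: \<B>_def hausdorff1_axis_part)
  show "visible_part x (percolation_set \<omega>) = \<Union>\<B>"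
  proof
    show "\<Union>\<B> \<subseteq> visible_part x (percolation_set \<omega>)"
      by (auto simp: \<B>_def cone_part_def axis_part_def)
    show "visible_part x (percolation_set \<omega>) \<subseteq> \<Union>\<B>"
    proof
      fix a assume a: "a \<in> visible_part x (percolation_set \<omega>)"
      then have "a \<noteq> x"
        using x by (auto simp: visible_part_def)
      then obtain s where s: "snd ((unturn ^^ s) x) < snd ((unturn ^^ s) a)" "fst ((unturn ^^ s) x) \<le> fst ((unturn ^^ s) a)"
        by (rule visible_direction_cases)
      show "a \<in> \<Union>\<B>"
      proof (cases "fst ((unturn ^^ s) x) = fst ((unturn ^^ s) a)")
        case True
        with s a have "a \<in> axis_part s x (percolation_set \<omega>)"
          by (simp add: axis_part_def)
        then show ?thesis
          by (auto simp: \<B>_def)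
      next
        case False
        with s obtain m where "1 \<le> m" "(unturn ^^ s) a \<in> cone (real m) ((unturn ^^ s) x)"
          using mem_cone_eventually[of "(unturn ^^ s) x" "(unturn ^^ s) a"] by (metis less_le)
        with a have "a \<in> cone_part (Suc (m - 1)) s x (percolation_set \<omega>)"
          by (simp add: cone_part_def)
        then show ?thesis
          unfolding \<B>_def by (intro UnionI[OF UnI1[OF image_eqI[of _ _ "(m - 1, s)"]]]) auto
      qed
    qed
  qed
qed

text \<open>Quarter turns make both coordinates of \<open>x\<close> negative. The unit square then
  lies in a single cone at \<open>x\<close>, which replaces the countable family of cones and
  axes.\<close>

lemma finite_visible_part:
  assumes fin: "visible_counts_finite e x \<omega>" and x: "x \<in> diagonal_region" and e: "\<And>m. 0 < e m"
  shows "hausdorff1 (visible_part x (percolation_set \<omega>)) < \<infinity>"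
proof -
  define E where "E = percolation_set \<omega>"
  have x': "fst x < 0 \<or> 1 < fst x" "snd x < 0 \<or> 1 < snd x"
    using x by (auto simp: diagonal_region_def not_le)
  have "x \<notin> E"
    using x' percolation_set_subset_unit[of \<omega>] by (auto simp: E_def mem_Times_iff)
  have "\<exists>s. fst ((unturn ^^ s) x) < 0 \<and> snd ((unturn ^^ s) x) < 0"
  proof -
    consider "fst x < 0" "snd x < 0" | "1 < fst x" "snd x < 0" | "1 < fst x" "1 < snd x" | "fst x < 0" "1 < snd x"
      using x' by blast
    then show ?thesis
    proof cases
      case 1
      then show ?thesis by (intro exI[of _ 0]) simp
    next
      case 2
      then show ?thesis by (intro exI[of _ 1]) (simp add: unturn_def)
    next
      case 3
      then show ?thesis by (intro exI[of _ 2]) (simp add: unturn_funpow_cases)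
    next
      case 4
      then show ?thesis by (intro exI[of _ 3]) (simp add: unturn_funpow_cases)
    qed
  qed
  then obtain s where s: "fst ((unturn ^^ s) x) < 0" "snd ((unturn ^^ s) x) < 0"
    by blast
  define y where "y = (unturn ^^ s) x"
  \<comment> \<open>The offsets of points of the unit square from \<open>y\<close> range from -fst y
    to 1 - fst y and from -snd y to 1 - snd y; the two quotients bound dy/dx and dx/dy.\<close>
  obtain m :: nat where m: "max 1 (max ((1 - snd y) / - fst y) ((1 - fst y) / - snd y)) \<le> real m"
    using real_arch_simple by blast
  have "visible_part x E \<subseteq> cone_part m s x E"
  proof
    fix a assume a: "a \<in> visible_part x E"
    define b where "b = (unturn ^^ s) a"
    have "b \<in> percolation_set ((rotate_config ^^ s) \<omega>)"
      using a by (auto simp: b_def E_def visible_part_def mem_percolation_set_rotate_funpow)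
    then have b: "0 \<le> fst b" "fst b \<le> 1" "0 \<le> snd b" "snd b \<le> 1"
      using percolation_set_subset_unit[of "(rotate_config ^^ s) \<omega>"] by auto
    have y: "fst y < 0" "snd y < 0"
      using s by (simp_all add: y_def)
    have m': "1 \<le> real m" "1 - snd y \<le> real m * - fst y" "1 - fst y \<le> real m * - snd y"
    proof -
      have "1 \<le> real m" "(1 - snd y) / - fst y \<le> real m" "(1 - fst y) / - snd y \<le> real m"
        using m unfolding max.bounded_iff by blast+
      then show "1 \<le> real m" "1 - snd y \<le> real m * - fst y" "1 - fst y \<le> real m * - snd y"
        using y by (simp_all only: pos_divide_le_eq neg_0_less_iff_less)
    qed
    have "real m * - snd y \<le> real m * (snd b - snd y)" "real m * - fst y \<le> real m * (fst b - fst y)"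
      using b by (intro mult_left_mono; simp)+
    with m' b have "fst b - fst y \<le> real m * (snd b - snd y)" "snd b - snd y \<le> real m * (fst b - fst y)"
      by linarith+
    then have "b \<in> cone (real m) y"
      using b y m' by (auto simp: cone_def slope_def pos_divide_le_eq pos_le_divide_eq mult.commute)
    then show "a \<in> cone_part m s x E"
      using a by (simp add: cone_part_def b_def y_def)
  qed
  then have "hausdorff1 (visible_part x E) \<le> hausdorff1 (cone_part m s x E)"
    by (rule hausdorff1_mono)
  also have "\<dots> < \<infinity>"
    unfolding E_def using m \<open>x \<notin> E\<close> e by (intro hausdorff1_cone_part_finite[OF fin]) (auto simp: E_def)
  finally show ?thesis
    by (simp add: E_def)
qed

text \<open>By continuity the slope stays within a factor 2 on a small surviving square around
  \<open>a\<close>. A blocking square inside it has its centre in this range of directions.\<close>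

lemma visible_part_pos:
  assumes x: "x \<notin> percolation_set \<omega>" and a: "a \<in> percolation_set \<omega>"
    and dir: "0 < slope x a" and e: "\<And>m. 0 < e m"
    and dense: "\<And>k q m. q \<in> grid k \<Longrightarrow> 1 \<le> m \<Longrightarrow> survives (subtree k q \<omega>) \<Longrightarrow>
      somewhere (standard_blocks e m) (subtree k q \<omega>)"
  shows "0 < hausdorff1 (visible_part x (percolation_set \<omega>))"
proof -
  have "snd a \<noteq> snd x"
    using dir by (auto simp: slope_def)
  then have "isCont (slope x) a"
    unfolding slope_def by (intro continuous_intros) auto
  then obtain \<delta> where \<delta>: "0 < \<delta>" "\<And>z. dist z a < \<delta> \<Longrightarrow> dist (slope x z) (slope x a) < slope x a / 2"
    unfolding continuous_at_eps_delta using dir by (metis half_gt_zero)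
  \<comment> \<open>Slopes strictly between half and twice that of \<open>a\<close> are then
    strictly between 1/m and m; the 3 instead of 2 is slack.\<close>
  obtain m :: nat where m: "max 1 (max (2 * slope x a) (3 / slope x a)) \<le> real m"
    using real_arch_simple by blast
  then have m': "1 \<le> m" "2 * slope x a \<le> real m" "3 / slope x a \<le> real m"
    by auto
  obtain k where "(1 / 2) ^ k < \<delta> / 2"
    using real_arch_pow_inv[of "\<delta> / 2" "1 / 2"] \<delta>(1) by auto
  then have k: "2 / 2 ^ k < \<delta>"
    by (simp add: power_one_over)
  obtain q where q: "q \<in> chosen_squares \<omega> k" "a \<in> dyadic_square k q" "survives (subtree k q \<omega>)"
    using a by (rule percolation_set_subtree)
  then have "q \<in> grid k"
    using chosen_squares_subset_grid by blast
  from dense[OF this m'(1) q(3)] obtain n r where r: "r \<in> grid n" "r \<in> chosen_squares (subtree k q \<omega>) n"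
    "standard_blocks e m (subtree n r (subtree k q \<omega>))"
    unfolding somewhere_def by blast
  define c where "c = centre (k + n) (graft n q r)"
  have "c \<in> dyadic_square (k + n) (graft n q r)"
    by (simp add: c_def centre_def mem_dyadic_square_iff)
  then have "c \<in> dyadic_square k q"
    using dyadic_square_ancestor[of k n "graft n q r"] ancestor_graft[OF r(1)] by auto
  then have "dist c a \<le> 2 / 2 ^ k"
    using q(2) diameter_dyadic_square[of k q]
      diameter_bounded_bound[OF compact_imp_bounded[OF compact_dyadic_square], of c k q a] by linarith
  then have "dist (slope x c) (slope x a) < slope x a / 2"
    using k by (intro \<delta>) linarith
  then have c: "slope x a / 2 < slope x c" "slope x c < 2 * slope x a"
    unfolding dist_real_def using dir by linarith+
  show ?thesis
  proof (rule hausdorff1_visible_pos[OF x])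
    show "graft n q r \<in> chosen_squares \<omega> (k + n)"
      using chosen_squares_graft[OF \<open>q \<in> grid k\<close> r(1)] q(1) r(2) by blast
    show "standard_blocks e m (subtree (k + n) (graft n q r) \<omega>)"
      using r(3) subtree_subtree[OF r(1)] by simp
    show "snd (centre (k + n) (graft n q r)) \<noteq> snd x"
    proof
      assume "snd (centre (k + n) (graft n q r)) = snd x"
      then have "slope x c = 0"
        by (simp add: slope_def c_def)
      with c(1) dir show False
        by simp
    qed
    have "3 \<le> real m * slope x a"
      using m'(3) dir by (simp add: pos_divide_le_eq)
    then have "1 / real m \<le> slope x a / 3"
      using m'(1) by (simp add: field_simps)
    then show "1 / real m < slope x (centre (k + n) (graft n q r))"
      using c(1) dir unfolding c_def by linarith
    show "slope x (centre (k + n) (graft n q r)) < real m"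
      using c(2) m'(2) unfolding c_def by linarith
  qed (use m'(1) e in auto)
qed

section \<open>Almost sure statements for fixed points, almost all points and all points\<close>

context fractal_percolation
begin

lemma blocks_imp_survives:
  assumes "blocks m g \<epsilon> \<omega>" "1 \<le> m" "g \<le> 1"
  shows "survives \<omega>"
proof -
  have "crossing_line m g 0 1"
    using assms by (simp add: crossing_line_def)
  from blocksD[OF assms(1) this] have "percolation_set \<omega> \<noteq> {}"
    by (metis empty_iff)
  then show ?thesis
    by (simp add: percolation_set_nonempty_iff)
qed

lemma block_margins:
  obtains e :: "nat \<Rightarrow> real" where "\<And>m. 0 < e m"
    "\<forall>m\<ge>1. 0 < \<P>(\<omega> in M. standard_blocks e m \<omega>)"
proof -
  have "\<forall>m::nat. \<exists>\<epsilon>. 0 < \<epsilon> \<and>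
      (1 \<le> m \<longrightarrow> 0 < \<P>(\<omega> in M. blocks (real m) (1 / (6 * real m)) \<epsilon> \<omega>))"
  proof
    fix m :: nat
    show "\<exists>\<epsilon>. 0 < \<epsilon> \<and> (1 \<le> m \<longrightarrow> 0 < \<P>(\<omega> in M. blocks (real m) (1 / (6 * real m)) \<epsilon> \<omega>))"
    proof (cases "1 \<le> m")
      case True
      then show ?thesis
        using prob_blocks_pos[of "real m" "1 / (6 * real m)"] by auto
    qed (auto intro: exI[of _ 1])
  qed
  from choice[OF this] show ?thesis
    using that by blast
qed

lemma AE_visible_counts_finite:
  assumes "\<forall>m\<ge>1. 0 < \<P>(\<omega> in M. standard_blocks e m \<omega>)"
  shows "AE \<omega> in M. visible_counts_finite e x \<omega>"
  unfolding visible_counts_finite_def AE_all_countable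
proof (intro allI AE_impI)
  fix m s X :: nat assume "1 \<le> m"
  then have "AE \<omega> in M. mean_count (real m) (1 / (6 * real m)) (e m) (real X) ((unturn ^^ s) x) \<omega> < \<infinity>"
    using assms by (intro AE_mean_count_finite) auto
  then show "AE \<omega> in M. mean_count (real m) (1 / (6 * real m)) (e m) (real X) ((unturn ^^ s) x) ((rotate_config ^^ s) \<omega>) < \<infinity>"
    by (rule AE_rotate_funpow)
qed

text \<open>Fubini's theorem turns an almost sure statement for each fixed point into one for almost
  all points, almost surely.\<close>

lemma AE_AE_visible_counts_finite:
  assumes "\<forall>m\<ge>1. 0 < \<P>(\<omega> in M. standard_blocks e m \<omega>)"
  shows "AE \<omega> in M. AE x in lborel. visible_counts_finite e x \<omega>"
proof -
  interpret pair_sigma_finite "lborel :: (real \<times> real) measure" M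
    by unfold_locales
  have [measurable]: "(\<lambda>z. mean_count (real m) (1 / (6 * real m)) (e m) (real X) ((unturn ^^ s) (fst z)) ((rotate_config ^^ s) (snd z)))
      \<in> borel_measurable (lborel \<Otimes>\<^sub>M M)" for m s X
  proof -
    have "(\<lambda>z. ((unturn ^^ s) (fst z), (rotate_config ^^ s) (snd z))) \<in> lborel \<Otimes>\<^sub>M M \<rightarrow>\<^sub>M lborel \<Otimes>\<^sub>M M"
      by measurable
    from measurable_compose[OF this measurable_mean_count_joint] show ?thesis
      by simp
  qed
  have "Measurable.pred (lborel \<Otimes>\<^sub>M M) (\<lambda>z. visible_counts_finite e (fst z) (snd z))"
    unfolding visible_counts_finite_def by measurable
  then have "(AE x in lborel. AE \<omega> in M. visible_counts_finite e x \<omega>) \<longleftrightarrow>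
      (AE \<omega> in M. AE x in lborel. visible_counts_finite e x \<omega>)"
    unfolding pred_def by (rule AE_commute)
  then show ?thesis
    using AE_visible_counts_finite[OF assms] by simp
qed

text \<open>The zero-one law for each of countably many subtrees, rotations and values of
  \<open>m\<close>, so blocking squares are found at once inside every surviving square.\<close>

lemma AE_blocks_dense:
  assumes "\<forall>m\<ge>1. 0 < \<P>(\<omega> in M. standard_blocks e m \<omega>)"
  shows "AE \<omega> in M. \<forall>s k m q. q \<in> grid k \<longrightarrow> 1 \<le> m \<longrightarrow>
    survives (subtree k q ((rotate_config ^^ s) \<omega>)) \<longrightarrow>
    somewhere (standard_blocks e m) (subtree k q ((rotate_config ^^ s) \<omega>))"
  unfolding AE_all_countable
proof (intro allI AE_impI)
  fix s k m :: nat and q :: "nat \<times> nat" assume "q \<in> grid k" "1 \<le> m"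
  have "AE \<omega> in M. survives \<omega> \<longrightarrow> somewhere (standard_blocks e m) \<omega>"
  proof (rule zero_one_law)
    show "survives \<omega>" if "standard_blocks e m \<omega>" for \<omega>
      using that by (rule blocks_imp_survives) (use \<open>1 \<le> m\<close> in auto)
  qed (use assms \<open>1 \<le> m\<close> in auto)
  from AE_subtree[OF \<open>q \<in> grid k\<close> this]
  show "AE \<omega> in M. survives (subtree k q ((rotate_config ^^ s) \<omega>)) \<longrightarrow>
      somewhere (standard_blocks e m) (subtree k q ((rotate_config ^^ s) \<omega>))"
    by (rule AE_rotate_funpow)
qed

text \<open>The density of blocking squares mentions no viewpoint, so one null set of configurations
  serves all \<open>x\<close>.\<close>

lemma AE_visible_part_pos:
  assumes e: "\<And>m. 0 < e m" and "\<forall>m\<ge>1. 0 < \<P>(\<omega> in M. standard_blocks e m \<omega>)"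
  shows "AE \<omega> in M. \<forall>x a. x \<notin> percolation_set \<omega> \<longrightarrow> a \<in> percolation_set \<omega> \<longrightarrow>
    fst x \<noteq> fst a \<and> snd x \<noteq> snd a \<longrightarrow> 0 < hausdorff1 (visible_part x (percolation_set \<omega>))"
  using AE_blocks_dense[OF assms(2)]
proof (eventually_elim, intro allI impI)
  fix \<omega> :: config and x a :: "real \<times> real"
  assume dense: "\<forall>s k m q. q \<in> grid k \<longrightarrow> 1 \<le> m \<longrightarrow> survives (subtree k q ((rotate_config ^^ s) \<omega>)) \<longrightarrow>
      somewhere (standard_blocks e m) (subtree k q ((rotate_config ^^ s) \<omega>))"
    and xa: "x \<notin> percolation_set \<omega>" "a \<in> percolation_set \<omega>" "fst x \<noteq> fst a \<and> snd x \<noteq> snd a"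
  \<comment> \<open>A quarter turn replaces the slope by its negative reciprocal.\<close>
  have "0 < slope x a \<or> 0 < slope (unturn x) (unturn a)"
    using xa(3) by (auto simp: slope_def unturn_def zero_less_divide_iff)
  then obtain s where s: "0 < slope ((unturn ^^ s) x) ((unturn ^^ s) a)"
    by (metis funpow_0 funpow_simps_right(2) o_apply One_nat_def)
  have "0 < hausdorff1 (visible_part ((unturn ^^ s) x) (percolation_set ((rotate_config ^^ s) \<omega>)))"
    using dense xa e
    by (intro visible_part_pos[OF _ _ s, of _ e]) (auto simp: mem_percolation_set_rotate_funpow)
  also have "\<dots> \<le> hausdorff1 (visible_part x (percolation_set \<omega>))"
    unfolding visible_part_rotate_funpow by (rule hausdorff1_image_le) (simp add: dist_unturn_funpow)
  finally show "0 < hausdorff1 (visible_part x (percolation_set \<omega>))" .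
qed

end

lemma AE_lborel_not_on_axes:
  fixes a :: "real \<times> real"
  shows "AE x in lborel. fst x \<noteq> fst a \<and> snd x \<noteq> snd a"
proof -
  have "{x. x \<bullet> k = c} \<in> null_sets lborel" if "k \<in> Basis" for k :: "real \<times> real" and c
  proof -
    have "closed {x :: real \<times> real. x \<bullet> k = c}"
      by (intro closed_Collect_eq continuous_intros)
    then show ?thesis
      using negligible_standard_hyperplane[OF that, of c]
      by (simp add: negligible_iff_null_sets null_sets_completion_iff borel_closed)
  qed
  from this[of "(1, 0)" "fst a"] this[of "(0, 1)" "snd a"]
  have "{x :: real \<times> real. fst x = fst a} \<in> null_sets lborel" "{x :: real \<times> real. snd x = snd a} \<in> null_sets lborel"
    by (auto simp: Basis_prod_def inner_prod_def)
  from AE_not_in[OF this(1)] AE_not_in[OF this(2)] show ?thesis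
    by eventually_elim simp
qed

theorem theorem4p3:
  fixes p :: real
  assumes "1 / 2 < p" and "p < 1"
  shows "(\<forall>x \<in> diagonal_region.
            AE \<omega> in percolation p. hausdorff1 (visible_part x (percolation_set \<omega>)) < \<infinity>)
       \<and> (\<forall>x. AE \<omega> in percolation p. x \<notin> percolation_set \<omega> \<longrightarrow>
            sigma_finite_hausdorff1 (visible_part x (percolation_set \<omega>)))
       \<and> (AE \<omega> in percolation p. percolation_set \<omega> \<noteq> {} \<longrightarrow>
            (AE x in lborel. x \<in> diagonal_region \<longrightarrow>
               0 < hausdorff1 (visible_part x (percolation_set \<omega>)) \<and>
               hausdorff1 (visible_part x (percolation_set \<omega>)) < \<infinity>) \<and>
            (AE x in lborel. x \<notin> percolation_set \<omega> \<longrightarrow>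
               0 < hausdorff1 (visible_part x (percolation_set \<omega>)) \<and>
               sigma_finite_hausdorff1 (visible_part x (percolation_set \<omega>))))"
proof -
  interpret prob_space "percolation p"
    by (rule prob_space_percolation)
  interpret fractal_percolation p
    by unfold_locales (use assms in auto)
  obtain e :: "nat \<Rightarrow> real" where e: "\<And>m. 0 < e m"
    and pos: "\<forall>m\<ge>1. 0 < \<P>(\<omega> in M. standard_blocks e m \<omega>)"
    using block_margins by blast
  note fin = AE_visible_counts_finite[of e, OF pos]
  note AE = AE_AE_visible_counts_finite[of e, OF pos] AE_visible_part_pos[of e, OF e pos]
  show ?thesis
  proof (intro conjI ballI allI, goal_cases)
    case (1 x)
    from fin[of x] show ?case
      by eventually_elim (rule finite_visible_part[OF _ 1 e])
  next
    case (2 x)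
    from fin[of x] show ?case
      by eventually_elim (blast intro: sigma_finite_visible_part e)
  next
    case 3
    from AE show ?case
    proof (eventually_elim, intro impI conjI, goal_cases)
      case (1 \<omega>)
      then obtain a where a: "a \<in> percolation_set \<omega>"
        by blast
      \<comment> \<open>Positivity uses a point of the set sharing no coordinate with
        \<open>x\<close>; one fixed \<open>a\<close> serves almost all \<open>x\<close>.\<close>
      from 1(1) AE_lborel_not_on_axes[of a] show ?case
      proof eventually_elim
        case (elim x)
        have "x \<notin> percolation_set \<omega>" if "x \<in> diagonal_region"
          using that percolation_set_subset_unit[of \<omega>] by (auto simp: diagonal_region_def)
        then show ?case
          using 1(2) a elim finite_visible_part[OF elim(1) _ e] by blast
      qed
    next
      case (2 \<omega>)
      then obtain a where a: "a \<in> percolation_set \<omega>"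
        by blast
      from 2(1) AE_lborel_not_on_axes[of a] show ?case
      proof eventually_elim
        case (elim x)
        then show ?case
          using 2(2) a sigma_finite_visible_part[OF elim(1) _ e] by blast
      qed
    qed
  qed
qed

end
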